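(* Suppose $T$ is a complete NSOP$_1$ theory. If $M\models T$ and $p\in S(M)$, then the set of elementary substructures $N\prec M$ with $|N|=|T|$ such that $p$ does not Kim-divide over $N$ contains a club subset of $[M]^{|T|}$.
   Context: A formula $\varphi(x;y)$ has SOP$_1$ if there is a tree $\langle a_\eta:\eta\in 2^{<\omega}\rangle$ such that for every $\eta\in 2^\omega$ the set $\{\varphi(x;a_{\eta\restriction n}):n<\omega\}$ is consistent, and for all $\nu,\eta\in 2^{<\omega}$ with $\nu^\frown\langle 0\rangle\trianglelefteq\eta$, $\{\varphi(x;a_\eta),\varphi(x;a_{\nu^\frown\langle1\rangle})\}$ is inconsistent; $T$ is NSOP$_1$ if no formula has SOP$_1$ modulo $T$. Work in a monster model $\mathbb{M}$. For $N\models T$, a global type $q$ is $N$-invariant if $b\equiv_N b'$ implies ($\varphi(x;b)\in q\iff\varphi(x;b')\in q$). A Morley sequence in $q$ over $N$ is $\langle b_i:i<\omega\rangle$ with $b_i\models q|_{Nb_{<i}}$. A formula $\varphi(x;b)$ Kim-divides over $N$ if there are a global $N$-invariant $q\supseteq\operatorname{tp}(b/N)$ and $k<\omega$ such that for every Morley sequence $\langle b_i\rangle$ in $q$ over $N$, $\{\varphi(x;b_i):i<\omega\}$ is $k$-inconsistent. A type Kim-divides over $N$ if it contains a formula that Kim-divides over $N$. $[X]^\kappa=\{Y\subseteq X:|Y|=\kappa\}$; $C\subseteq[X]^\kappa$ is club if it is unbounded (every $Y\in[X]^\kappa$ is contained in some member of $C$) and closed (the union of any chain of members of $C$ of length $\le\kappa$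 is in $C$). *)

theory Defs
  imports Main "HOL-Library.Sublist"
begin

section \<open>First-order languages, structures and satisfaction\<close>

record ('f, 'r) lang =
  funs :: "'f set"
  rels :: "'r set"
  farity :: "'f \<Rightarrow> nat"
  rarity :: "'r \<Rightarrow> nat"

datatype 'f tm = Var nat | Fn 'f "'f tm list"

text \<open>
  Variables are de Bruijn indices into an assignment that is a list: a quantifier binds index 0
  and shifts the others.  A formula all of whose free indices are below n is a formula
  in the n variables x_0, ..., x_(n-1), and a partitioned formula with n variables x and
  m variables y is a formula in n + m variables, evaluated at the concatenation a @ b.
\<close>

datatype ('f, 'r) fm =
    Eq "'f tm" "'f tm"
  | Rel 'r "'f tm list"
  | Neg "('f, 'r) fm"
  | Conj "('f, 'r) fm" "('f, 'r) fm"
  | Ex "('f, 'r) fm"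

fun is_tm :: "('f, 'r) lang \<Rightarrow> nat \<Rightarrow> 'f tm \<Rightarrow> bool" where
  "is_tm L n (Var i) \<longleftrightarrow> i < n"
| "is_tm L n (Fn f ts) \<longleftrightarrow> f \<in> funs L \<and> length ts = farity L f \<and> (\<forall>t\<in>set ts. is_tm L n t)"

fun is_fm :: "('f, 'r) lang \<Rightarrow> nat \<Rightarrow> ('f, 'r) fm \<Rightarrow> bool" where
  "is_fm L n (Eq s t) \<longleftrightarrow> is_tm L n s \<and> is_tm L n t"
| "is_fm L n (Rel r ts) \<longleftrightarrow> r \<in> rels L \<and> length ts = rarity L r \<and> (\<forall>t\<in>set ts. is_tm L n t)"
| "is_fm L n (Neg \<phi>) \<longleftrightarrow> is_fm L n \<phi>"
| "is_fm L n (Conj \<phi> \<psi>) \<longleftrightarrow> is_fm L n \<phi> \<and> is_fm L n \<psi>"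
| "is_fm L n (Ex \<phi>) \<longleftrightarrow> is_fm L (Suc n) \<phi>"

abbreviation sentence :: "('f, 'r) lang \<Rightarrow> ('f, 'r) fm \<Rightarrow> bool" where
  "sentence L \<equiv> is_fm L 0"

record ('f, 'r, 'a) struct =
  univ :: "'a set"
  fint :: "'f \<Rightarrow> 'a list \<Rightarrow> 'a"
  rint :: "'r \<Rightarrow> 'a list \<Rightarrow> bool"

definition tuples :: "nat \<Rightarrow> 'a set \<Rightarrow> 'a list set" where
  "tuples n A = {a. length a = n \<and> set a \<subseteq> A}"

definition is_struct :: "('f, 'r) lang \<Rightarrow> ('f, 'r, 'a) struct \<Rightarrow> bool" where
  "is_struct L M \<longleftrightarrow> univ M \<noteq> {} \<and>
    (\<forall>f\<in>funs L. \<forall>a\<in>tuples (farity L f) (univ M). fint M f a \<in> univ M)"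

primrec tm_val :: "('f, 'r, 'a) struct \<Rightarrow> 'a list \<Rightarrow> 'f tm \<Rightarrow> 'a" where
  "tm_val M e (Var i) = e ! i"
| "tm_val M e (Fn f ts) = fint M f (map (tm_val M e) ts)"

fun sat :: "('f, 'r, 'a) struct \<Rightarrow> 'a list \<Rightarrow> ('f, 'r) fm \<Rightarrow> bool" where
  "sat M e (Eq s t) \<longleftrightarrow> tm_val M e s = tm_val M e t"
| "sat M e (Rel r ts) \<longleftrightarrow> rint M r (map (tm_val M e) ts)"
| "sat M e (Neg \<phi>) \<longleftrightarrow> \<not> sat M e \<phi>"
| "sat M e (Conj \<phi> \<psi>) \<longleftrightarrow> sat M e \<phi> \<and> sat M e \<psi>"
| "sat M e (Ex \<phi>) \<longleftrightarrow> (\<exists>a\<in>univ M. sat M (a # e) \<phi>)"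

definition model :: "('f, 'r) lang \<Rightarrow> ('f, 'r) fm set \<Rightarrow> ('f, 'r, 'a) struct \<Rightarrow> bool" where
  "model L T M \<longleftrightarrow> is_struct L M \<and> (\<forall>\<phi>\<in>T. sat M [] \<phi>)"

text \<open>
  Satisfiability and logical consequence range over structures whose universe is a subset of the
  type of formulas.  By downward Loewenheim-Skolem this is no restriction: a satisfiable set of
  L-sentences has a model of cardinality at most the number of L-formulas.
\<close>

definition satisfiable :: "('f, 'r) lang \<Rightarrow> ('f, 'r) fm set \<Rightarrow> bool" where
  "satisfiable L T \<longleftrightarrow> (\<exists>A :: ('f, 'r, ('f, 'r) fm) struct. model L T A)"

definition entails :: "('f, 'r) lang \<Rightarrow> ('f, 'r) fm set \<Rightarrow> ('f, 'r) fm \<Rightarrow> bool" where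
  "entails L T \<phi> \<longleftrightarrow> (\<forall>A :: ('f, 'r, ('f, 'r) fm) struct. model L T A \<longrightarrow> sat A [] \<phi>)"

definition complete_theory :: "('f, 'r) lang \<Rightarrow> ('f, 'r) fm set \<Rightarrow> bool" where
  "complete_theory L T \<longleftrightarrow> (\<forall>\<phi>\<in>T. sentence L \<phi>) \<and> satisfiable L T \<and>
    (\<forall>\<phi>. sentence L \<phi> \<longrightarrow> entails L T \<phi> \<or> entails L T (Neg \<phi>))"

text \<open>The cardinal |T|, by the usual convention the number of L-formulas, i.e. |L| + aleph_0.\<close>

definition theory_card :: "('f, 'r) lang \<Rightarrow> ('f, 'r) fm rel" where
  "theory_card L = card_of {\<phi>. \<exists>n. is_fm L n \<phi>}"

definition elem_substruct ::
    "('f, 'r) lang \<Rightarrow> ('f, 'r, 'a) struct \<Rightarrow> ('f, 'r, 'a) struct \<Rightarrow> bool" where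
  "elem_substruct L N M \<longleftrightarrow> is_struct L N \<and> is_struct L M \<and> univ N \<subseteq> univ M \<and>
    (\<forall>f\<in>funs L. \<forall>a\<in>tuples (farity L f) (univ N). fint N f a = fint M f a) \<and>
    (\<forall>r\<in>rels L. \<forall>a\<in>tuples (rarity L r) (univ N). rint N r a = rint M r a) \<and>
    (\<forall>n \<phi> a. is_fm L n \<phi> \<longrightarrow> a \<in> tuples n (univ N) \<longrightarrow> sat N a \<phi> = sat M a \<phi>)"

abbreviation restr :: "('f, 'r, 'a) struct \<Rightarrow> 'a set \<Rightarrow> ('f, 'r, 'a) struct" where
  "restr M A \<equiv> M\<lparr>univ := A\<rparr>"


section \<open>Types and the monster model\<close>

text \<open>
  A formula with parameters is a pair (phi, b), read as phi(x; b).
  A set of such formulas is consistent if it is finitely satisfiable in the ambient (monster)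
  model, i.e. consistent with its elementary diagram.
\<close>

type_synonym ('f, 'r, 'a) pfm = "('f, 'r) fm \<times> 'a list"

definition pfms :: "('f, 'r) lang \<Rightarrow> nat \<Rightarrow> 'a set \<Rightarrow> ('f, 'r, 'a) pfm set" where
  "pfms L n A = {(\<phi>, b). is_fm L (n + length b) \<phi> \<and> set b \<subseteq> A}"

definition realizes ::
    "('f, 'r, 'a) struct \<Rightarrow> 'a list \<Rightarrow> ('f, 'r, 'a) pfm set \<Rightarrow> bool" where
  "realizes MM a \<Gamma> \<longleftrightarrow> (\<forall>(\<phi>, b)\<in>\<Gamma>. sat MM (a @ b) \<phi>)"

definition consistent ::
    "('f, 'r, 'a) struct \<Rightarrow> nat \<Rightarrow> ('f, 'r, 'a) pfm set \<Rightarrow> bool" where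
  "consistent MM n \<Gamma> \<longleftrightarrow>
    (\<forall>\<Delta>. \<Delta> \<subseteq> \<Gamma> \<longrightarrow> finite \<Delta> \<longrightarrow> (\<exists>a\<in>tuples n (univ MM). realizes MM a \<Delta>))"

definition complete_types ::
    "('f, 'r) lang \<Rightarrow> ('f, 'r, 'a) struct \<Rightarrow> nat \<Rightarrow> 'a set \<Rightarrow> ('f, 'r, 'a) pfm set set" where
  "complete_types L MM n A = {p. p \<subseteq> pfms L n A \<and> consistent MM n p \<and>
    (\<forall>(\<phi>, b)\<in>pfms L n A. (\<phi>, b) \<in> p \<or> (Neg \<phi>, b) \<in> p)}"

definition tp ::
    "('f, 'r) lang \<Rightarrow> ('f, 'r, 'a) struct \<Rightarrow> 'a list \<Rightarrow> 'a set \<Rightarrow> ('f, 'r, 'a) pfm set" where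
  "tp L MM a A = {(\<phi>, b) \<in> pfms L (length a) A. sat MM (a @ b) \<phi>}"

definition type_restr :: "('f, 'r, 'a) pfm set \<Rightarrow> 'a set \<Rightarrow> ('f, 'r, 'a) pfm set" where
  "type_restr q A = {(\<phi>, b) \<in> q. set b \<subseteq> A}"

definition saturated ::
    "('f, 'r) lang \<Rightarrow> 'k rel \<Rightarrow> ('f, 'r, 'a) struct \<Rightarrow> bool" where
  "saturated L \<kappa> MM \<longleftrightarrow> (\<forall>A n. A \<subseteq> univ MM \<longrightarrow> (card_of A, \<kappa>) \<in> ordLess \<longrightarrow>
    (\<forall>p\<in>complete_types L MM n A. \<exists>a\<in>tuples n (univ MM). realizes MM a p))"

definition automorphism ::
    "('f, 'r) lang \<Rightarrow> ('f, 'r, 'a) struct \<Rightarrow> ('a \<Rightarrow> 'a) \<Rightarrow> bool" where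
  "automorphism L MM \<sigma> \<longleftrightarrow> bij_betw \<sigma> (univ MM) (univ MM) \<and>
    (\<forall>f\<in>funs L. \<forall>a\<in>tuples (farity L f) (univ MM). \<sigma> (fint MM f a) = fint MM f (map \<sigma> a)) \<and>
    (\<forall>r\<in>rels L. \<forall>a\<in>tuples (rarity L r) (univ MM). rint MM r a = rint MM r (map \<sigma> a))"

definition partial_elementary ::
    "('f, 'r) lang \<Rightarrow> ('f, 'r, 'a) struct \<Rightarrow> 'a set \<Rightarrow> ('a \<Rightarrow> 'a) \<Rightarrow> bool" where
  "partial_elementary L MM A g \<longleftrightarrow> A \<subseteq> univ MM \<and> g ` A \<subseteq> univ MM \<and>
    (\<forall>n \<phi> a. is_fm L n \<phi> \<longrightarrow> a \<in> tuples n A \<longrightarrow> sat MM a \<phi> = sat MM (map g a) \<phi>)"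

definition strongly_homogeneous ::
    "('f, 'r) lang \<Rightarrow> 'k rel \<Rightarrow> ('f, 'r, 'a) struct \<Rightarrow> bool" where
  "strongly_homogeneous L \<kappa> MM \<longleftrightarrow>
    (\<forall>A g. partial_elementary L MM A g \<longrightarrow> (card_of A, \<kappa>) \<in> ordLess \<longrightarrow>
      (\<exists>\<sigma>. automorphism L MM \<sigma> \<and> (\<forall>a\<in>A. \<sigma> a = g a)))"

definition monster ::
    "('f, 'r) lang \<Rightarrow> ('f, 'r) fm set \<Rightarrow> 'k rel \<Rightarrow> ('f, 'r, 'a) struct \<Rightarrow> bool" where
  "monster L T \<kappa> MM \<longleftrightarrow> model L T MM \<and> Card_order \<kappa> \<and> (theory_card L, \<kappa>) \<in> ordLess \<and>
    saturated L \<kappa> MM \<and> strongly_homogeneous L \<kappa> MM"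

text \<open>The models over which one works: elementary submodels of the monster of size below kappa.\<close>

definition small_model ::
    "('f, 'r) lang \<Rightarrow> ('f, 'r) fm set \<Rightarrow> 'k rel \<Rightarrow> ('f, 'r, 'a) struct \<Rightarrow> 'a set \<Rightarrow> bool" where
  "small_model L T \<kappa> MM M \<longleftrightarrow> model L T (restr MM M) \<and> elem_substruct L (restr MM M) MM \<and>
    (card_of M, \<kappa>) \<in> ordLess"


section \<open>SOP1\<close>

text \<open>
  Nodes of the binary tree are boolean lists (False = 0, True = 1), branches are functions
  on nat.  The formula has n object variables x and m parameter variables y.
\<close>

definition has_SOP1 ::
    "('f, 'r) lang \<Rightarrow> ('f, 'r, 'a) struct \<Rightarrow> nat \<Rightarrow> nat \<Rightarrow> ('f, 'r) fm \<Rightarrow> bool" where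
  "has_SOP1 L MM n m \<phi> \<longleftrightarrow> is_fm L (n + m) \<phi> \<and>
    (\<exists>a :: bool list \<Rightarrow> 'a list.
      (\<forall>\<eta>. a \<eta> \<in> tuples m (univ MM)) \<and>
      (\<forall>\<eta> :: nat \<Rightarrow> bool. consistent MM n {(\<phi>, a (map \<eta> [0..<k])) | k. True}) \<and>
      (\<forall>\<nu> \<eta>. prefix (\<nu> @ [False]) \<eta> \<longrightarrow>
        \<not> consistent MM n {(\<phi>, a \<eta>), (\<phi>, a (\<nu> @ [True]))}))"

definition NSOP1 :: "('f, 'r) lang \<Rightarrow> ('f, 'r, 'a) struct \<Rightarrow> bool" where
  "NSOP1 L MM \<longleftrightarrow> \<not> (\<exists>n m \<phi>. has_SOP1 L MM n m \<phi>)"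


section \<open>Kim-dividing\<close>

definition invariant_type ::
    "('f, 'r) lang \<Rightarrow> ('f, 'r, 'a) struct \<Rightarrow> nat \<Rightarrow> 'a set \<Rightarrow> ('f, 'r, 'a) pfm set \<Rightarrow> bool" where
  "invariant_type L MM m N q \<longleftrightarrow> q \<in> complete_types L MM m (univ MM) \<and>
    (\<forall>b b'. set b \<subseteq> univ MM \<longrightarrow> set b' \<subseteq> univ MM \<longrightarrow> length b = length b' \<longrightarrow>
      tp L MM b N = tp L MM b' N \<longrightarrow>
      (\<forall>\<phi>. is_fm L (m + length b) \<phi> \<longrightarrow> ((\<phi>, b) \<in> q \<longleftrightarrow> (\<phi>, b') \<in> q)))"

definition Morley_seq ::
    "('f, 'r, 'a) struct \<Rightarrow> nat \<Rightarrow> 'a set \<Rightarrow> ('f, 'r, 'a) pfm set \<Rightarrow> (nat \<Rightarrow> 'a list) \<Rightarrow> bool" where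
  "Morley_seq MM m N q b \<longleftrightarrow> (\<forall>i. b i \<in> tuples m (univ MM) \<and>
    realizes MM (b i) (type_restr q (N \<union> (\<Union>j<i. set (b j)))))"

text \<open>
  k-inconsistency is that of the indexed family: instances at k distinct indices are jointly
  inconsistent, even when the sequence b has repetitions.
\<close>

definition k_inconsistent ::
    "('f, 'r, 'a) struct \<Rightarrow> nat \<Rightarrow> nat \<Rightarrow> ('f, 'r) fm \<Rightarrow> (nat \<Rightarrow> 'a list) \<Rightarrow> bool" where
  "k_inconsistent MM n k \<phi> b \<longleftrightarrow>
    (\<forall>I. finite I \<longrightarrow> card I = k \<longrightarrow> \<not> consistent MM n {(\<phi>, b i) | i. i \<in> I})"

definition Kim_divides ::
    "('f, 'r) lang \<Rightarrow> ('f, 'r, 'a) struct \<Rightarrow> nat \<Rightarrow> 'a set \<Rightarrow> ('f, 'r, 'a) pfm \<Rightarrow> bool" where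
  "Kim_divides L MM n N = (\<lambda>(\<phi>, b).
    \<exists>q k. invariant_type L MM (length b) N q \<and> tp L MM b N \<subseteq> q \<and>
      (\<forall>b'. Morley_seq MM (length b) N q b' \<longrightarrow> k_inconsistent MM n k \<phi> b'))"

definition type_Kim_divides ::
    "('f, 'r) lang \<Rightarrow> ('f, 'r, 'a) struct \<Rightarrow> nat \<Rightarrow> 'a set \<Rightarrow> ('f, 'r, 'a) pfm set \<Rightarrow> bool" where
  "type_Kim_divides L MM n N p \<longleftrightarrow> (\<exists>\<psi>\<in>p. Kim_divides L MM n N \<psi>)"


section \<open>Clubs\<close>

definition subsets_of_card :: "'a set \<Rightarrow> 'c rel \<Rightarrow> 'a set set" where
  "subsets_of_card X \<mu> = {Y. Y \<subseteq> X \<and> (card_of Y, \<mu>) \<in> ordIso}"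

text \<open>
  Chains are nonempty sets of at most mu members of C, linearly ordered by inclusion; each has a
  cofinal well-ordered subchain of length at most mu, with the same union.
\<close>

definition club :: "'a set \<Rightarrow> 'c rel \<Rightarrow> 'a set set \<Rightarrow> bool" where
  "club X \<mu> C \<longleftrightarrow> C \<subseteq> subsets_of_card X \<mu> \<and>
    (\<forall>Y\<in>subsets_of_card X \<mu>. \<exists>Z\<in>C. Y \<subseteq> Z) \<and>
    (\<forall>D. D \<subseteq> C \<longrightarrow> D \<noteq> {} \<longrightarrow> chain\<^sub>\<subseteq> D \<longrightarrow> (card_of D, \<mu>) \<in> ordLeq \<longrightarrow> \<Union>D \<in> C)"

end

theory Submission
  imports Defs
begin

text \<open>
  If the good submodels contain no club, the bad ones form a positive (stationary) set, and Fodor's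
  lemma makes the Kim-dividing formula \<open>\<phi>(x; b\<^sub>N) \<in> p\<close> independent of \<open>N\<close> up to the parameter.  By Kim's
  lemma for NSOP1 theories the dividing is witnessed by a coheir of \<open>tp(b\<^sub>N/N)\<close>, given by an ultrafilter
  on \<open>N\<close>.  Choose alternately a tuple \<open>d\<^sub>i \<in> N\<close> approximating this coheir, constant on a smaller positive
  set by pressing down, and \<open>b\<^sub>i = b\<^sub>N\<close> for some \<open>N\<close> in that set.  Then \<open>d\<^sub>i\<close> and \<open>b\<^sub>i\<close> have (approximately)
  the same type over the earlier tuples, the \<open>\<phi>(x; b\<^sub>i)\<close> all lie in \<open>p\<close>, and the \<open>\<phi>(x; d\<^sub>i)\<close> are
  \<open>k\<close>-inconsistent.  Such an array gives SOP1.
\<close>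

section \<open>Ultrafilters\<close>

text \<open>Kim-dividing is witnessed by some invariant type, and nothing ties its Morley sequences
  to tuples of \<open>N\<close>. A coheir is needed because every large set of its ultrafilter
  contains a tuple of \<open>N\<close> itself: this makes the choice of \<open>d\<close> regressive
  in \<open>N\<close>, so that pressing down applies. Kim's lemma is what permits the change of
  witness. The price is that a tuple of \<open>N\<close> can meet only finitely many conditions at a
  time, so each array is approximate and finite, and compactness repairs this afterwards. The
  inconsistency is carried along as that of an initial segment of fixed length \<open>K\<close> of a
  Morley sequence, whose terms are exchanged for tuples \<open>d\<close> one at a time, the last
  remaining one first. Equality of types inside an array is expressed by automorphisms fixing the
  earlier entries, since the binary tree is obtained by composing them. Stationarity is tested only
  against closure under one set-valued function of finite tuples: the sets closed under such a
  function form a club, and up to |T| such functions merge into one, so no general theory of clubs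
  is required.\<close>

definition ultra :: "'x set set \<Rightarrow> bool" where
  "ultra U \<longleftrightarrow> {} \<notin> U \<and> (\<forall>A B. A \<in> U \<longrightarrow> A \<subseteq> B \<longrightarrow> B \<in> U) \<and>
    (\<forall>A\<in>U. \<forall>B\<in>U. A \<inter> B \<in> U) \<and> (\<forall>A. A \<in> U \<or> - A \<in> U)"

text \<open>Zorn's lemma applies to the families \<open>G\<close> for which
  \<open>F \<union> G\<close> has the finite intersection property. By maximality a set outside
  \<open>G\<close> is disjoint from a finite intersection of members of \<open>G\<close>, and this
  yields the closure properties of \<open>ultra\<close>.\<close>

lemma ultra_exists:
  fixes F :: "'x set set"
  assumes fip: "\<And>G. finite G \<Longrightarrow> G \<subseteq> F \<Longrightarrow> \<Inter>G \<noteq> {}"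
  shows "\<exists>U. ultra U \<and> F \<subseteq> U"
proof -
  define A where "A = {G. \<forall>H. finite H \<longrightarrow> H \<subseteq> F \<union> G \<longrightarrow> \<Inter>H \<noteq> {}}"
  have "\<Union>C \<in> A" if C: "subset.chain A C" for C
  proof (cases "C = {}")
    case True
    then show ?thesis using fip by (simp add: A_def)
  next
    case False
    have "\<Inter>H \<noteq> {}" if H: "finite H" "H \<subseteq> F \<union> \<Union>C" for H
    proof -
      have "finite (H - F)" "H - F \<subseteq> \<Union>C" using H by auto
      then obtain B where B: "B \<in> C" "H - F \<subseteq> B"
        by (rule finite_subset_Union_chain[OF _ _ False C])
      have "B \<in> A" using B C by (auto simp: subset_chain_def)
      moreover have "H \<subseteq> F \<union> B" using B by auto
      ultimately show ?thesis using H(1) by (simp add: A_def)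
    qed
    then show ?thesis by (simp add: A_def)
  qed
  then have "\<exists>G\<in>A. \<forall>X\<in>A. G \<subseteq> X \<longrightarrow> X = G" by (rule subset_Zorn')
  then obtain G where G: "G \<in> A" and max: "\<And>X. X \<in> A \<Longrightarrow> G \<subseteq> X \<Longrightarrow> X = G"
    by blast
  have fipG: "\<Inter>H \<noteq> {}" if "finite H" "H \<subseteq> F \<union> G" for H
    using G that by (simp add: A_def)
  have "F \<union> G \<in> A" using G by (simp add: A_def)
  then have FG: "F \<subseteq> G" using max[of "F \<union> G"] by blast
  have key: "\<exists>H. finite H \<and> H \<subseteq> G \<and> B \<inter> \<Inter>H = {}" if B: "B \<notin> G" for B
  proof -
    have "insert B G \<notin> A" using max[of "insert B G"] B by auto
    then obtain H where H: "finite H" "H \<subseteq> F \<union> insert B G" "\<Inter>H = {}"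
      by (simp add: A_def) blast
    have "B \<inter> \<Inter>(H - {B}) \<subseteq> \<Inter>H" by fastforce
    moreover have "H - {B} \<subseteq> G" using H(2) FG by fast
    ultimately show ?thesis using H(1,3) by (intro exI[of _ "H - {B}"]) simp
  qed
  have 0: "\<And>H. finite H \<Longrightarrow> H \<subseteq> G \<Longrightarrow> \<Inter>H \<noteq> {}" using fipG by blast
  have "{} \<notin> G"
  proof
    assume "{} \<in> G"
    then show False using 0[of "{{}}"] by simp
  qed
  moreover have "Y \<in> G" if "X \<in> G" "X \<subseteq> Y" for X Y
  proof (rule ccontr)
    assume "Y \<notin> G"
    from key[OF this] obtain H where H: "finite H" "H \<subseteq> G" "Y \<inter> \<Inter>H = {}"
      by (elim exE conjE)
    then have "\<Inter>(insert X H) = {}" using that(2) by (simp add: disjoint_iff) blast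
    then show False using 0[of "insert X H"] H(1,2) that(1) by simp
  qed
  moreover have "X \<inter> Y \<in> G" if "X \<in> G" "Y \<in> G" for X Y
  proof (rule ccontr)
    assume "X \<inter> Y \<notin> G"
    from key[OF this] obtain H where H: "finite H" "H \<subseteq> G" "X \<inter> Y \<inter> \<Inter>H = {}"
      by (elim exE conjE)
    then have "\<Inter>(insert X (insert Y H)) = {}" by (simp add: Int_assoc)
    then show False using 0[of "insert X (insert Y H)"] H(1,2) that by simp
  qed
  moreover have "X \<in> G \<or> - X \<in> G" for X
  proof (rule ccontr)
    assume "\<not> ?thesis"
    then have a: "X \<notin> G" "- X \<notin> G" by simp_all
    from key[OF a(1)] obtain H where H: "finite H" "H \<subseteq> G" "X \<inter> \<Inter>H = {}"
      by (elim exE conjE)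
    from key[OF a(2)] obtain H' where H': "finite H'" "H' \<subseteq> G" "- X \<inter> \<Inter>H' = {}"
      by (elim exE conjE)
    have "\<Inter>(H \<union> H') = {}" using H(3) H'(3) by (simp only: Inter_Un_distrib) blast
    then show False using 0[of "H \<union> H'"] H(1,2) H'(1,2) by simp
  qed
  ultimately have "ultra G" unfolding ultra_def by blast
  then show ?thesis using FG by blast
qed

lemma ultra_up: "ultra U \<Longrightarrow> A \<in> U \<Longrightarrow> A \<subseteq> B \<Longrightarrow> B \<in> U"
  unfolding ultra_def by blast

lemma ultra_Int: "ultra U \<Longrightarrow> A \<in> U \<Longrightarrow> B \<in> U \<Longrightarrow> A \<inter> B \<in> U"
  unfolding ultra_def by blast

lemma ultra_nonempty: "ultra U \<Longrightarrow> A \<in> U \<Longrightarrow> A \<noteq> {}"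
  unfolding ultra_def by blast

lemma ultra_not: "ultra U \<Longrightarrow> {x. \<not> P x} \<in> U \<longleftrightarrow> {x. P x} \<notin> U"
proof -
  assume U: "ultra U"
  have "{x. \<not> P x} \<inter> {x. P x} = {}" "{x. \<not> P x} = - {x. P x}" by auto
  then show ?thesis using U unfolding ultra_def by metis
qed

lemma ultra_INT:
  assumes "ultra U" "finite I" "\<And>i. i \<in> I \<Longrightarrow> A i \<in> U"
  shows "{x. \<forall>i\<in>I. x \<in> A i} \<in> U"
  using assms(2,3)
proof (induction I)
  case empty
  have "UNIV \<in> U" using assms(1) unfolding ultra_def by (metis top_greatest)
  then show ?case by simp
next
  case (insert i I)
  then have "A i \<inter> {x. \<forall>i\<in>I. x \<in> A i} \<in> U" by (intro ultra_Int[OF assms(1)]) auto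
  then show ?case by (rule ultra_up[OF assms(1)]) auto
qed

lemma ultra_cong_on:
  assumes "ultra U" "D \<in> U" "\<And>x. x \<in> D \<Longrightarrow> P x \<longleftrightarrow> Q x"
  shows "{x. P x} \<in> U \<longleftrightarrow> {x. Q x} \<in> U"
proof -
  have "{x. Q' x} \<in> U" if "{x. P' x} \<in> U" "\<And>x. x \<in> D \<Longrightarrow> P' x \<Longrightarrow> Q' x" for P' Q' :: "'a \<Rightarrow> bool"
  proof -
    have "D \<inter> {x. P' x} \<in> U" by (rule ultra_Int[OF assms(1,2) that(1)])
    then show ?thesis by (rule ultra_up[OF assms(1)]) (use that(2) in auto)
  qed
  from this[of P Q] this[of Q P] show ?thesis using assms(3) by auto
qed

text \<open>Below, \<open>D\<close> is the set of tuples, of sequences of tuples, or of tuples of a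
  submodel; the last case produces coheirs.\<close>

lemma ultra_exists_on:
  assumes fip: "\<And>\<Delta>. finite \<Delta> \<Longrightarrow> \<Delta> \<subseteq> I \<Longrightarrow> \<exists>x\<in>D. \<forall>i\<in>\<Delta>. P i x"
  shows "\<exists>U. ultra U \<and> D \<in> U \<and> (\<forall>i\<in>I. {x \<in> D. P i x} \<in> U)"
proof -
  let ?S = "\<lambda>i. {x \<in> D. P i x}"
  have fip': "\<Inter>G \<noteq> {}" if G: "finite G" "G \<subseteq> insert D (?S ` I)" for G
  proof -
    have "finite (G - {D})" "G - {D} \<subseteq> ?S ` I" using G by auto
    from finite_subset_image[OF this] obtain \<Delta>
      where \<Delta>: "\<Delta> \<subseteq> I" "finite \<Delta>" and eq: "G - {D} = ?S ` \<Delta>"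
      by (elim exE conjE)
    obtain x where x: "x \<in> D" "\<forall>i\<in>\<Delta>. P i x" using fip[OF \<Delta>(2,1)] by (elim bexE)
    have "x \<in> X" if "X \<in> G" for X
    proof (cases "X = D")
      case False
      then have "X \<in> ?S ` \<Delta>" using that eq by (metis Diff_iff singletonD)
      then show ?thesis using x by (elim imageE) simp
    qed (use x in simp)
    then show ?thesis by (metis InterI empty_iff)
  qed
  have "\<exists>U. ultra U \<and> insert D (?S ` I) \<subseteq> U"
    by (rule ultra_exists, rule fip')
  then obtain U where U: "ultra U" "insert D (?S ` I) \<subseteq> U" by (elim exE conjE)
  then show ?thesis by (intro exI[of _ U]) (simp add: image_subset_iff)
qed

section \<open>Definability, compactness and homogeneity\<close>

primrec tm_ren :: "(nat \<Rightarrow> nat) \<Rightarrow> 'f tm \<Rightarrow> 'f tm" where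
  "tm_ren g (Var i) = Var (g i)"
| "tm_ren g (Fn f ts) = Fn f (map (tm_ren g) ts)"

primrec fm_ren :: "(nat \<Rightarrow> nat) \<Rightarrow> ('f, 'r) fm \<Rightarrow> ('f, 'r) fm" where
  "fm_ren g (Eq s t) = Eq (tm_ren g s) (tm_ren g t)"
| "fm_ren g (Rel r ts) = Rel r (map (tm_ren g) ts)"
| "fm_ren g (Neg \<phi>) = Neg (fm_ren g \<phi>)"
| "fm_ren g (Conj \<phi> \<psi>) = Conj (fm_ren g \<phi>) (fm_ren g \<psi>)"
| "fm_ren g (Ex \<phi>) = Ex (fm_ren (case_nat 0 (\<lambda>i. Suc (g i))) \<phi>)"

lemma tm_val_ren:
  "is_tm L n t \<Longrightarrow> \<forall>i<n. e' ! i = e ! g i \<Longrightarrow> tm_val M e (tm_ren g t) = tm_val M e' t"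
proof (induction t)
  case (Fn f ts)
  then have "map (tm_val M e \<circ> tm_ren g) ts = map (tm_val M e') ts" by simp
  then show ?case by (simp only: tm_ren.simps tm_val.simps map_map)
qed simp

lemma is_tm_ren: "is_tm L n t \<Longrightarrow> \<forall>i<n. g i < n' \<Longrightarrow> is_tm L n' (tm_ren g t)"
  by (induction t) auto

lemma sat_ren:
  "is_fm L n \<phi> \<Longrightarrow> \<forall>i<n. e' ! i = e ! g i \<Longrightarrow> sat M e (fm_ren g \<phi>) = sat M e' \<phi>"
proof (induction \<phi> arbitrary: n e e' g)
  case (Eq s t)
  then show ?case by (auto simp: tm_val_ren)
next
  case (Rel r ts)
  then have "map (tm_val M e \<circ> tm_ren g) ts = map (tm_val M e') ts"
    by (auto simp: tm_val_ren)
  then show ?case by (simp only: fm_ren.simps sat.simps map_map)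
next
  case (Ex \<phi>)
  have "sat M (a # e) (fm_ren (case_nat 0 (\<lambda>i. Suc (g i))) \<phi>) = sat M (a # e') \<phi>" for a
    by (rule Ex.IH[of "Suc n"]) (use Ex.prems in \<open>auto split: nat.split\<close>)
  then show ?case by simp
qed auto

lemma is_fm_ren: "is_fm L n \<phi> \<Longrightarrow> \<forall>i<n. g i < n' \<Longrightarrow> is_fm L n' (fm_ren g \<phi>)"
proof (induction \<phi> arbitrary: n n' g)
  case (Ex \<phi>)
  then show ?case by (auto split: nat.split intro!: Ex.IH[of "Suc n"])
qed (auto simp: is_tm_ren)

lemma tuples_append: "a @ b \<in> tuples k A" if "a \<in> tuples n A" "b \<in> tuples m A" "k = n + m"
  using that by (auto simp: tuples_def)

lemma tuples_Suc: "a \<in> tuples (Suc n) A \<longleftrightarrow> (\<exists>x\<in>A. \<exists>b\<in>tuples n A. a = x # b)"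
  by (auto simp: tuples_def length_Suc_conv)

lemma is_fm_Exs: "is_fm L m ((Ex ^^ n) \<phi>) \<longleftrightarrow> is_fm L (n + m) \<phi>"
  by (induction n arbitrary: m) auto

lemma sat_Exs: "sat M b ((Ex ^^ n) \<phi>) \<longleftrightarrow> (\<exists>a\<in>tuples n (univ M). sat M (a @ b) \<phi>)"
proof (induction n arbitrary: b)
  case 0
  then show ?case by (simp add: tuples_def)
next
  case (Suc n)
  \<comment> \<open>The outermost quantifier binds the last entry of the tuple, so the induction
    splits the tuple at its end.\<close>
  have "sat M b ((Ex ^^ Suc n) \<phi>) \<longleftrightarrow> (\<exists>x\<in>univ M. \<exists>a\<in>tuples n (univ M). sat M (a @ x # b) \<phi>)"
    using Suc by simp
  also have "\<dots> \<longleftrightarrow> (\<exists>a\<in>tuples (Suc n) (univ M). sat M (a @ b) \<phi>)"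
  proof
    assume "\<exists>x\<in>univ M. \<exists>a\<in>tuples n (univ M). sat M (a @ x # b) \<phi>"
    then obtain x a where "x \<in> univ M" "a \<in> tuples n (univ M)" "sat M (a @ x # b) \<phi>" by blast
    then show "\<exists>a\<in>tuples (Suc n) (univ M). sat M (a @ b) \<phi>"
      by (intro bexI[of _ "a @ [x]"]) (auto simp: tuples_def)
  next
    assume "\<exists>a\<in>tuples (Suc n) (univ M). sat M (a @ b) \<phi>"
    then obtain a where a: "a \<in> tuples (Suc n) (univ M)" "sat M (a @ b) \<phi>" by blast
    then have "a \<noteq> []" by (auto simp: tuples_def)
    then obtain c x where "a = c @ [x]" by (metis append_butlast_last_id)
    then show "\<exists>x\<in>univ M. \<exists>a\<in>tuples n (univ M). sat M (a @ x # b) \<phi>"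
      using a by (intro bexI[of _ x] bexI[of _ c]) (auto simp: tuples_def)
  qed
  finally show ?case .
qed

text \<open>Definability is made a property of HOL predicates on lists, so that closure under
  boolean operations, projection and reindexing replaces the writing of formulas.\<close>

definition dfn ::
    "('f, 'r) lang \<Rightarrow> ('f, 'r, 'a) struct \<Rightarrow> nat \<Rightarrow> ('a list \<Rightarrow> bool) \<Rightarrow> bool" where
  "dfn L M N P \<longleftrightarrow> (\<exists>\<phi>. is_fm L N \<phi> \<and> (\<forall>a\<in>tuples N (univ M). P a \<longleftrightarrow> sat M a \<phi>))"

lemma dfn_sat: "is_fm L N \<phi> \<Longrightarrow> dfn L M N (\<lambda>a. sat M a \<phi>)"
  by (auto simp: dfn_def)

lemma dfn_not: "dfn L M N P \<Longrightarrow> dfn L M N (\<lambda>a. \<not> P a)"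
  unfolding dfn_def by (metis is_fm.simps(3) sat.simps(3))

lemma dfn_conj: "dfn L M N P \<Longrightarrow> dfn L M N Q \<Longrightarrow> dfn L M N (\<lambda>a. P a \<and> Q a)"
  unfolding dfn_def by (metis is_fm.simps(4) sat.simps(4))

lemma dfn_iff: "dfn L M N P \<Longrightarrow> dfn L M N Q \<Longrightarrow> dfn L M N (\<lambda>a. P a \<longleftrightarrow> Q a)"
proof -
  assume "dfn L M N P" "dfn L M N Q"
  then have "dfn L M N (\<lambda>a. \<not> (P a \<and> \<not> Q a) \<and> \<not> (Q a \<and> \<not> P a))"
    by (intro dfn_conj dfn_not)
  moreover have "(\<lambda>a. \<not> (P a \<and> \<not> Q a) \<and> \<not> (Q a \<and> \<not> P a)) = (\<lambda>a. P a \<longleftrightarrow> Q a)" by auto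
  ultimately show ?thesis by simp
qed

text \<open>\<open>N\<close> may be 0 and there is no truth constant, so a true sentence has to
  bring its own variable by \<open>Ex\<close>.\<close>

lemma dfn_True: "univ M \<noteq> {} \<Longrightarrow> dfn L M N (\<lambda>a. True)"
  unfolding dfn_def by (rule exI[of _ "Ex (Eq (Var 0) (Var 0))"]) auto

lemma dfn_ball:
  assumes "univ M \<noteq> {}" "finite I" "\<And>i. i \<in> I \<Longrightarrow> dfn L M N (P i)"
  shows "dfn L M N (\<lambda>a. \<forall>i\<in>I. P i a)"
  using assms(2,3)
proof (induction I)
  case empty
  then show ?case using dfn_True[OF assms(1)] by simp
next
  case (insert i I)
  then have "dfn L M N (\<lambda>a. P i a \<and> (\<forall>i\<in>I. P i a))" by (intro dfn_conj) auto
  then show ?case by simp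
qed

lemma dfn_Exs:
  assumes "dfn L M (n + N) P"
  shows "dfn L M N (\<lambda>b. \<exists>a\<in>tuples n (univ M). P (a @ b))"
proof -
  obtain \<phi> where \<phi>: "is_fm L (n + N) \<phi>" "\<And>a. a \<in> tuples (n + N) (univ M) \<Longrightarrow> P a \<longleftrightarrow> sat M a \<phi>"
    using assms by (auto simp: dfn_def)
  have "\<forall>b\<in>tuples N (univ M). (\<exists>a\<in>tuples n (univ M). P (a @ b)) = sat M b ((Ex ^^ n) \<phi>)"
    using \<phi>(2) by (auto simp: sat_Exs tuples_append)
  then show ?thesis unfolding dfn_def using \<phi>(1) is_fm_Exs by blast
qed

lemma dfn_reindex:
  assumes "dfn L M N P" "\<And>i. i < N \<Longrightarrow> g i < N'"
  shows "dfn L M N' (\<lambda>a. P (map (\<lambda>i. a ! g i) [0..<N]))"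
proof -
  obtain \<phi> where \<phi>: "is_fm L N \<phi>" "\<And>a. a \<in> tuples N (univ M) \<Longrightarrow> P a \<longleftrightarrow> sat M a \<phi>"
    using assms by (auto simp: dfn_def)
  have "P (map (\<lambda>i. a ! g i) [0..<N]) \<longleftrightarrow> sat M a (fm_ren g \<phi>)" if "a \<in> tuples N' (univ M)" for a
  proof -
    have "map (\<lambda>i. a ! g i) [0..<N] \<in> tuples N (univ M)"
      using that assms(2) by (fastforce simp: tuples_def)
    then show ?thesis
      using \<phi>(2) sat_ren[OF \<phi>(1), of "map (\<lambda>i. a ! g i) [0..<N]" a g M] by simp
  qed
  then show ?thesis unfolding dfn_def using is_fm_ren[OF \<phi>(1), of g N'] assms(2) by blast
qed

text \<open>\<open>g t\<close> gives the positions in \<open>a\<close> of the parameters of instance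
  \<open>t\<close>; putting the witness \<open>x\<close> in front shifts them by
  \<open>n\<close>.\<close>

lemma dfn_realizable:
  assumes ne: "univ M \<noteq> {}" and fm: "is_fm L (n + m) \<phi>" and I: "finite I"
    and g: "\<And>t i. t \<in> I \<Longrightarrow> i < m \<Longrightarrow> g t i < N"
  shows "dfn L M N (\<lambda>a. \<exists>x\<in>tuples n (univ M). \<forall>t\<in>I. sat M (x @ map (\<lambda>i. a ! g t i) [0..<m]) \<phi>)"
proof -
  have "dfn L M (n + N) (\<lambda>a. \<forall>t\<in>I. sat M (map (\<lambda>i. a ! (if i < n then i else n + g t (i - n))) [0..<n+m]) \<phi>)"
  proof (rule dfn_ball[OF ne I])
    fix t assume "t \<in> I"
    then show "dfn L M (n + N) (\<lambda>a. sat M (map (\<lambda>i. a ! (if i < n then i else n + g t (i - n))) [0..<n+m]) \<phi>)"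
      using g by (intro dfn_reindex[OF dfn_sat[OF fm]]) auto
  qed
  from dfn_Exs[OF this]
  have d: "dfn L M N (\<lambda>b. \<exists>x\<in>tuples n (univ M). \<forall>t\<in>I. sat M (map (\<lambda>i. (x @ b) ! (if i < n then i else n + g t (i - n))) [0..<n+m]) \<phi>)" .
  have eq: "map (\<lambda>i. (x @ b) ! (if i < n then i else n + h (i - n))) [0..<n+m] = x @ map (\<lambda>i. b ! h i) [0..<m]"
    if "x \<in> tuples n (univ M)" for x b h
    using that by (intro nth_equalityI) (auto simp: tuples_def nth_append)
  show ?thesis using d by (simp add: eq cong: bex_cong)
qed

text \<open>Newest entry first, so that appending a tuple to a sequence prepends it to the list and the de
  Bruijn quantifier \<open>Ex\<close> removes exactly the newest entry.\<close>

primrec Rv :: "(nat \<Rightarrow> 'b list) \<Rightarrow> nat \<Rightarrow> 'b list" where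
  "Rv u 0 = []"
| "Rv u (Suc N) = u N @ Rv u N"

lemma Rv_tuples: "(\<And>i. i < N \<Longrightarrow> u i \<in> tuples m A) \<Longrightarrow> Rv u N \<in> tuples (N * m) A"
  by (induction N) (auto simp: tuples_def)

lemma set_Rv: "set (Rv u N) = (\<Union>i<N. set (u i))"
  by (induction N) (auto simp: lessThan_Suc)

text \<open>With the newest entry first, entry \<open>t\<close> is block \<open>N - 1 - t\<close>
  counted from the front.\<close>

lemma Rv_nth: "(\<And>i. length (u i) = m) \<Longrightarrow> t < N \<Longrightarrow> i < m \<Longrightarrow> Rv u N ! ((N - 1 - t) * m + i) = u t ! i"
proof (induction N)
  case (Suc N)
  show ?case
  proof (cases "t = N")
    case True
    then show ?thesis using Suc.prems by (simp add: nth_append)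
  next
    case False
    then have tN: "t < N" using Suc.prems by simp
    then obtain k where k: "N = Suc (t + k)" using less_imp_Suc_add by blast
    have "Rv u N ! (k * m + i) = u t ! i" using Suc.IH[OF Suc.prems(1) tN Suc.prems(3)] k by simp
    moreover have "Rv u (Suc N) ! (m + (k * m + i)) = Rv u N ! (k * m + i)"
      using Suc.prems(1) by (simp add: nth_append)
    ultimately show ?thesis using k by (simp add: add.assoc)
  qed
qed simp

lemma Rv_block:
  assumes "\<And>i. length (u i) = m" "t < N"
  shows "map (\<lambda>i. Rv u N ! ((N - 1 - t) * m + i)) [0..<m] = u t"
  using assms Rv_nth[of u m t N] by (intro nth_equalityI) auto

text \<open>The average type of an ultrafilter on tuples. When the ultrafilter concentrates on
  tuples of a model, the version with parameters from the whole monster is a coheir.\<close>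

definition utype ::
    "('f, 'r) lang \<Rightarrow> ('f, 'r, 'a) struct \<Rightarrow> nat \<Rightarrow> 'a set \<Rightarrow> 'a list set set \<Rightarrow> ('f, 'r, 'a) pfm set" where
  "utype L MM n A U = {(\<phi>, b) \<in> pfms L n A. {a. sat MM (a @ b) \<phi>} \<in> U}"

lemma utype_complete:
  assumes U: "ultra U" and t: "tuples n (univ MM) \<in> U"
  shows "utype L MM n A U \<in> complete_types L MM n A"
proof -
  have "consistent MM n (utype L MM n A U)" unfolding consistent_def
  proof (intro allI impI)
    fix \<Delta> assume D: "\<Delta> \<subseteq> utype L MM n A U" "finite \<Delta>"
    have "{a. \<forall>d\<in>\<Delta>. a \<in> {a. sat MM (a @ snd d) (fst d)}} \<in> U"
      using D by (intro ultra_INT[OF U]) (auto simp: utype_def)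
    from ultra_nonempty[OF U ultra_Int[OF U t this]]
    show "\<exists>a\<in>tuples n (univ MM). realizes MM a \<Delta>" by (fastforce simp: realizes_def)
  qed
  moreover have "(\<phi>, b) \<in> utype L MM n A U \<or> (Neg \<phi>, b) \<in> utype L MM n A U" if "(\<phi>, b) \<in> pfms L n A" for \<phi> b
    using that ultra_not[OF U] by (auto simp: utype_def pfms_def)
  ultimately show ?thesis unfolding complete_types_def utype_def by auto
qed

lemma consistent_finite:
  "finite \<Gamma> \<Longrightarrow> consistent MM n \<Gamma> \<longleftrightarrow> (\<exists>a\<in>tuples n (univ MM). realizes MM a \<Gamma>)"
  unfolding consistent_def realizes_def by blast

lemma consistent_mono: "consistent MM n \<Gamma> \<Longrightarrow> \<Delta> \<subseteq> \<Gamma> \<Longrightarrow> consistent MM n \<Delta>"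
  unfolding consistent_def by blast

lemma consistent_image:
  "finite I \<Longrightarrow> consistent MM n ((\<lambda>i. (\<phi>, c i)) ` I) \<longleftrightarrow>
    (\<exists>x\<in>tuples n (univ MM). \<forall>i\<in>I. sat MM (x @ c i) \<phi>)"
  by (subst consistent_finite) (auto simp: realizes_def)

section \<open>Automorphisms\<close>

lemma automorphism_closed: "automorphism L MM \<sigma> \<Longrightarrow> x \<in> univ MM \<Longrightarrow> \<sigma> x \<in> univ MM"
  by (auto simp: automorphism_def bij_betw_def)

lemma automorphism_tuples: "automorphism L MM \<sigma> \<Longrightarrow> a \<in> tuples n (univ MM) \<Longrightarrow> map \<sigma> a \<in> tuples n (univ MM)"
  by (auto simp: tuples_def automorphism_closed)

lemma tm_val_closed:
  assumes "is_struct L M" "is_tm L n t" "a \<in> tuples n (univ M)"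
  shows "tm_val M a t \<in> univ M"
  using assms(2)
proof (induction t)
  case (Var i)
  then show ?case using assms(3) by (auto simp: tuples_def)
next
  case (Fn f ts)
  then have "map (tm_val M a) ts \<in> tuples (farity L f) (univ M)" by (auto simp: tuples_def)
  then show ?case using Fn.prems assms(1) by (simp add: is_struct_def)
qed

lemma automorphism_tm_val:
  assumes s: "is_struct L MM" and \<sigma>: "automorphism L MM \<sigma>" and a: "a \<in> tuples n (univ MM)"
  shows "is_tm L n t \<Longrightarrow> tm_val MM (map \<sigma> a) t = \<sigma> (tm_val MM a t)"
proof (induction t)
  case (Var i)
  then show ?case using a by (auto simp: tuples_def)
next
  case (Fn f ts)
  then have "map (tm_val MM a) ts \<in> tuples (farity L f) (univ MM)"
    using tm_val_closed[OF s _ a] by (auto simp: tuples_def)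
  then have "\<sigma> (fint MM f (map (tm_val MM a) ts)) = fint MM f (map \<sigma> (map (tm_val MM a) ts))"
    using \<sigma> Fn.prems by (auto simp: automorphism_def)
  moreover have "map (tm_val MM (map \<sigma> a)) ts = map \<sigma> (map (tm_val MM a) ts)"
    using Fn by auto
  ultimately show ?case by (simp only: tm_val.simps)
qed

lemma automorphism_sat:
  assumes s: "is_struct L MM" and \<sigma>: "automorphism L MM \<sigma>"
  shows "is_fm L n \<phi> \<Longrightarrow> a \<in> tuples n (univ MM) \<Longrightarrow> sat MM (map \<sigma> a) \<phi> \<longleftrightarrow> sat MM a \<phi>"
proof (induction \<phi> arbitrary: n a)
  case (Eq t1 t2)
  have "inj_on \<sigma> (univ MM)" using \<sigma> by (auto simp: automorphism_def bij_betw_def)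
  moreover have "tm_val MM a t1 \<in> univ MM" "tm_val MM a t2 \<in> univ MM"
    using tm_val_closed[OF s] Eq by auto
  ultimately show ?case using Eq automorphism_tm_val[OF s \<sigma>] by (auto dest: inj_onD)
next
  case (Rel r ts)
  then have "map (tm_val MM a) ts \<in> tuples (rarity L r) (univ MM)"
    using tm_val_closed[OF s] by (auto simp: tuples_def)
  then have "rint MM r (map (tm_val MM a) ts) = rint MM r (map \<sigma> (map (tm_val MM a) ts))"
    using \<sigma> Rel.prems by (auto simp: automorphism_def)
  moreover have "map (tm_val MM (map \<sigma> a)) ts = map \<sigma> (map (tm_val MM a) ts)"
    using Rel automorphism_tm_val[OF s \<sigma>] by auto
  ultimately show ?case by (simp only: sat.simps)
next
  case (Ex \<phi>)
  have 1: "sat MM (\<sigma> x # map \<sigma> a) \<phi> \<longleftrightarrow> sat MM (x # a) \<phi>" if "x \<in> univ MM" for x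
    using Ex.IH[of "Suc n" "x # a"] Ex.prems that by (auto simp: tuples_def)
  have "univ MM = \<sigma> ` univ MM" using \<sigma> by (auto simp: automorphism_def bij_betw_def)
  then have "(\<exists>y\<in>univ MM. sat MM (y # map \<sigma> a) \<phi>) \<longleftrightarrow> (\<exists>x\<in>univ MM. sat MM (\<sigma> x # map \<sigma> a) \<phi>)"
    by (metis (no_types, lifting) image_iff)
  then show ?case using 1 by simp
qed auto

lemma automorphism_id: "automorphism L MM id"
  by (auto simp: automorphism_def)

lemma automorphism_comp:
  assumes a: "automorphism L MM \<sigma>" and b: "automorphism L MM \<tau>"
  shows "automorphism L MM (\<sigma> \<circ> \<tau>)"
proof -
  have "bij_betw (\<sigma> \<circ> \<tau>) (univ MM) (univ MM)"
    using assms by (auto simp: automorphism_def intro: bij_betw_trans)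
  moreover have "(\<sigma> \<circ> \<tau>) (fint MM f c) = fint MM f (map (\<sigma> \<circ> \<tau>) c)"
    if "f \<in> funs L" "c \<in> tuples (farity L f) (univ MM)" for f c
    using assms that automorphism_tuples[OF b that(2)] by (auto simp: automorphism_def)
  moreover have "rint MM r c = rint MM r (map (\<sigma> \<circ> \<tau>) c)"
    if "r \<in> rels L" "c \<in> tuples (rarity L r) (univ MM)" for r c
  proof -
    have "rint MM r c = rint MM r (map \<tau> c)" using b that by (auto simp: automorphism_def)
    also have "\<dots> = rint MM r (map \<sigma> (map \<tau> c))"
      using a that(1) automorphism_tuples[OF b that(2)] unfolding automorphism_def by blast
    finally show ?thesis by simp
  qed
  ultimately show ?thesis by (auto simp: automorphism_def)
qed

lemma automorphism_surj_tuples: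
  assumes "automorphism L MM \<sigma>" "a \<in> tuples n (univ MM)"
  shows "\<exists>b\<in>tuples n (univ MM). map \<sigma> b = a"
proof -
  have s: "\<sigma> ` univ MM = univ MM" using assms(1) by (auto simp: automorphism_def bij_betw_def)
  have "map (inv_into (univ MM) \<sigma>) a \<in> tuples n (univ MM)"
    using assms(2) inv_into_into[of _ \<sigma> "univ MM"] s by (auto simp: tuples_def)
  moreover have "map \<sigma> (map (inv_into (univ MM) \<sigma>) a) = a"
    using assms(2) s by (intro nth_equalityI) (auto simp: tuples_def f_inv_into_f subset_iff)
  ultimately show ?thesis by blast
qed

section \<open>Compactness and homogeneity in the monster\<close>

locale monster_model =
  fixes L :: "('f, 'r) lang" and T :: "('f, 'r) fm set"
    and \<kappa> :: "'k rel" and MM :: "('f, 'r, 'a) struct"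
  assumes monster: "monster L T \<kappa> MM"
begin

lemma struct_MM: "is_struct L MM"
  using monster by (auto simp: monster_def model_def)

lemma univ_ne: "univ MM \<noteq> {}"
  using struct_MM by (auto simp: is_struct_def)

lemma infinite_formulas: "infinite {\<phi>. \<exists>n. is_fm L n \<phi>}"
proof
  assume "finite {\<phi>. \<exists>n. is_fm L n \<phi>}"
  moreover have "range (\<lambda>i. Eq (Var i) (Var i)) \<subseteq> {\<phi>. \<exists>n. is_fm L n \<phi>}" by auto
  ultimately have "finite (range (\<lambda>i::nat. (Eq (Var i) (Var i) :: ('f, 'r) fm)))"
    using finite_subset by blast
  moreover have "inj (\<lambda>i::nat. (Eq (Var i) (Var i) :: ('f, 'r) fm))" by (auto intro: injI)
  ultimately show False using finite_imageD by blast
qed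

lemma card_order_\<kappa>: "Card_order \<kappa>"
  using monster by (simp add: monster_def)

lemma theory_card_less: "(theory_card L, \<kappa>) \<in> ordLess"
  using monster by (simp add: monster_def)

lemma infinite_\<kappa>: "infinite (Field \<kappa>)"
proof
  assume f: "finite (Field \<kappa>)"
  have "(theory_card L, card_of (Field \<kappa>)) \<in> ordLess"
    using theory_card_less card_order_\<kappa> by (meson card_of_Field_ordIso ordIso_symmetric ordLess_ordIso_trans)
  then have "finite {\<phi>. \<exists>n. is_fm L n \<phi>}"
    using f unfolding theory_card_def by (meson card_of_ordLeq_finite ordLess_imp_ordLeq)
  then show False using infinite_formulas by blast
qed

lemma finite_small: "finite A \<Longrightarrow> (card_of A, \<kappa>) \<in> ordLess"
  using finite_ordLess_infinite[OF card_of_Well_order, of \<kappa> A] infinite_\<kappa> card_order_\<kappa>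
  by (simp add: card_order_on_well_order_on Field_card_of)

lemma Un_small:
  "(card_of A, \<kappa>) \<in> ordLess \<Longrightarrow> finite B \<Longrightarrow> (card_of (A \<union> B), \<kappa>) \<in> ordLess"
  by (rule card_of_Un_ordLess_infinite_Field[OF infinite_\<kappa> card_order_\<kappa> _ finite_small])

text \<open>\<open>saturated\<close> concerns complete types only; finite satisfiability gives an
  ultrafilter whose average type completes \<open>\<Gamma>\<close>.\<close>

lemma type_realized:
  assumes A: "A \<subseteq> univ MM" "(card_of A, \<kappa>) \<in> ordLess"
    and \<Gamma>: "\<Gamma> \<subseteq> pfms L n A" "consistent MM n \<Gamma>"
  shows "\<exists>a\<in>tuples n (univ MM). realizes MM a \<Gamma>"
proof -
  have "\<exists>U. ultra U \<and> tuples n (univ MM) \<in> U \<and>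
      (\<forall>d\<in>\<Gamma>. {a \<in> tuples n (univ MM). sat MM (a @ snd d) (fst d)} \<in> U)"
  proof (rule ultra_exists_on)
    fix \<Delta> assume "finite \<Delta>" "\<Delta> \<subseteq> \<Gamma>"
    then obtain a where "a \<in> tuples n (univ MM)" "realizes MM a \<Delta>"
      using \<Gamma>(2) unfolding consistent_def by blast
    then show "\<exists>a\<in>tuples n (univ MM). \<forall>d\<in>\<Delta>. sat MM (a @ snd d) (fst d)"
      unfolding realizes_def by (intro bexI[of _ a]) auto
  qed
  then obtain U where U: "ultra U" "tuples n (univ MM) \<in> U"
      "\<And>d. d \<in> \<Gamma> \<Longrightarrow> {a \<in> tuples n (univ MM). sat MM (a @ snd d) (fst d)} \<in> U"
    by blast
  have "\<Gamma> \<subseteq> utype L MM n A U"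
  proof
    fix d assume d: "d \<in> \<Gamma>"
    then have "{a. sat MM (a @ snd d) (fst d)} \<in> U" by (rule ultra_up[OF U(1) U(3)]) auto
    then show "d \<in> utype L MM n A U" using d \<Gamma>(1) by (auto simp: utype_def)
  qed
  moreover obtain a where "a \<in> tuples n (univ MM)" "realizes MM a (utype L MM n A U)"
    using monster utype_complete[OF U(1,2)] A unfolding monster_def saturated_def by blast
  ultimately show ?thesis unfolding realizes_def by blast
qed

text \<open>Saturation realises types of finite tuples, so the infinite sequence is built one entry
  at a time. An ultrafilter on sequences fixes a limit type for every initial segment;
  \<open>good\<close> says that the list chosen so far realises it, and such a list extends because
  limit types are closed under existential quantification.\<close>

lemma compactness:
  assumes dfn: "\<And>N P. (N, P) \<in> F \<Longrightarrow> dfn L MM (N * m) P"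
    and fs: "\<And>G. finite G \<Longrightarrow> G \<subseteq> F \<Longrightarrow>
      \<exists>u. (\<forall>i. u i \<in> tuples m (univ MM)) \<and> (\<forall>(N, P)\<in>G. P (Rv u N))"
  shows "\<exists>u. (\<forall>i. u i \<in> tuples m (univ MM)) \<and> (\<forall>(N, P)\<in>F. P (Rv u N))"
proof -
  define D :: "(nat \<Rightarrow> 'a list) set" where "D = {u. \<forall>i. u i \<in> tuples m (univ MM)}"
  have "\<exists>U. ultra U \<and> D \<in> U \<and> (\<forall>d\<in>F. {u \<in> D. snd d (Rv u (fst d))} \<in> U)"
  proof (rule ultra_exists_on)
    fix \<Delta> assume "finite \<Delta>" "\<Delta> \<subseteq> F"
    from fs[OF this] obtain u where "u \<in> D" "\<forall>(N, P)\<in>\<Delta>. P (Rv u N)"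
      unfolding D_def by blast
    then show "\<exists>u\<in>D. \<forall>d\<in>\<Delta>. snd d (Rv u (fst d))" by (intro bexI[of _ u]) auto
  qed
  then obtain U where U: "ultra U" "D \<in> U" "\<And>d. d \<in> F \<Longrightarrow> {u \<in> D. snd d (Rv u (fst d))} \<in> U"
    by blast
  define good where "good = (\<lambda>N a. a \<in> tuples (N * m) (univ MM) \<and>
    (\<forall>\<chi>. is_fm L (N * m) \<chi> \<longrightarrow> {u. sat MM (Rv u N) \<chi>} \<in> U \<longrightarrow> sat MM a \<chi>))"
  have g0: "good 0 []"
  proof -
    have "sat MM [] \<chi>" if "{u::nat \<Rightarrow> 'a list. sat MM [] \<chi>} \<in> U" for \<chi>
      using ultra_nonempty[OF U(1) that] by blast
    moreover have "[] \<in> tuples (0 * m) (univ MM)" by (simp add: tuples_def)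
    ultimately show ?thesis unfolding good_def Rv.simps by blast
  qed
  have gS: "\<exists>b\<in>tuples m (univ MM). good (Suc N) (b @ a)" if a: "good N a" for N a
  proof -
    define \<Gamma> where "\<Gamma> = {(\<chi>, a) | \<chi>. is_fm L (m + N * m) \<chi> \<and> {u. sat MM (Rv u (Suc N)) \<chi>} \<in> U}"
    have len: "length a = N * m" "set a \<subseteq> univ MM" using a by (auto simp: good_def tuples_def)
    have "consistent MM m \<Gamma>" unfolding consistent_def
    proof (intro allI impI)
      fix \<Delta> assume \<Delta>: "\<Delta> \<subseteq> \<Gamma>" "finite \<Delta>"
      \<comment> \<open>A finite part of the type amounts to one formula \<open>\<chi>\<close>; its
        projection \<open>(Ex ^^ m) \<chi>\<close> holds for almost all sequences, hence of
        \<open>a\<close>, and this provides the witness.\<close>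
      have "dfn L MM (m + N * m) (\<lambda>c. \<forall>d\<in>\<Delta>. sat MM c (fst d))"
        using \<Delta> by (intro dfn_ball[OF univ_ne] dfn_sat) (auto simp: \<Gamma>_def)
      then obtain \<chi> where \<chi>: "is_fm L (m + N * m) \<chi>"
        "\<And>c. c \<in> tuples (m + N * m) (univ MM) \<Longrightarrow> (\<forall>d\<in>\<Delta>. sat MM c (fst d)) \<longleftrightarrow> sat MM c \<chi>"
        by (auto simp: dfn_def)
      have "{u. \<forall>d\<in>\<Delta>. u \<in> {u. sat MM (Rv u (Suc N)) (fst d)}} \<in> U"
        using \<Delta> by (intro ultra_INT[OF U(1)]) (auto simp: \<Gamma>_def)
      from ultra_Int[OF U(1,2) this] have "{u. sat MM (Rv u N) ((Ex ^^ m) \<chi>)} \<in> U"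
      proof (rule ultra_up[OF U(1)], safe)
        fix u assume u: "u \<in> D" "\<forall>d\<in>\<Delta>. u \<in> {u. sat MM (Rv u (Suc N)) (fst d)}"
        have "Rv u (Suc N) \<in> tuples (m + N * m) (univ MM)"
          using Rv_tuples[of "Suc N" u m "univ MM"] u(1) by (simp add: D_def)
        then have "sat MM (u N @ Rv u N) \<chi>" using \<chi>(2) u(2) by fastforce
        then show "sat MM (Rv u N) ((Ex ^^ m) \<chi>)" using u(1) by (auto simp: sat_Exs D_def)
      qed
      then have "sat MM a ((Ex ^^ m) \<chi>)" using a \<chi>(1) by (auto simp: good_def is_fm_Exs)
      then obtain b where b: "b \<in> tuples m (univ MM)" "sat MM (b @ a) \<chi>" by (auto simp: sat_Exs)
      have "b @ a \<in> tuples (m + N * m) (univ MM)" using b len by (auto simp: tuples_def)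
      then have "\<forall>d\<in>\<Delta>. sat MM (b @ a) (fst d)" using \<chi>(2) b(2) by blast
      moreover have "snd d = a" if "d \<in> \<Delta>" for d using \<Delta>(1) that by (auto simp: \<Gamma>_def)
      ultimately have "realizes MM b \<Delta>" by (auto simp: realizes_def)
      then show "\<exists>b\<in>tuples m (univ MM). realizes MM b \<Delta>" using b by blast
    qed
    moreover have "\<Gamma> \<subseteq> pfms L m (set a)" using len by (auto simp: \<Gamma>_def pfms_def)
    ultimately obtain b where b: "b \<in> tuples m (univ MM)" "realizes MM b \<Gamma>"
      using type_realized[OF len(2) finite_small[OF finite_set], of \<Gamma> m] by blast
    have "b @ a \<in> tuples (Suc N * m) (univ MM)" using b len by (auto simp: tuples_def)
    then have "good (Suc N) (b @ a)" using b(2) by (auto simp: good_def \<Gamma>_def realizes_def)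
    then show ?thesis using b by blast
  qed
  have "\<exists>f. \<forall>N. good N (f N) \<and> (\<exists>b\<in>tuples m (univ MM). f (Suc N) = b @ f N)"
    by (rule dependent_nat_choice) (use g0 gS in blast)+
  then obtain f where f: "\<And>N. good N (f N)" "\<And>N. \<exists>b\<in>tuples m (univ MM). f (Suc N) = b @ f N"
    by blast
  from f(2) obtain u where u: "\<And>N. u N \<in> tuples m (univ MM)" "\<And>N. f (Suc N) = u N @ f N"
    by metis
  have "f 0 = []" using f(1)[of 0] by (auto simp: good_def tuples_def)
  then have fu: "f N = Rv u N" for N by (induction N) (auto simp: u(2))
  have "P (Rv u N)" if NP: "(N, P) \<in> F" for N P
  proof -
    obtain \<chi> where \<chi>: "is_fm L (N * m) \<chi>" "\<And>a. a \<in> tuples (N * m) (univ MM) \<Longrightarrow> P a \<longleftrightarrow> sat MM a \<chi>"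
      using dfn[OF NP] by (auto simp: dfn_def)
    have "{u \<in> D. P (Rv u N)} \<in> U" using U(3)[OF NP] by simp
    then have "{u. sat MM (Rv u N) \<chi>} \<in> U"
    proof (rule ultra_up[OF U(1)], safe)
      fix v assume "v \<in> D" "P (Rv v N)"
      then show "sat MM (Rv v N) \<chi>" using \<chi>(2) Rv_tuples[of N v m "univ MM"] by (auto simp: D_def)
    qed
    then have "sat MM (Rv u N) \<chi>" using f(1)[of N] \<chi>(1) by (auto simp: good_def fu)
    then show ?thesis using \<chi>(2) Rv_tuples[of N u m "univ MM"] u(1) by auto
  qed
  then show ?thesis using u(1) by blast
qed

text \<open>Strong homogeneity speaks of maps on sets, while a list may repeat elements; equality
  formulas show that sending \<open>a ! i\<close> to \<open>b ! i\<close> is well defined.\<close>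

lemma homogeneous_lists:
  assumes a: "a \<in> tuples N (univ MM)" and b: "b \<in> tuples N (univ MM)"
    and eq: "\<And>\<chi>. is_fm L N \<chi> \<Longrightarrow> sat MM a \<chi> \<longleftrightarrow> sat MM b \<chi>"
  shows "\<exists>\<sigma>. automorphism L MM \<sigma> \<and> map \<sigma> a = b"
proof -
  have la: "length a = N" "set a \<subseteq> univ MM" "length b = N" "set b \<subseteq> univ MM"
    using a b by (auto simp: tuples_def)
  define ix where "ix x = (SOME i. i < N \<and> a ! i = x)" for x
  have ix: "ix x < N \<and> a ! ix x = x" if "x \<in> set a" for x
    unfolding ix_def by (rule someI_ex) (use that la in \<open>auto simp: in_set_conv_nth\<close>)
  define g where "g x = b ! ix x" for x
  have gi: "g (a ! i) = b ! i" if "i < N" for i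
  proof -
    have j: "ix (a ! i) < N" "a ! ix (a ! i) = a ! i" using ix[of "a ! i"] that la by auto
    show ?thesis using eq[of "Eq (Var (ix (a ! i))) (Var i)"] that j by (simp add: g_def)
  qed
  have "partial_elementary L MM (set a) g" unfolding partial_elementary_def
  proof (intro conjI allI impI)
    show "g ` set a \<subseteq> univ MM" using ix la by (auto simp: g_def)
    fix n \<phi> c assume \<phi>: "is_fm L n \<phi>" and c: "c \<in> tuples n (set a)"
    have n: "ix (c ! i) < N" "a ! ix (c ! i) = c ! i" "b ! ix (c ! i) = map g c ! i" if "i < n" for i
    proof -
      have "c ! i \<in> set a" using c that by (auto simp: tuples_def)
      then show "ix (c ! i) < N" "a ! ix (c ! i) = c ! i" "b ! ix (c ! i) = map g c ! i"
        using ix c that by (auto simp: tuples_def g_def)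
    qed
    have "sat MM c \<phi> = sat MM a (fm_ren (\<lambda>i. ix (c ! i)) \<phi>)"
      by (rule sat_ren[OF \<phi>, symmetric]) (use n in auto)
    also have "\<dots> = sat MM b (fm_ren (\<lambda>i. ix (c ! i)) \<phi>)"
      by (rule eq, rule is_fm_ren[OF \<phi>]) (use n in auto)
    also have "\<dots> = sat MM (map g c) \<phi>"
      by (rule sat_ren[OF \<phi>]) (use n in auto)
    finally show "sat MM c \<phi> = sat MM (map g c) \<phi>" .
  qed (use la in auto)
  then obtain \<sigma> where \<sigma>: "automorphism L MM \<sigma>" "\<forall>x\<in>set a. \<sigma> x = g x"
    using monster finite_small[of "set a"] unfolding monster_def strongly_homogeneous_def by blast
  have "map \<sigma> a = b" using \<sigma>(2) gi la by (intro nth_equalityI) auto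
  then show ?thesis using \<sigma>(1) by blast
qed

end

section \<open>Arrays and SOP1\<close>

text \<open>The ordered product of those \<open>\<tau> (i + j)\<close> for which
  \<open>\<eta> ! j\<close> is true. Later factors act first, so an element fixed by them feels only
  an initial segment of \<open>\<eta>\<close>.\<close>

primrec twist :: "(nat \<Rightarrow> 'x \<Rightarrow> 'x) \<Rightarrow> nat \<Rightarrow> bool list \<Rightarrow> 'x \<Rightarrow> 'x" where
  "twist \<tau> i [] = id"
| "twist \<tau> i (b # \<eta>) = (if b then \<tau> i else id) \<circ> twist \<tau> (Suc i) \<eta>"

lemma twist_append: "twist \<tau> i (\<eta> @ \<zeta>) = twist \<tau> i \<eta> \<circ> twist \<tau> (i + length \<eta>) \<zeta>"
  by (induction \<eta> arbitrary: i) (auto simp: comp_assoc)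

lemma twist_automorphism:
  "(\<And>i. automorphism L MM (\<tau> i)) \<Longrightarrow> automorphism L MM (twist \<tau> i \<eta>)"
  by (induction \<eta> arbitrary: i) (auto intro: automorphism_comp simp: automorphism_id)

lemma twist_fixes: "(\<And>j. j \<ge> i \<Longrightarrow> \<tau> j x = x) \<Longrightarrow> twist \<tau> i \<eta> x = x"
  by (induction \<eta> arbitrary: i) auto

lemma map_Rv: "map f (Rv w N) = Rv (\<lambda>i. map f (w i)) N"
  by (induction N) auto

context monster_model
begin

definition jointly :: "nat \<Rightarrow> ('f, 'r) fm \<Rightarrow> 'a list set \<Rightarrow> bool" where
  "jointly n \<phi> C \<longleftrightarrow> (\<exists>x\<in>tuples n (univ MM). \<forall>c\<in>C. sat MM (x @ c) \<phi>)"

lemma jointly_mono: "jointly n \<phi> C \<Longrightarrow> D \<subseteq> C \<Longrightarrow> jointly n \<phi> D"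
  unfolding jointly_def by blast

lemma consistent_jointly:
  assumes "finite C"
  shows "consistent MM n ((\<lambda>c. (\<phi>, c)) ` C) \<longleftrightarrow> jointly n \<phi> C"
  using consistent_image[OF assms, of MM n \<phi> "\<lambda>c. c"] by (simp add: jointly_def)

text \<open>A condition on an infinite sequence that depends definably on finitely many entries.
  Stating it for \<open>u\<close> itself hides the length \<open>N\<close> and the position
  arithmetic of \<open>Rv\<close>.\<close>

definition seq_dfn :: "nat \<Rightarrow> ((nat \<Rightarrow> 'a list) \<Rightarrow> bool) \<Rightarrow> bool" where
  "seq_dfn m Q \<longleftrightarrow> (\<exists>N P. dfn L MM (N * m) P \<and>
    (\<forall>u. (\<forall>i. u i \<in> tuples m (univ MM)) \<longrightarrow> (P (Rv u N) \<longleftrightarrow> Q u)))"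

lemma seq_dfn_not: "seq_dfn m Q \<Longrightarrow> seq_dfn m (\<lambda>u. \<not> Q u)"
  unfolding seq_dfn_def using dfn_not by metis

lemma block_index_less: "t < N \<Longrightarrow> i < m \<Longrightarrow> (N - 1 - t) * m + i < N * (m::nat)"
proof -
  assume "t < N" "i < m"
  then have "(N - 1 - t) * m + i < (N - 1 - t) * m + m" "Suc (N - 1 - t) \<le> N" by auto
  then show ?thesis by (metis add.commute mult_Suc mult_le_mono1 order_less_le_trans)
qed

lemma dfn_jointly:
  assumes fm: "is_fm L (n + m) \<phi>" and I: "I \<subseteq> {..<N}"
  shows "\<exists>P. dfn L MM (N * m) P \<and>
    (\<forall>u. (\<forall>i. u i \<in> tuples m (univ MM)) \<longrightarrow> (P (Rv u N) \<longleftrightarrow> jointly n \<phi> (u ` I)))"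
proof -
  let ?P = "\<lambda>a. \<exists>x\<in>tuples n (univ MM). \<forall>t\<in>I. sat MM (x @ map (\<lambda>i. a ! ((N - 1 - t) * m + i)) [0..<m]) \<phi>"
  have "finite I" using I finite_subset by blast
  then have "dfn L MM (N * m) ?P"
    using I by (intro dfn_realizable[OF univ_ne fm] block_index_less) auto
  moreover have "?P (Rv u N) \<longleftrightarrow> jointly n \<phi> (u ` I)" if u: "\<forall>i. u i \<in> tuples m (univ MM)" for u
  proof -
    have "map (\<lambda>i. Rv u N ! ((N - 1 - t) * m + i)) [0..<m] = u t" if "t \<in> I" for t
      by (rule Rv_block) (use u I that in \<open>auto simp: tuples_def\<close>)
    then show ?thesis by (simp add: jointly_def cong: ball_cong)
  qed
  ultimately show ?thesis by blast
qed

lemma seq_dfn_jointly: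
  assumes "is_fm L (n + m) \<phi>" and "finite I"
  shows "seq_dfn m (\<lambda>u. jointly n \<phi> (u ` I))"
proof -
  obtain N where "I \<subseteq> {..<N}" using assms(2) unfolding finite_nat_set_iff_bounded by blast
  from dfn_jointly[OF assms(1) this] show ?thesis unfolding seq_dfn_def by blast
qed

lemma seq_dfn_same_type:
  assumes fm: "is_fm L (Suc j * m) \<chi>"
  shows "seq_dfn m (\<lambda>u. sat MM (u j @ Rv u j) \<chi> \<longleftrightarrow> sat MM (u (Suc j) @ Rv u j) \<chi>)"
proof -
  \<comment> \<open>\<open>Rv u (Suc (Suc j))\<close> is \<open>u (Suc j) @ u j @ Rv u j\<close>:
    the shift by \<open>m\<close> drops the first block, and \<open>?g\<close> skips the
    second.\<close>
  let ?g = "\<lambda>i. if i < m then i else m + i"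
  let ?P = "\<lambda>a. sat MM (map (\<lambda>i. a ! (m + i)) [0..<Suc j * m]) \<chi> \<longleftrightarrow>
      sat MM (map (\<lambda>i. a ! ?g i) [0..<Suc j * m]) \<chi>"
  have "dfn L MM (Suc (Suc j) * m) ?P"
    by (intro dfn_iff dfn_reindex[OF dfn_sat[OF fm]]) auto
  moreover have "?P (Rv u (Suc (Suc j))) \<longleftrightarrow> (sat MM (u j @ Rv u j) \<chi> \<longleftrightarrow> sat MM (u (Suc j) @ Rv u j) \<chi>)"
    if u: "\<forall>i. u i \<in> tuples m (univ MM)" for u
  proof -
    have l: "length (u i) = m" "length (Rv u i) = i * m" for i
      using u Rv_tuples[of i u m "univ MM"] by (auto simp: tuples_def)
    have "map (\<lambda>i. Rv u (Suc (Suc j)) ! (m + i)) [0..<Suc j * m] = u j @ Rv u j"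
      by (rule nth_equalityI) (auto simp: l nth_append)
    moreover have "map (\<lambda>i. Rv u (Suc (Suc j)) ! ?g i) [0..<Suc j * m] = u (Suc j) @ Rv u j"
      by (rule nth_equalityI) (auto simp: l nth_append)
    ultimately show ?thesis by simp
  qed
  ultimately show ?thesis unfolding seq_dfn_def by blast
qed

lemma compactness_seq:
  assumes dfn: "\<And>Q. Q \<in> F \<Longrightarrow> seq_dfn m Q"
    and fs: "\<And>G. finite G \<Longrightarrow> G \<subseteq> F \<Longrightarrow> \<exists>u. (\<forall>i. u i \<in> tuples m (univ MM)) \<and> (\<forall>Q\<in>G. Q u)"
  shows "\<exists>u. (\<forall>i. u i \<in> tuples m (univ MM)) \<and> (\<forall>Q\<in>F. Q u)"
proof -
  obtain f where f: "\<And>Q. Q \<in> F \<Longrightarrow> dfn L MM (fst (f Q) * m) (snd (f Q))"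
    "\<And>Q u. Q \<in> F \<Longrightarrow> (\<forall>i. u i \<in> tuples m (univ MM)) \<Longrightarrow> snd (f Q) (Rv u (fst (f Q))) \<longleftrightarrow> Q u"
  proof -
    have "\<forall>Q\<in>F. \<exists>d. dfn L MM (fst d * m) (snd d) \<and>
        (\<forall>u. (\<forall>i. u i \<in> tuples m (univ MM)) \<longrightarrow> (snd d (Rv u (fst d)) \<longleftrightarrow> Q u))"
      using dfn unfolding seq_dfn_def by fastforce
    from bchoice[OF this] show ?thesis using that by blast
  qed
  have "\<exists>u. (\<forall>i. u i \<in> tuples m (univ MM)) \<and> (\<forall>(N, P)\<in>f ` F. P (Rv u N))"
  proof (rule compactness)
    show "dfn L MM (N * m) P" if "(N, P) \<in> f ` F" for N P
      using that f(1) by (metis fst_conv imageE snd_conv)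
    fix G assume "finite G" "G \<subseteq> f ` F"
    from finite_subset_image[OF this] obtain H where H: "H \<subseteq> F" "finite H" "G = f ` H"
      by (elim exE conjE)
    obtain u where u: "\<forall>i. u i \<in> tuples m (univ MM)" "\<forall>Q\<in>H. Q u" using fs[OF H(2,1)] by blast
    have "\<forall>d\<in>f ` H. snd d (Rv u (fst d))" using f(2)[OF _ u(1)] u(2) H(1) by auto
    then show "\<exists>u. (\<forall>i. u i \<in> tuples m (univ MM)) \<and> (\<forall>(N, P)\<in>G. P (Rv u N))"
      using u(1) H(3) by (intro exI[of _ u]) auto
  qed
  then obtain u where u: "\<forall>i. u i \<in> tuples m (univ MM)" "\<forall>d\<in>f ` F. snd d (Rv u (fst d))"
    by (auto simp: case_prod_beta)
  then show ?thesis using f(2)[OF _ u(1)] by auto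
qed

lemma same_type_automorphism:
  assumes u: "\<And>i. u i \<in> tuples m (univ MM)"
    and eq: "\<And>\<chi>. is_fm L (Suc j * m) \<chi> \<Longrightarrow> sat MM (u j @ Rv u j) \<chi> \<longleftrightarrow> sat MM (u (Suc j) @ Rv u j) \<chi>"
  shows "\<exists>\<sigma>. automorphism L MM \<sigma> \<and> (\<forall>i<j. map \<sigma> (u i) = u i) \<and> map \<sigma> (u j) = u (Suc j)"
proof -
  have t: "u i @ Rv u j \<in> tuples (Suc j * m) (univ MM)" for i
    using u Rv_tuples[of j u m] by (intro tuples_append) auto
  from homogeneous_lists[OF t t, of j "Suc j"] eq
  obtain \<sigma> where \<sigma>: "automorphism L MM \<sigma>" "map \<sigma> (u j @ Rv u j) = u (Suc j) @ Rv u j" by blast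
  have len: "length (map \<sigma> (u j)) = length (u (Suc j))" using u by (simp add: tuples_def)
  have "map \<sigma> (u j) = u (Suc j)" "map \<sigma> (Rv u j) = Rv u j" using \<sigma>(2) len by (auto simp: append_eq_append_conv)
  moreover have "map \<sigma> (u i) = u i" if "i < j" for i
  proof -
    have "\<forall>x\<in>set (Rv u j). \<sigma> x = x" using calculation(2) by (metis map_eq_conv map_ident)
    then show ?thesis using that by (auto simp: set_Rv intro!: map_idI)
  qed
  ultimately show ?thesis using \<sigma>(1) by blast
qed

text \<open>That the two entries of a row have the same type over all earlier entries is an infinite
  family of definable conditions, of which \<open>X\<close> is a finite part. Once all of them hold,
  homogeneity yields the automorphism.\<close>

lemma compactness_array:
  assumes dfn: "\<And>Q. Q \<in> F \<Longrightarrow> seq_dfn m Q"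
    and fs: "\<And>G X. finite G \<Longrightarrow> G \<subseteq> F \<Longrightarrow> finite X \<Longrightarrow>
      \<exists>u. (\<forall>i. u i \<in> tuples m (univ MM)) \<and> (\<forall>Q\<in>G. Q u) \<and>
        (\<forall>i \<chi>. (i, \<chi>) \<in> X \<longrightarrow> is_fm L (Suc (l + 2 * i) * m) \<chi> \<longrightarrow>
          (sat MM (u (l + 2 * i) @ Rv u (l + 2 * i)) \<chi> \<longleftrightarrow> sat MM (u (Suc (l + 2 * i)) @ Rv u (l + 2 * i)) \<chi>))"
  shows "\<exists>u. (\<forall>i. u i \<in> tuples m (univ MM)) \<and> (\<forall>Q\<in>F. Q u) \<and>
    (\<forall>i. \<exists>\<sigma>. automorphism L MM \<sigma> \<and> (\<forall>j<l + 2 * i. map \<sigma> (u j) = u j) \<and>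
      map \<sigma> (u (l + 2 * i)) = u (Suc (l + 2 * i)))"
proof -
  define E where "E = (\<lambda>(i, \<chi>) u. sat MM (u (l + 2 * i) @ Rv u (l + 2 * i)) \<chi> \<longleftrightarrow>
      sat MM (u (Suc (l + 2 * i)) @ Rv u (l + 2 * i)) \<chi>)"
  define D where "D = {(i, \<chi>). is_fm L (Suc (l + 2 * i) * m) \<chi>}"
  have "\<exists>u. (\<forall>i. u i \<in> tuples m (univ MM)) \<and> (\<forall>Q\<in>F \<union> E ` D. Q u)"
  proof (rule compactness_seq)
    show "seq_dfn m Q" if "Q \<in> F \<union> E ` D" for Q
      using that dfn seq_dfn_same_type by (auto simp: D_def E_def)
    fix G assume G: "finite G" "G \<subseteq> F \<union> E ` D"
    then have "finite (G - F)" "G - F \<subseteq> E ` D" by auto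
    from finite_subset_image[OF this] obtain X where X: "X \<subseteq> D" "finite X" "G - F = E ` X"
      by (elim exE conjE)
    have GF: "finite (G \<inter> F)" "G \<inter> F \<subseteq> F" using G by auto
    from fs[OF GF X(2)] obtain u where u: "\<forall>i. u i \<in> tuples m (univ MM)" "\<forall>Q\<in>G \<inter> F. Q u"
      and u3: "\<And>i \<chi>. (i, \<chi>) \<in> X \<Longrightarrow> is_fm L (Suc (l + 2 * i) * m) \<chi> \<Longrightarrow> E (i, \<chi>) u"
      unfolding E_def by auto
    have "\<forall>Q\<in>E ` X. Q u" using u3 X(1) by (auto simp: D_def)
    then have "\<forall>Q\<in>G. Q u" using u(2) X(3) by (metis Diff_iff Int_iff)
    then show "\<exists>u. (\<forall>i. u i \<in> tuples m (univ MM)) \<and> (\<forall>Q\<in>G. Q u)" using u(1) by blast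
  qed
  then obtain u where u: "\<forall>i. u i \<in> tuples m (univ MM)" "\<forall>Q\<in>F. Q u" "\<forall>d\<in>D. E d u" by auto
  have "\<exists>\<sigma>. automorphism L MM \<sigma> \<and> (\<forall>j<l + 2 * i. map \<sigma> (u j) = u j) \<and>
      map \<sigma> (u (l + 2 * i)) = u (Suc (l + 2 * i))" for i
    by (rule same_type_automorphism) (use u(1,3) in \<open>auto simp: D_def E_def\<close>)
  then show ?thesis using u(1,2) by blast
qed

text \<open>SOP1 attaches one parameter tuple to a node, while the nodes of the tree below carry
  several entries; \<open>\<psi>\<close> is the conjunction of the \<open>B\<close>
  instances.\<close>

lemma block_formula:
  assumes fm: "is_fm L (n + m) \<phi>"
  shows "\<exists>\<psi>. is_fm L (n + B * m) \<psi> \<and> (\<forall>x\<in>tuples n (univ MM). \<forall>w. (\<forall>i. w i \<in> tuples m (univ MM)) \<longrightarrow>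
    (sat MM (x @ Rv w B) \<psi> \<longleftrightarrow> (\<forall>t<B. sat MM (x @ w t) \<phi>)))"
proof -
  let ?g = "\<lambda>t i. if i < n then i else n + ((B - 1 - t) * m + (i - n))"
  have "dfn L MM (n + B * m) (\<lambda>a. \<forall>t\<in>{..<B}. sat MM (map (\<lambda>i. a ! ?g t i) [0..<n + m]) \<phi>)"
  proof (rule dfn_ball[OF univ_ne])
    fix t assume t: "t \<in> {..<B}"
    have "?g t i < n + B * m" if "i < n + m" for i
    proof (cases "i < n")
      case False
      then have "(B - 1 - t) * m + (i - n) < B * m" using t that by (intro block_index_less) auto
      then show ?thesis using False by simp
    qed simp
    then show "dfn L MM (n + B * m) (\<lambda>a. sat MM (map (\<lambda>i. a ! ?g t i) [0..<n + m]) \<phi>)"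
      by (rule dfn_reindex[OF dfn_sat[OF fm]])
  qed simp
  then obtain \<psi> where \<psi>: "is_fm L (n + B * m) \<psi>"
    "\<And>a. a \<in> tuples (n + B * m) (univ MM) \<Longrightarrow>
      (\<forall>t\<in>{..<B}. sat MM (map (\<lambda>i. a ! ?g t i) [0..<n + m]) \<phi>) \<longleftrightarrow> sat MM a \<psi>"
    by (auto simp: dfn_def)
  have "sat MM (x @ Rv w B) \<psi> \<longleftrightarrow> (\<forall>t<B. sat MM (x @ w t) \<phi>)"
    if x: "x \<in> tuples n (univ MM)" and w: "\<forall>i. w i \<in> tuples m (univ MM)" for x w
  proof -
    have "x @ Rv w B \<in> tuples (n + B * m) (univ MM)"
      using x w Rv_tuples[of B w m] by (intro tuples_append) auto
    moreover have "map (\<lambda>i. (x @ Rv w B) ! ?g t i) [0..<n + m] = x @ w t" if "t < B" for t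
    proof (rule nth_equalityI)
      show "length (map (\<lambda>i. (x @ Rv w B) ! ?g t i) [0..<n + m]) = length (x @ w t)"
        using x w by (auto simp: tuples_def)
      fix i assume "i < length (map (\<lambda>i. (x @ Rv w B) ! ?g t i) [0..<n + m])"
      then show "map (\<lambda>i. (x @ Rv w B) ! ?g t i) [0..<n + m] ! i = (x @ w t) ! i"
        using x w Rv_nth[of w m t B "i - n"] that by (auto simp: tuples_def nth_append)
    qed
    ultimately show ?thesis using \<psi>(2)[of "x @ Rv w B"] by (auto simp: lessThan_iff)
  qed
  then show ?thesis using \<psi>(1) by blast
qed

text \<open>The tree: \<open>a \<eta>\<close> is the block of \<open>Suc s\<close> consecutive even entries number \<open>length \<eta>\<close> (together
  with the first \<open>l\<close> entries), moved by the automorphisms \<open>\<tau> i\<close> with \<open>\<eta> ! i = True\<close>.  As \<open>\<tau> i\<close> turns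
  the first entry of block \<open>Suc i\<close> into its odd partner, the two successors of a node are separated.\<close>

lemma SOP1_of_infinite_array:
  assumes fm: "is_fm L (n + m) \<phi>" and u: "\<And>i. u i \<in> tuples m (univ MM)"
    and \<sigma>: "\<And>i. automorphism L MM (\<sigma> i)"
    and fixes': "\<And>i j. j < l + 2 * i \<Longrightarrow> map (\<sigma> i) (u j) = u j"
    and moves: "\<And>i. map (\<sigma> i) (u (l + 2 * i)) = u (Suc (l + 2 * i))"
    and cons: "\<And>h. jointly n \<phi> (u ` ({..<l} \<union> (\<lambda>i. l + 2 * i) ` {..<h}))"
    and incons: "\<And>i J. finite J \<Longrightarrow> J \<subseteq> {i<..} \<Longrightarrow> card J = s \<Longrightarrow>
      \<not> jointly n \<phi> (u ` ({..<l} \<union> {Suc (l + 2 * i)} \<union> (\<lambda>j. l + 2 * j) ` J))"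
  shows "\<not> NSOP1 L MM"
proof -
  \<comment> \<open>The \<open>l\<close> constants, one row that can be moved, and \<open>s\<close>
    rows inconsistent with the moved one.\<close>
  define B where "B = l + Suc s"
  obtain \<psi> where \<psi>: "is_fm L (n + B * m) \<psi>"
    "\<And>x w. x \<in> tuples n (univ MM) \<Longrightarrow> (\<And>i. w i \<in> tuples m (univ MM)) \<Longrightarrow>
      sat MM (x @ Rv w B) \<psi> \<longleftrightarrow> (\<forall>t<B. sat MM (x @ w t) \<phi>)"
    using block_formula[OF fm, of B] by blast
  define ix where "ix t r = (if r < l then r else l + 2 * (t * Suc s + (r - l)))" for t r
  \<comment> \<open>\<open>Suc i * Suc s\<close> is the first row of block \<open>Suc i\<close>, the
    block used at both successors of a node of length \<open>i\<close>.\<close>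
  define \<tau> where "\<tau> i = \<sigma> (Suc i * Suc s)" for i
  define a where "a \<eta> = map (twist \<tau> 0 \<eta>) (Rv (\<lambda>r. u (ix (length \<eta>) r)) B)" for \<eta>
  have aut: "automorphism L MM (twist \<tau> i \<eta>)" for i \<eta>
    by (rule twist_automorphism) (simp add: \<tau>_def \<sigma>)
  have fix_twist: "map (twist \<tau> i \<eta>) (u j) = u j" if "j < l + 2 * (Suc i * Suc s)" for i \<eta> j
  proof (rule map_idI)
    fix x assume x: "x \<in> set (u j)"
    show "twist \<tau> i \<eta> x = x"
    proof (rule twist_fixes)
      fix k assume "k \<ge> i"
      then have "Suc i * Suc s \<le> Suc k * Suc s" by (intro mult_le_mono1) simp
      then have "map (\<sigma> (Suc k * Suc s)) (u j) = u j" using that by (intro fixes') linarith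
      then show "\<tau> k x = x" using x unfolding \<tau>_def by (metis map_eq_conv map_ident)
    qed
  qed
  have ix_less: "ix t r < l + 2 * (Suc t * Suc s)" if "r < B" for t r
    using that by (auto simp: ix_def B_def)
  have a_tuples: "a \<eta> \<in> tuples (B * m) (univ MM)" for \<eta>
    unfolding a_def by (intro automorphism_tuples[OF aut] Rv_tuples u)
  have sat_a: "sat MM (x @ a \<eta>) \<psi> \<longleftrightarrow> (\<forall>r<B. sat MM (x @ map (twist \<tau> 0 \<eta>) (u (ix (length \<eta>) r))) \<phi>)"
    if "x \<in> tuples n (univ MM)" for x \<eta>
    unfolding a_def map_Rv by (rule \<psi>(2)[OF that automorphism_tuples[OF aut u]])
  have pull: "sat MM (map \<alpha> x @ map \<alpha> (u j)) \<phi> \<longleftrightarrow> sat MM (x @ u j) \<phi>"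
    if "automorphism L MM \<alpha>" "x \<in> tuples n (univ MM)" for \<alpha> x j
    using automorphism_sat[OF struct_MM that(1) fm, of "x @ u j"] tuples_append[OF that(2) u[of j] refl] by simp
  have branch: "consistent MM n {(\<psi>, a (map \<eta> [0..<k])) | k. True}" for \<eta> :: "nat \<Rightarrow> bool"
    unfolding consistent_def
  proof (intro allI impI)
    fix \<Delta> assume "\<Delta> \<subseteq> {(\<psi>, a (map \<eta> [0..<k])) | k. True}" "finite \<Delta>"
    then have "finite \<Delta>" "\<Delta> \<subseteq> (\<lambda>k. (\<psi>, a (map \<eta> [0..<k]))) ` UNIV" by auto
    from finite_subset_image[OF this] obtain K where K: "finite K" "\<Delta> = (\<lambda>k. (\<psi>, a (map \<eta> [0..<k]))) ` K"
      by (elim exE conjE)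
    obtain h where h: "\<And>k. k \<in> K \<Longrightarrow> k < h" using K(1) unfolding finite_nat_set_iff_bounded by blast
    obtain x where x: "x \<in> tuples n (univ MM)"
      "\<And>j. j \<in> {..<l} \<union> (\<lambda>i. l + 2 * i) ` {..<Suc h * Suc s} \<Longrightarrow> sat MM (x @ u j) \<phi>"
      using cons[of "Suc h * Suc s"] unfolding jointly_def by blast
    \<comment> \<open>A finite part of the branch is the image of even entries under the single
      automorphism \<open>?\<alpha>\<close>, because the factors at positions \<open>k\<close> and
      beyond fix block \<open>k\<close>.\<close>
    let ?\<alpha> = "twist \<tau> 0 (map \<eta> [0..<h])"
    have "sat MM (map ?\<alpha> x @ a (map \<eta> [0..<k])) \<psi>" if k: "k \<in> K" for k
    proof -
      have split: "map \<eta> [0..<h] = map \<eta> [0..<k] @ map \<eta> [k..<h]"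
        using h[OF k] by (metis map_append le_add_diff_inverse less_imp_le_nat plus_nat.add_0 upt_add_eq_append zero_le)
      have "sat MM (map ?\<alpha> x @ map (twist \<tau> 0 (map \<eta> [0..<k])) (u (ix k r))) \<phi>" if r: "r < B" for r
      proof -
        have "map (twist \<tau> k (map \<eta> [k..<h])) (u (ix k r)) = u (ix k r)"
          by (rule fix_twist[OF ix_less[OF r]])
        then have eq: "map (twist \<tau> 0 (map \<eta> [0..<k])) (u (ix k r)) = map ?\<alpha> (u (ix k r))"
          unfolding split twist_append by (metis add_0 diff_zero length_map length_upt map_map)
        have "ix k r \<in> {..<l} \<union> (\<lambda>i. l + 2 * i) ` {..<Suc h * Suc s}"
        proof (cases "r < l")
          case False
          have "k * Suc s + (r - l) < Suc k * Suc s" using r by (auto simp: B_def)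
          also have "\<dots> \<le> Suc h * Suc s" using h[OF k] by (intro mult_le_mono1) simp
          finally show ?thesis using False by (auto simp: ix_def)
        qed (simp add: ix_def)
        from x(2)[OF this] show ?thesis unfolding eq pull[OF aut x(1)] .
      qed
      then show ?thesis using sat_a[OF automorphism_tuples[OF aut x(1)]] by simp
    qed
    then have "realizes MM (map ?\<alpha> x) \<Delta>" using K(2) by (auto simp: realizes_def)
    then show "\<exists>a\<in>tuples n (univ MM). realizes MM a \<Delta>" using automorphism_tuples[OF aut x(1)] by blast
  qed
  have split: "\<not> consistent MM n {(\<psi>, a \<eta>), (\<psi>, a (\<nu> @ [True]))}" if "prefix (\<nu> @ [False]) \<eta>" for \<nu> \<eta>
  proof
    assume "consistent MM n {(\<psi>, a \<eta>), (\<psi>, a (\<nu> @ [True]))}"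
    then obtain x where x: "x \<in> tuples n (univ MM)" "sat MM (x @ a \<eta>) \<psi>" "sat MM (x @ a (\<nu> @ [True])) \<psi>"
      by (subst (asm) consistent_finite) (auto simp: realizes_def)
    from that obtain \<zeta> where "\<eta> = (\<nu> @ [False]) @ \<zeta>" by (rule prefixE)
    then have \<eta>: "\<eta> = \<nu> @ [False] @ \<zeta>" by simp
    define i where "i = length \<nu>"
    define t where "t = Suc i + length \<zeta>"
    define c where "c = Suc i * Suc s"
    \<comment> \<open>Undoing \<open>?\<alpha>\<close> turns the parameters at \<open>\<eta>\<close>
      into even entries of block \<open>t\<close>. The moved entry at \<open>\<nu> @ [True]\<close>
      becomes the odd entry of row \<open>c\<close>, which \<open>?\<beta>\<close> fixes.\<close>
    let ?\<beta> = "twist \<tau> (Suc i) \<zeta>"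
    let ?\<alpha> = "twist \<tau> 0 \<nu> \<circ> ?\<beta>"
    have \<alpha>: "twist \<tau> 0 \<eta> = ?\<alpha>" "length \<eta> = t" by (simp_all add: \<eta> twist_append i_def t_def)
    have aut\<alpha>: "automorphism L MM ?\<alpha>" by (intro automorphism_comp aut)
    obtain y where y: "y \<in> tuples n (univ MM)" "map ?\<alpha> y = x"
      using automorphism_surj_tuples[OF aut\<alpha> x(1)] by blast
    have y_sat: "sat MM (y @ u (ix t r)) \<phi>" if "r < B" for r
      using sat_a[OF x(1), of \<eta>] x(2) that pull[OF aut\<alpha> y(1)] y(2) \<alpha> by simp
    have "ix (Suc i) l = l + 2 * c" by (simp add: ix_def c_def)
    moreover have "map (twist \<tau> 0 (\<nu> @ [True])) (u (l + 2 * c)) = map (twist \<tau> 0 \<nu>) (u (Suc (l + 2 * c)))"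
    proof -
      have "twist \<tau> 0 (\<nu> @ [True]) = twist \<tau> 0 \<nu> \<circ> \<sigma> c"
        by (simp add: twist_append i_def[symmetric] \<tau>_def c_def)
      then show ?thesis using moves[of c] by (metis map_map)
    qed
    moreover have "map ?\<beta> (u (Suc (l + 2 * c))) = u (Suc (l + 2 * c))"
      by (rule fix_twist) (simp add: c_def)
    ultimately have "map (twist \<tau> 0 (\<nu> @ [True])) (u (ix (Suc i) l)) = map ?\<alpha> (u (Suc (l + 2 * c)))"
      by (metis map_map)
    moreover have "sat MM (x @ map (twist \<tau> 0 (\<nu> @ [True])) (u (ix (Suc i) l))) \<phi>"
      using sat_a[OF x(1), of "\<nu> @ [True]"] x(3) by (simp add: i_def B_def)
    ultimately have 2: "sat MM (y @ u (Suc (l + 2 * c))) \<phi>"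
      using pull[OF aut\<alpha> y(1)] y(2) by metis
    \<comment> \<open>The first row of block \<open>t\<close> is left out: it is row
      \<open>c\<close> itself when \<open>\<zeta>\<close> is empty, and \<open>incons\<close> needs
      rows strictly after \<open>c\<close>.\<close>
    let ?J = "{t * Suc s + 1..<t * Suc s + Suc s}"
    have J: "finite ?J" "card ?J = s" by simp_all
    have "c \<le> t * Suc s" unfolding c_def t_def by (intro mult_le_mono1) simp
    then have Jc: "?J \<subseteq> {c<..}" by auto
    have "sat MM (y @ u j) \<phi>" if hj: "j \<in> {..<l} \<union> {Suc (l + 2 * c)} \<union> (\<lambda>j. l + 2 * j) ` ?J" for j
    proof -
      consider "j < l" | "j = Suc (l + 2 * c)" | j' where "j = l + 2 * j'" "j' \<in> ?J"
        using hj by blast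
      then show ?thesis
      proof cases
        case 1
        then show ?thesis using y_sat[of j] by (simp add: ix_def B_def)
      next
        case 3
        define r where "r = l + (j' - t * Suc s)"
        have "r < B" "ix t r = j" using 3 by (auto simp: r_def B_def ix_def)
        then show ?thesis using y_sat[of r] by simp
      qed (use 2 in simp)
    qed
    then have "jointly n \<phi> (u ` ({..<l} \<union> {Suc (l + 2 * c)} \<union> (\<lambda>j. l + 2 * j) ` ?J))"
      unfolding jointly_def using y(1) by blast
    then show False using incons[OF J(1) Jc J(2)] by blast
  qed
  have "has_SOP1 L MM n (B * m) \<psi>"
    unfolding has_SOP1_def using \<psi>(1) a_tuples branch split by blast
  then show ?thesis unfolding NSOP1_def by blast
qed

text \<open>An array is a sequence whose first \<open>l\<close> entries are constants and whose entries \<open>l + 2 * i\<close> and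
  \<open>Suc (l + 2 * i)\<close> form row \<open>i\<close>: the even column is consistent, the odd one \<open>k\<close>-inconsistent.\<close>

definition array :: "nat \<Rightarrow> ('f, 'r) fm \<Rightarrow> nat \<Rightarrow> nat \<Rightarrow> nat \<Rightarrow> nat \<Rightarrow> (nat \<Rightarrow> 'a list) \<Rightarrow> bool" where
  "array n \<phi> m l k h u \<longleftrightarrow> (\<forall>i. u i \<in> tuples m (univ MM)) \<and>
    (\<forall>i<h. \<exists>\<sigma>. automorphism L MM \<sigma> \<and> (\<forall>j<l + 2 * i. map \<sigma> (u j) = u j) \<and>
      map \<sigma> (u (l + 2 * i)) = u (Suc (l + 2 * i))) \<and>
    jointly n \<phi> (u ` ({..<l} \<union> (\<lambda>i. l + 2 * i) ` {..<h})) \<and>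
    (\<forall>I\<subseteq>{..<h}. card I = k \<longrightarrow> \<not> jointly n \<phi> (u ` ({..<l} \<union> (\<lambda>i. Suc (l + 2 * i)) ` I)))"

text \<open>The odd entry of row \<open>i\<close> becomes a constant and the rows in
  \<open>J\<close> survive. The old automorphisms still fix the new constant, since the rows in
  \<open>J\<close> come after row \<open>i\<close>; and \<open>k\<close> odd entries together with
  the new constant are \<open>Suc k\<close> odd entries of the old array.\<close>

lemma array_shift:
  assumes A: "array n \<phi> m l (Suc k) h u" and i: "i < h" and J: "J \<subseteq> {i<..<h}" "card J = s"
    and j: "jointly n \<phi> (u ` ({..<l} \<union> {Suc (l + 2 * i)} \<union> (\<lambda>j. l + 2 * j) ` J))"
  shows "\<exists>v. array n \<phi> m (Suc l) k s v"
proof -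
  have fJ: "finite J" using J(1) finite_subset by blast
  define e where "e t = sorted_list_of_set J ! t" for t
  have eJ: "e ` {..<s} = J"
    using fJ J(2) nth_image[of "s" "sorted_list_of_set J"] by (simp add: e_def[abs_def] lessThan_atLeast0)
  have emono: "e t < e t'" if "t < t'" "t' < s" for t t'
    using that fJ J(2) sorted_wrt_nth_less[OF strict_sorted_list_of_set, of t t' J] by (simp add: e_def)
  \<comment> \<open>Position \<open>l\<close> receives the odd entry of row \<open>i\<close>; beyond
    it, row \<open>t\<close> of the new array is row \<open>e t\<close> of the old one.\<close>
  define f where "f x = (if x < l then x else if x = l then Suc (l + 2 * i)
      else l + 2 * e ((x - Suc l) div 2) + (x - Suc l) mod 2)" for x
  have f: "x < l \<Longrightarrow> f x = x" "f l = Suc (l + 2 * i)" "f (Suc l + 2 * t) = l + 2 * e t"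
    "f (Suc (Suc l + 2 * t)) = Suc (l + 2 * e t)" for x t
    by (auto simp: f_def)
  have eb: "i < e t" "e t < h" if "t < s" for t using that eJ J(1) by auto
  let ?v = "u \<circ> f"
  have v: "\<forall>x. ?v x \<in> tuples m (univ MM)" using A by (auto simp: array_def)
  have vS: "f ` {..<Suc l} = {..<l} \<union> {Suc (l + 2 * i)}"
    using f by (auto simp: lessThan_Suc image_iff)
  have "\<exists>\<sigma>. automorphism L MM \<sigma> \<and> (\<forall>j<Suc l + 2 * t. map \<sigma> (?v j) = ?v j) \<and>
      map \<sigma> (?v (Suc l + 2 * t)) = ?v (Suc (Suc l + 2 * t))" if t: "t < s" for t
  proof -
    obtain \<sigma> where \<sigma>: "automorphism L MM \<sigma>" "\<And>j. j < l + 2 * e t \<Longrightarrow> map \<sigma> (u j) = u j"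
      "map \<sigma> (u (l + 2 * e t)) = u (Suc (l + 2 * e t))"
      using A eb[OF t] unfolding array_def by blast
    have "f x < l + 2 * e t" if "x < Suc l + 2 * t" for x
    proof -
      consider "x < l" | "x = l" | "x > l" by linarith
      then show ?thesis
      proof cases
        case 3
        then have q: "(x - Suc l) div 2 < t" using that by auto
        then have "e ((x - Suc l) div 2) < e t" using emono t by blast
        moreover have "f x = l + 2 * e ((x - Suc l) div 2) + (x - Suc l) mod 2" using 3 by (simp add: f_def)
        moreover have "(x - Suc l) mod 2 < 2" by simp
        ultimately show ?thesis by linarith
      qed (use eb[OF t] f in auto)
    qed
    then show ?thesis using \<sigma> f by (intro exI[of _ \<sigma>]) auto
  qed
  moreover have "jointly n \<phi> (?v ` ({..<Suc l} \<union> (\<lambda>t. Suc l + 2 * t) ` {..<s}))"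
  proof -
    have "f ` ((\<lambda>t. Suc l + 2 * t) ` {..<s}) = (\<lambda>j. l + 2 * j) ` J"
      unfolding image_image f(3) eJ[symmetric] by simp
    then show ?thesis using j unfolding image_comp[symmetric] image_Un vS by simp
  qed
  moreover have "\<not> jointly n \<phi> (?v ` ({..<Suc l} \<union> (\<lambda>t. Suc (Suc l + 2 * t)) ` I))"
    if I: "I \<subseteq> {..<s}" "card I = k" for I
  proof
    assume jo: "jointly n \<phi> (?v ` ({..<Suc l} \<union> (\<lambda>t. Suc (Suc l + 2 * t)) ` I))"
    have fI: "finite I" using I(1) finite_subset by blast
    have inj: "inj_on e I" using emono I(1) by (intro inj_onI) (metis less_irrefl lessThan_iff linorder_neqE_nat subsetD)
    have "i \<notin> e ` I" using eb(1) I(1) by fastforce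
    then have card: "card (insert i (e ` I)) = Suc k" using fI I(2) by (simp add: card_image[OF inj])
    have sub: "insert i (e ` I) \<subseteq> {..<h}" using i eb(2) I(1) by auto
    have "f ` ((\<lambda>t. Suc (Suc l + 2 * t)) ` I) = (\<lambda>j. Suc (l + 2 * j)) ` e ` I"
      unfolding image_image f(4) by simp
    then have "jointly n \<phi> (u ` ({..<l} \<union> (\<lambda>j. Suc (l + 2 * j)) ` insert i (e ` I)))"
      using jo unfolding image_comp[symmetric] image_Un vS by (simp add: Un_commute Un_left_commute insert_commute)
    then show False using A sub card unfolding array_def by blast
  qed
  ultimately show ?thesis using v unfolding array_def by (intro exI[of _ ?v]) blast
qed

text \<open>Lowers \<open>k\<close> by turning one odd entry into a constant.  When this stops being possible, an odd
  entry is inconsistent with any \<open>s\<close> later even entries for a uniform \<open>s\<close>, without Ramsey's theorem.\<close>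

theorem SOP1_of_arrays:
  assumes fm: "is_fm L (n + m) \<phi>" and "\<And>h. \<exists>u. array n \<phi> m l k h u"
  shows "\<not> NSOP1 L MM"
  using assms(2)
proof (induction k arbitrary: l)
  case 0
  \<comment> \<open>For \<open>k = 0\<close> the empty set of rows makes the constants both
    consistent and inconsistent.\<close>
  obtain u where A: "array n \<phi> m l 0 0 u" using 0 by blast
  then have "jointly n \<phi> (u ` {..<l})" "\<not> jointly n \<phi> (u ` {..<l})" unfolding array_def by simp_all
  then show ?case by blast
next
  case (Suc k)
  show ?case
  proof (cases "\<forall>h. \<exists>v. array n \<phi> m (Suc l) k h v")
    case True
    then show ?thesis using Suc.IH by blast
  next
    case False
    \<comment> \<open>By \<open>array_shift\<close> this \<open>s\<close> works for all heights
      \<open>h\<close> at once, which is what lets compactness pass to an infinite array.\<close>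
    then obtain s where s: "\<And>v. \<not> array n \<phi> m (Suc l) k s v" by blast
    define FC where "FC = (\<lambda>h u. jointly n \<phi> (u ` ({..<l} \<union> (\<lambda>i. l + 2 * i) ` {..<h})))"
    define FI where "FI = (\<lambda>(i, J) u. \<not> jointly n \<phi> (u ` ({..<l} \<union> {Suc (l + 2 * i)} \<union> (\<lambda>j. l + 2 * j) ` J)))"
    define D where "D = {(i :: nat, J). finite J \<and> J \<subseteq> {i<..} \<and> card J = s}"
    have "\<exists>u. (\<forall>i. u i \<in> tuples m (univ MM)) \<and> (\<forall>Q\<in>range FC \<union> FI ` D. Q u) \<and>
      (\<forall>i. \<exists>\<sigma>. automorphism L MM \<sigma> \<and> (\<forall>j<l + 2 * i. map \<sigma> (u j) = u j) \<and>
        map \<sigma> (u (l + 2 * i)) = u (Suc (l + 2 * i)))"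
    proof (rule compactness_array)
      show "seq_dfn m Q" if "Q \<in> range FC \<union> FI ` D" for Q
      proof -
        have "seq_dfn m (FC h)" for h unfolding FC_def by (intro seq_dfn_jointly[OF fm]) simp
        moreover have "seq_dfn m (FI d)" if "d \<in> D" for d
          unfolding FI_def case_prod_beta using that
          by (intro seq_dfn_not seq_dfn_jointly[OF fm]) (auto simp: D_def)
        ultimately show ?thesis using that by blast
      qed
      fix G X assume G: "finite G" "G \<subseteq> range FC \<union> FI ` D" and X: "finite (X :: (nat \<times> ('f, 'r) fm) set)"
      have "finite (G \<inter> range FC)" "G \<inter> range FC \<subseteq> FC ` UNIV" using G by auto
      from finite_subset_image[OF this] obtain H where H: "finite H" "G \<inter> range FC = FC ` H" by (elim exE conjE)
      have "finite (G - range FC)" "G - range FC \<subseteq> FI ` D" using G by auto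
      from finite_subset_image[OF this] obtain K where K: "K \<subseteq> D" "finite K" "G - range FC = FI ` K"
        by (elim exE conjE)
      have "finite (H \<union> fst ` X \<union> (\<Union>(i, J)\<in>K. insert i J))" using H K X by (auto simp: D_def)
      then obtain h where h: "\<And>x. x \<in> H \<union> fst ` X \<union> (\<Union>(i, J)\<in>K. insert i J) \<Longrightarrow> x < h"
        unfolding finite_nat_set_iff_bounded by blast
      obtain u where A: "array n \<phi> m l (Suc k) h u" using Suc.prems by blast
      have "FC x u" if "x \<in> H" for x
      proof -
        have "x < h" using h that by blast
        then have sub: "u ` ({..<l} \<union> (\<lambda>i. l + 2 * i) ` {..<x}) \<subseteq> u ` ({..<l} \<union> (\<lambda>i. l + 2 * i) ` {..<h})"
          by (intro image_mono Un_mono) auto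
        have "jointly n \<phi> (u ` ({..<l} \<union> (\<lambda>i. l + 2 * i) ` {..<h}))" using A by (simp add: array_def)
        from jointly_mono[OF this sub] show ?thesis by (simp only: FC_def)
      qed
      moreover have "FI d u" if "d \<in> K" for d
      proof -
        obtain i J where d: "d = (i, J)" by force
        have "insert i J \<subseteq> {..<h}" using h that d by auto
        moreover have J: "J \<subseteq> {i<..}" "card J = s" using that K(1) d by (auto simp: D_def)
        ultimately have "i < h" "J \<subseteq> {i<..<h}" by auto
        from array_shift[OF A this J(2)] s show ?thesis unfolding FI_def d by auto
      qed
      ultimately have "\<forall>Q\<in>FC ` H \<union> FI ` K. Q u" by auto
      then have uG: "\<forall>Q\<in>G. Q u" unfolding H(2)[symmetric] K(3)[symmetric] by blast
      have uX: "sat MM (u (l + 2 * i) @ Rv u (l + 2 * i)) \<chi> \<longleftrightarrow> sat MM (u (Suc (l + 2 * i)) @ Rv u (l + 2 * i)) \<chi>"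
        if "(i, \<chi>) \<in> X" "is_fm L (Suc (l + 2 * i) * m) \<chi>" for i \<chi>
      proof -
        have "i < h" using that(1) h by force
        then obtain \<sigma> where \<sigma>: "automorphism L MM \<sigma>" "\<And>j. j < l + 2 * i \<Longrightarrow> map \<sigma> (u j) = u j"
          "map \<sigma> (u (l + 2 * i)) = u (Suc (l + 2 * i))"
          using A unfolding array_def by blast
        have "\<sigma> x = x" if hx: "x \<in> set (Rv u (l + 2 * i))" for x
        proof -
          obtain j where "j < l + 2 * i" "x \<in> set (u j)" using hx by (auto simp: set_Rv)
          then show ?thesis using \<sigma>(2) by (metis map_eq_conv map_ident)
        qed
        then have R: "map \<sigma> (Rv u (l + 2 * i)) = Rv u (l + 2 * i)" by (simp add: map_idI)
        have "u (l + 2 * i) @ Rv u (l + 2 * i) \<in> tuples (Suc (l + 2 * i) * m) (univ MM)"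
          using A Rv_tuples[of "l + 2 * i" u m] by (intro tuples_append) (auto simp: array_def)
        from automorphism_sat[OF struct_MM \<sigma>(1) that(2) this] show ?thesis by (simp add: R \<sigma>(3))
      qed
      have "\<forall>i. u i \<in> tuples m (univ MM)" using A by (simp add: array_def)
      then show "\<exists>u. (\<forall>i. u i \<in> tuples m (univ MM)) \<and> (\<forall>Q\<in>G. Q u) \<and>
        (\<forall>i \<chi>. (i, \<chi>) \<in> X \<longrightarrow> is_fm L (Suc (l + 2 * i) * m) \<chi> \<longrightarrow>
          (sat MM (u (l + 2 * i) @ Rv u (l + 2 * i)) \<chi> \<longleftrightarrow> sat MM (u (Suc (l + 2 * i)) @ Rv u (l + 2 * i)) \<chi>))"
        using uG uX by (intro exI[of _ u] conjI allI impI) simp_all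
    qed
    then obtain u where u1: "\<forall>i. u i \<in> tuples m (univ MM)" and uQ: "\<forall>Q\<in>range FC \<union> FI ` D. Q u"
      and ex: "\<forall>i. \<exists>\<sigma>. automorphism L MM \<sigma> \<and> (\<forall>j<l + 2 * i. map \<sigma> (u j) = u j) \<and>
        map \<sigma> (u (l + 2 * i)) = u (Suc (l + 2 * i))" by (elim exE conjE)
    have u: "u i \<in> tuples m (univ MM)" "FC h u" "d \<in> D \<Longrightarrow> FI d u" for i h d
      using u1 uQ by (simp_all add: ball_Un)
    from ex obtain \<sigma> where \<sigma>: "\<And>i. automorphism L MM (\<sigma> i)"
      "\<And>i j. j < l + 2 * i \<Longrightarrow> map (\<sigma> i) (u j) = u j"
      "\<And>i. map (\<sigma> i) (u (l + 2 * i)) = u (Suc (l + 2 * i))" by metis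
    show ?thesis
    proof (rule SOP1_of_infinite_array[OF fm u(1) \<sigma>])
      show "jointly n \<phi> (u ` ({..<l} \<union> (\<lambda>i. l + 2 * i) ` {..<h}))" for h
        using u(2)[of h] by (simp add: FC_def)
      show "\<not> jointly n \<phi> (u ` ({..<l} \<union> {Suc (l + 2 * i)} \<union> (\<lambda>j. l + 2 * j) ` J))"
        if "finite J" "J \<subseteq> {i<..}" "card J = s" for i J
        using u(3)[of "(i, J)"] that by (simp add: FI_def D_def)
    qed
  qed
qed

end

section \<open>Kim's lemma and coheirs\<close>

lemma pfms_swap:
  assumes "is_fm L (m + k) \<phi>"
  shows "\<exists>\<chi>. is_fm L (k + m) \<chi> \<and> (\<forall>a b. length a = m \<longrightarrow> length b = k \<longrightarrow> sat MM (b @ a) \<chi> = sat MM (a @ b) \<phi>)"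
proof (intro exI conjI allI impI)
  let ?g = "\<lambda>i. if i < m then k + i else i - m"
  show "is_fm L (k + m) (fm_ren ?g \<phi>)" by (rule is_fm_ren[OF assms]) auto
  show "sat MM (b @ a) (fm_ren ?g \<phi>) = sat MM (a @ b) \<phi>" if "length a = m" "length b = k" for a b
    by (rule sat_ren[OF assms]) (use that in \<open>auto simp: nth_append\<close>)
qed

lemma tp_append:
  assumes eq: "tp L MM a N = tp L MM a' N" and len: "length a = length a'" and d: "set d \<subseteq> N"
  shows "tp L MM (a @ d) N = tp L MM (a' @ d) N"
proof -
  have "(\<chi>, e) \<in> tp L MM (c @ d) N \<longleftrightarrow> (\<chi>, d @ e) \<in> tp L MM c N \<and> set e \<subseteq> N" for \<chi> e c
    using d by (auto simp: tp_def pfms_def add.assoc)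
  then show ?thesis using eq by auto
qed

lemma tp_sat:
  assumes "tp L MM a N = tp L MM a' N" "length a = length a'" "is_fm L (length a + length d) \<chi>" "set d \<subseteq> N"
  shows "sat MM (a @ d) \<chi> \<longleftrightarrow> sat MM (a' @ d) \<chi>"
proof -
  have "(\<chi>, d) \<in> tp L MM a N \<longleftrightarrow> (\<chi>, d) \<in> tp L MM a' N" using assms(1) by simp
  then show ?thesis using assms by (simp add: tp_def pfms_def)
qed

lemma realizes_type_restr_iff:
  assumes q: "q \<in> complete_types L MM m (univ MM)" and A: "A \<subseteq> univ MM"
    and b: "realizes MM b (type_restr q A)" and w: "set w \<subseteq> A" "is_fm L (m + length w) \<chi>"
  shows "sat MM (b @ w) \<chi> \<longleftrightarrow> (\<chi>, w) \<in> q"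
proof -
  have "(\<chi>, w) \<in> q \<or> (Neg \<chi>, w) \<in> q"
    using q w A by (fastforce simp: complete_types_def pfms_def)
  moreover have "(\<psi>, w) \<in> q \<Longrightarrow> sat MM (b @ w) \<psi>" for \<psi>
    using b w(1) by (auto simp: realizes_def type_restr_def)
  ultimately show ?thesis by (metis sat.simps(3))
qed

text \<open>Membership of an instance at \<open>b\<close> depends only on the trace of the formula
  on tuples of \<open>N\<close>, and that trace can be read off \<open>tp L MM b N\<close>.\<close>

lemma utype_invariant:
  assumes U: "ultra U" "tuples m N \<in> U" and N: "N \<subseteq> univ MM"
  shows "invariant_type L MM m N (utype L MM m (univ MM) U)"
  unfolding invariant_type_def
proof (intro conjI allI impI)
  have "tuples m N \<subseteq> tuples m (univ MM)" using N by (auto simp: tuples_def)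
  then have "tuples m (univ MM) \<in> U" by (rule ultra_up[OF U])
  then show "utype L MM m (univ MM) U \<in> complete_types L MM m (univ MM)" by (rule utype_complete[OF U(1)])
  fix b b' \<phi>
  assume b: "set b \<subseteq> univ MM" "set b' \<subseteq> univ MM" "length b = length b'" "tp L MM b N = tp L MM b' N"
    and \<phi>: "is_fm L (m + length b) \<phi>"
  obtain \<chi> where \<chi>: "is_fm L (length b + m) \<chi>"
    "\<And>a c. length a = m \<Longrightarrow> length c = length b \<Longrightarrow> sat MM (c @ a) \<chi> = sat MM (a @ c) \<phi>"
    using pfms_swap[OF \<phi>] by blast
  have "sat MM (a @ b) \<phi> \<longleftrightarrow> sat MM (a @ b') \<phi>" if a: "a \<in> tuples m N" for a
    using tp_sat[OF b(4,3), of a \<chi>] a \<chi> b(3) by (auto simp: tuples_def)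
  then have "{a. sat MM (a @ b) \<phi>} \<in> U \<longleftrightarrow> {a. sat MM (a @ b') \<phi>} \<in> U"
    by (rule ultra_cong_on[OF U])
  then show "(\<phi>, b) \<in> utype L MM m (univ MM) U \<longleftrightarrow> (\<phi>, b') \<in> utype L MM m (univ MM) U"
    using b \<phi> by (auto simp: utype_def pfms_def)
qed

text \<open>By induction the parameters of \<open>Q k\<close> have the same type over
  \<open>N\<close> on both sides; invariance equates the instances in \<open>Q k\<close>, and
  \<open>v k\<close> realises \<open>Q k\<close> over both lists at once.\<close>

lemma Rv_same_type:
  assumes c: "tp L MM c N = tp L MM c' N" "length c = length c'" "set c \<subseteq> univ MM" "set c' \<subseteq> univ MM"
    and N: "N \<subseteq> univ MM" and Q: "\<And>i. invariant_type L MM m N (Q i)"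
    and v: "\<And>i. v i \<in> tuples m (univ MM)"
      "\<And>i. realizes MM (v i) (type_restr (Q i) (N \<union> set c \<union> set c' \<union> (\<Union>j<i. set (v j))))"
  shows "tp L MM (Rv v k @ c) N = tp L MM (Rv v k @ c') N"
proof (induction k)
  case 0
  then show ?case using c(1) by simp
next
  case (Suc k)
  let ?A = "N \<union> set c \<union> set c' \<union> (\<Union>j<k. set (v j))"
  have "set (v j) \<subseteq> univ MM" for j using v(1)[of j] by (simp add: tuples_def)
  then have A: "?A \<subseteq> univ MM" using N c by auto
  have len: "length (v k) = m" using v(1) by (simp add: tuples_def)
  have "sat MM (v k @ Rv v k @ c @ d) \<chi> \<longleftrightarrow> sat MM (v k @ Rv v k @ c' @ d) \<chi>"
    if d: "set d \<subseteq> N" and \<chi>: "is_fm L (m + length (Rv v k @ c @ d)) \<chi>" for \<chi> d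
  proof -
    have q: "Q k \<in> complete_types L MM m (univ MM)" using Q by (simp add: invariant_type_def)
    have s: "set (Rv v k @ c @ d) \<subseteq> ?A" "set (Rv v k @ c' @ d) \<subseteq> ?A" using d by (auto simp: set_Rv)
    have \<chi>': "is_fm L (m + length (Rv v k @ c' @ d)) \<chi>" using \<chi> c(2) by simp
    have "tp L MM (Rv v k @ c @ d) N = tp L MM (Rv v k @ c' @ d) N"
      using tp_append[OF Suc.IH _ d] c(2) by simp
    moreover have "set (Rv v k @ c @ d) \<subseteq> univ MM" "set (Rv v k @ c' @ d) \<subseteq> univ MM" using s A by blast+
    moreover have "length (Rv v k @ c @ d) = length (Rv v k @ c' @ d)" using c(2) by simp
    ultimately have "(\<chi>, Rv v k @ c @ d) \<in> Q k \<longleftrightarrow> (\<chi>, Rv v k @ c' @ d) \<in> Q k"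
      using Q[of k] \<chi> unfolding invariant_type_def by blast
    then show ?thesis
      using realizes_type_restr_iff[OF q A v(2) s(1) \<chi>] realizes_type_restr_iff[OF q A v(2) s(2) \<chi>'] by simp
  qed
  then show ?case using c(2) by (auto simp: tp_def pfms_def len add.assoc)
qed

context monster_model
begin

text \<open>The type may vary with the index because Kim's lemma alternates between two. Each entry
  depends on all earlier ones, hence the well-founded choice.\<close>

lemma sequence_exists:
  assumes Q: "\<And>s :: nat. Q s \<in> complete_types L MM m (univ MM)"
    and N: "N \<subseteq> univ MM" "(card_of N, \<kappa>) \<in> ordLess"
  shows "\<exists>v. \<forall>s. v s \<in> tuples m (univ MM) \<and>
    realizes MM (v s) (type_restr (Q s) (N \<union> (\<Union>j<s. set (v j :: 'a list))))"
proof -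
  define P where "P f s b \<longleftrightarrow> b \<in> tuples m (univ MM) \<and>
    realizes MM b (type_restr (Q s) (N \<union> (\<Union>j<s. set (f j :: 'a list))))" for f and s :: nat and b
  have "\<exists>f. \<forall>s. P f s (f s)"
  proof (rule dependent_wf_choice[OF wf_less_than])
    fix f g :: "nat \<Rightarrow> 'a list" and s r
    assume "\<And>z. (z, s) \<in> less_than \<Longrightarrow> f z = g z"
    then show "P f s r = P g s r" by (simp add: P_def)
  next
    fix s and f :: "nat \<Rightarrow> 'a list" assume "\<And>y. (y, s) \<in> less_than \<Longrightarrow> P f y (f y)"
    then have f: "\<And>y. y < s \<Longrightarrow> set (f y) \<subseteq> univ MM" by (auto simp: P_def tuples_def)
    let ?A = "N \<union> (\<Union>j<s. set (f j))"
    have "type_restr (Q s) ?A \<subseteq> pfms L m ?A" "consistent MM m (type_restr (Q s) ?A)"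
      using Q[of s] consistent_mono[of MM m "Q s" "type_restr (Q s) ?A"]
      by (auto simp: type_restr_def complete_types_def pfms_def)
    moreover have "?A \<subseteq> univ MM" using N f by auto
    moreover have "(card_of ?A, \<kappa>) \<in> ordLess" by (rule Un_small[OF N(2)]) simp
    ultimately show "\<exists>r. P f s r" using type_realized unfolding P_def by blast
  qed
  then show ?thesis unfolding P_def by blast
qed

text \<open>Realise \<open>q\<close> and \<open>r\<close> alternately and read the resulting pairs backwards: since the later pairs
  realise invariant types, the two entries of a pair have the same type over all of them.\<close>

theorem Kim_lemma:
  assumes NSOP1: "NSOP1 L MM" and N: "N \<subseteq> univ MM" "(card_of N, \<kappa>) \<in> ordLess"
    and fm: "is_fm L (n + m) \<phi>"
    and q: "invariant_type L MM m N q" and r: "invariant_type L MM m N r"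
    and eq: "type_restr q N = type_restr r N"
    and div: "\<And>b'. Morley_seq MM m N q b' \<Longrightarrow> k_inconsistent MM n k \<phi> b'"
  shows "\<exists>e K. Morley_seq MM m N r e \<and> \<not> jointly n \<phi> (e ` {..<K})"
proof -
  define Q where "Q s = (if even s then q else r)" for s :: nat
  have Q: "invariant_type L MM m N (Q s)" for s using q r by (simp add: Q_def)
  then have Qc: "Q s \<in> complete_types L MM m (univ MM)" for s by (simp add: invariant_type_def)
  from sequence_exists[of Q, OF Qc N] obtain v where v: "\<And>s. v s \<in> tuples m (univ MM)"
    "\<And>s. realizes MM (v s) (type_restr (Q s) (N \<union> (\<Union>j<s. set (v j))))" by blast
  have len: "length (v s) = m" for s using v(1) by (simp add: tuples_def)
  have realizes_sub: "realizes MM b (type_restr p A) \<Longrightarrow> A' \<subseteq> A \<Longrightarrow> realizes MM b (type_restr p A')"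
    for b p A A' unfolding realizes_def type_restr_def by blast
  have Mq: "Morley_seq MM m N q (\<lambda>t. v (2 * t))"
    unfolding Morley_seq_def
  proof (intro allI conjI v(1))
    fix t show "realizes MM (v (2 * t)) (type_restr q (N \<union> (\<Union>j<t. set (v (2 * j)))))"
    proof (rule realizes_sub)
      show "realizes MM (v (2 * t)) (type_restr q (N \<union> (\<Union>j<2 * t. set (v j))))"
        using v(2)[of "2 * t"] by (simp add: Q_def)
      show "N \<union> (\<Union>j<t. set (v (2 * j))) \<subseteq> N \<union> (\<Union>j<2 * t. set (v j))"
        by (intro Un_mono UN_least UN_upper) auto
    qed
  qed
  have Mr: "Morley_seq MM m N r (\<lambda>t. v (Suc (2 * t)))"
    unfolding Morley_seq_def
  proof (intro allI conjI v(1))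
    fix t show "realizes MM (v (Suc (2 * t))) (type_restr r (N \<union> (\<Union>j<t. set (v (Suc (2 * j))))))"
    proof (rule realizes_sub)
      show "realizes MM (v (Suc (2 * t))) (type_restr r (N \<union> (\<Union>j<Suc (2 * t). set (v j))))"
        using v(2)[of "Suc (2 * t)"] by (simp add: Q_def)
      show "N \<union> (\<Union>j<t. set (v (Suc (2 * j)))) \<subseteq> N \<union> (\<Union>j<Suc (2 * t). set (v j))"
        by (intro Un_mono UN_least UN_upper) auto
    qed
  qed
  have base: "tp L MM (v (Suc (2 * t))) N = tp L MM (v (2 * t)) N" for t
  proof -
    have "sat MM (v (Suc (2 * t)) @ d) \<chi> \<longleftrightarrow> sat MM (v (2 * t) @ d) \<chi>"
      if d: "set d \<subseteq> N" and \<chi>: "is_fm L (m + length d) \<chi>" for d \<chi>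
    proof -
      have s: "sat MM (v s @ d) \<chi> \<longleftrightarrow> (\<chi>, d) \<in> Q s" for s
        by (rule realizes_type_restr_iff[OF Qc _ v(2) _ \<chi>]) (use N d v(1) in \<open>auto simp: tuples_def\<close>)
      have "(\<chi>, d) \<in> q \<longleftrightarrow> (\<chi>, d) \<in> r" using eq d by (auto simp: type_restr_def set_eq_iff)
      then show ?thesis using s[of "2 * t"] s[of "Suc (2 * t)"] by (simp add: Q_def)
    qed
    then show ?thesis by (auto simp: tp_def pfms_def len)
  qed
  have shift: "\<exists>\<sigma>. automorphism L MM \<sigma> \<and> (\<forall>s. Suc (2 * t) < s \<and> s < 2 * h \<longrightarrow> map \<sigma> (v s) = v s) \<and>
      map \<sigma> (v (Suc (2 * t))) = v (2 * t)" for t h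
  proof -
    define w where "w i = v (2 * t + 2 + i)" for i
    have "tp L MM (Rv w (2 * h) @ v (Suc (2 * t))) N = tp L MM (Rv w (2 * h) @ v (2 * t)) N"
    proof (rule Rv_same_type[OF base, where Q = "\<lambda>i. Q (2 * t + 2 + i)" and m = m and v = w])
      show "realizes MM (w i) (type_restr (Q (2 * t + 2 + i))
          (N \<union> set (v (Suc (2 * t))) \<union> set (v (2 * t)) \<union> (\<Union>j<i. set (w j))))" for i
      proof (rule realizes_sub)
        show "realizes MM (w i) (type_restr (Q (2 * t + 2 + i)) (N \<union> (\<Union>j<2 * t + 2 + i. set (v j))))"
          unfolding w_def by (rule v(2))
        have "set (w j) \<subseteq> (\<Union>j<2 * t + 2 + i. set (v j))" if "j < i" for j
          using that unfolding w_def by (intro UN_upper) simp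
        moreover have "set (v (Suc (2 * t))) \<subseteq> (\<Union>j<2 * t + 2 + i. set (v j))"
          "set (v (2 * t)) \<subseteq> (\<Union>j<2 * t + 2 + i. set (v j))" by (intro UN_upper; simp)+
        ultimately show "N \<union> set (v (Suc (2 * t))) \<union> set (v (2 * t)) \<union> (\<Union>j<i. set (w j)) \<subseteq>
            N \<union> (\<Union>j<2 * t + 2 + i. set (v j))" by (intro Un_mono Un_least UN_least) blast+
      qed
    qed (use v(1) N len Q in \<open>auto simp: w_def tuples_def\<close>)
    from tp_sat[OF this, of "[]"] have
      same: "sat MM (Rv w (2 * h) @ v (Suc (2 * t))) \<chi> \<longleftrightarrow> sat MM (Rv w (2 * h) @ v (2 * t)) \<chi>"
      if "is_fm L (2 * h * m + m) \<chi>" for \<chi>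
      using that Rv_tuples[of "2 * h" w m "univ MM"] v(1) by (simp add: len w_def tuples_def)
    have R: "Rv w (2 * h) \<in> tuples (2 * h * m) (univ MM)" by (rule Rv_tuples) (simp add: w_def v(1))
    from homogeneous_lists[OF tuples_append[OF R v(1) refl] tuples_append[OF R v(1) refl] same]
    obtain \<sigma> where \<sigma>: "automorphism L MM \<sigma>"
      "map \<sigma> (Rv w (2 * h) @ v (Suc (2 * t))) = Rv w (2 * h) @ v (2 * t)" by blast
    then have m: "map \<sigma> (Rv w (2 * h)) = Rv w (2 * h)" "map \<sigma> (v (Suc (2 * t))) = v (2 * t)"
      by (auto simp: append_eq_append_conv)
    have "map \<sigma> (v s) = v s" if s: "Suc (2 * t) < s" "s < 2 * h" for s
    proof (rule map_idI)
      fix x assume "x \<in> set (v s)"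
      moreover have "v s = w (s - (2 * t + 2))"
        unfolding w_def by (rule arg_cong[where f = v]) (use s in linarith)
      moreover have "s - (2 * t + 2) < 2 * h" using s by simp
      ultimately have "x \<in> set (Rv w (2 * h))" by (auto simp: set_Rv)
      then show "\<sigma> x = x" using m(1) by (metis map_eq_conv map_ident)
    qed
    then show ?thesis using \<sigma>(1) m(2) by blast
  qed
  \<comment> \<open>Otherwise the consistent Morley sequence in \<open>r\<close> and the
    inconsistent one in \<open>q\<close> would be the even and odd columns of arrays of every
    height.\<close>
  have "\<exists>K. \<not> jointly n \<phi> ((\<lambda>t. v (Suc (2 * t))) ` {..<K})"
  proof (rule ccontr)
    assume "\<not> ?thesis"
    then have J: "\<And>K. jointly n \<phi> ((\<lambda>t. v (Suc (2 * t))) ` {..<K})" by blast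
    have "\<exists>u. array n \<phi> m 0 k h u" for h
    proof -
      \<comment> \<open>Row \<open>i\<close> is pair \<open>h - 1 - i\<close> with its entry from
        \<open>r\<close> first. The automorphism taking it to the partner from \<open>q\<close>
        fixes the later pairs, which after reversal are the earlier rows.\<close>
      define u where "u j = (if even j then v (Suc (2 * (h - 1 - j div 2))) else v (2 * (h - 1 - j div 2)))" for j
      have "\<exists>\<sigma>. automorphism L MM \<sigma> \<and> (\<forall>j<0 + 2 * i. map \<sigma> (u j) = u j) \<and>
          map \<sigma> (u (0 + 2 * i)) = u (Suc (0 + 2 * i))" if i: "i < h" for i
      proof -
        obtain \<sigma> where \<sigma>: "automorphism L MM \<sigma>"
          "\<And>s. Suc (2 * (h - 1 - i)) < s \<Longrightarrow> s < 2 * h \<Longrightarrow> map \<sigma> (v s) = v s"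
          "map \<sigma> (v (Suc (2 * (h - 1 - i)))) = v (2 * (h - 1 - i))" using shift by blast
        have "map \<sigma> (u j) = u j" if j: "j < 2 * i" for j
        proof -
          have "j div 2 < i" using j by auto
          then have "h - 1 - i < h - 1 - j div 2" "h - 1 - j div 2 < h" using i by auto
          then show ?thesis unfolding u_def by (auto intro!: \<sigma>(2))
        qed
        then show ?thesis using \<sigma>(1,3) by (intro exI[of _ \<sigma>]) (simp add: u_def)
      qed
      moreover have "jointly n \<phi> (u ` ({..<0} \<union> (\<lambda>i. 0 + 2 * i) ` {..<h}))"
        by (rule jointly_mono[OF J[of h]]) (auto simp: u_def)
      moreover have "\<not> jointly n \<phi> (u ` ({..<0} \<union> (\<lambda>i. Suc (0 + 2 * i)) ` I))"
        if I: "I \<subseteq> {..<h}" "card I = k" for I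
      proof -
        let ?I = "(\<lambda>i. h - 1 - i) ` I"
        have fI: "finite I" using I(1) finite_subset by blast
        have "inj_on (\<lambda>i. h - 1 - i) I"
        proof (rule inj_onI)
          fix x y assume "x \<in> I" "y \<in> I" and eq: "h - 1 - x = h - 1 - y"
          then have "x < h" "y < h" using I(1) by auto
          then show "x = y" using eq by linarith
        qed
        then have "card ?I = k" using I(2) card_image by blast
        then have "\<not> consistent MM n {(\<phi>, v (2 * t)) | t. t \<in> ?I}"
          using div[OF Mq] fI unfolding k_inconsistent_def by blast
        moreover have "{(\<phi>, v (2 * t)) | t. t \<in> ?I} = (\<lambda>c. (\<phi>, c)) ` (\<lambda>i. v (2 * (h - 1 - i))) ` I" by auto
        moreover have "u ` ({..<0} \<union> (\<lambda>i. Suc (0 + 2 * i)) ` I) = (\<lambda>i. v (2 * (h - 1 - i))) ` I"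
        proof -
          have "u (Suc (0 + 2 * i)) = v (2 * (h - 1 - i))" for i by (simp add: u_def)
          then show ?thesis by (simp only: image_Un image_image) simp
        qed
        ultimately show ?thesis using consistent_jointly[of "(\<lambda>i. v (2 * (h - 1 - i))) ` I" n \<phi>] fI by simp
      qed
      moreover have "\<forall>i. u i \<in> tuples m (univ MM)" using v(1) by (simp add: u_def)
      ultimately show ?thesis unfolding array_def by (intro exI[of _ u]) simp
    qed
    from SOP1_of_arrays[OF fm this] NSOP1 show False by blast
  qed
  then show ?thesis using Mr by blast
qed

text \<open>Elementarity of \<open>N\<close> applies to one formula at a time, so a finite part of
  the type is traded for a single formula implying it; the parameter lists are concatenated and the
  indices renamed to match.\<close>

lemma tp_finitely_directed:
  assumes b: "b \<in> tuples m (univ MM)" and N: "N \<subseteq> univ MM" and \<Delta>: "finite \<Delta>" "\<Delta> \<subseteq> tp L MM b N"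
  shows "\<exists>\<chi> w. (\<chi>, w) \<in> tp L MM b N \<and>
    (\<forall>a\<in>tuples m (univ MM). sat MM (a @ w) \<chi> \<longrightarrow> (\<forall>d\<in>\<Delta>. sat MM (a @ snd d) (fst d)))"
  using \<Delta>
proof (induction \<Delta>)
  case empty
  have "(Ex (Eq (Var 0) (Var 0)), []) \<in> tp L MM b N" using univ_ne by (auto simp: tp_def pfms_def)
  then show ?case by blast
next
  case (insert d \<Delta>)
  obtain \<chi> w where \<chi>: "(\<chi>, w) \<in> tp L MM b N"
    "\<And>a. a \<in> tuples m (univ MM) \<Longrightarrow> sat MM (a @ w) \<chi> \<Longrightarrow> \<forall>d\<in>\<Delta>. sat MM (a @ snd d) (fst d)"
    using insert by auto
  obtain \<psi> z where d: "d = (\<psi>, z)" by force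
  have lb: "length b = m" using b by (simp add: tuples_def)
  have f: "is_fm L (m + length w) \<chi>" "is_fm L (m + length z) \<psi>" "set w \<subseteq> N" "set z \<subseteq> N"
    "sat MM (b @ w) \<chi>" "sat MM (b @ z) \<psi>"
    using \<chi>(1) insert.prems d by (auto simp: tp_def pfms_def lb)
  let ?g = "\<lambda>i. if i < m then i else length w + i"
  let ?\<theta> = "Conj (fm_ren (\<lambda>i. i) \<chi>) (fm_ren ?g \<psi>)"
  have "is_fm L (m + length (w @ z)) ?\<theta>"
    by (simp, intro conjI is_fm_ren[OF f(1)] is_fm_ren[OF f(2)]) auto
  moreover have s: "sat MM (a @ w @ z) ?\<theta> \<longleftrightarrow> sat MM (a @ w) \<chi> \<and> sat MM (a @ z) \<psi>" if "length a = m" for a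
  proof -
    have "sat MM (a @ w @ z) (fm_ren (\<lambda>i. i) \<chi>) = sat MM (a @ w) \<chi>"
      by (rule sat_ren[OF f(1)]) (auto simp: that nth_append)
    moreover have "sat MM (a @ w @ z) (fm_ren ?g \<psi>) = sat MM (a @ z) \<psi>"
      by (rule sat_ren[OF f(2)]) (auto simp: that nth_append)
    ultimately show ?thesis by simp
  qed
  ultimately have "(?\<theta>, w @ z) \<in> tp L MM b N" using f by (auto simp: tp_def pfms_def lb)
  moreover have "\<forall>d\<in>insert d \<Delta>. sat MM (a @ snd d) (fst d)"
    if "a \<in> tuples m (univ MM)" "sat MM (a @ w @ z) ?\<theta>" for a
    using s[of a] that \<chi>(2)[OF that(1)] d by (auto simp: tuples_def)
  ultimately show ?case by blast
qed

text \<open>By elementarity every formula of \<open>tp L MM b N\<close> has a solution in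
  \<open>N\<close>, so the type extends to an ultrafilter on tuples of \<open>N\<close>; applying
  this to negations gives the equivalence.\<close>

lemma coheir_exists:
  assumes el: "elem_substruct L (restr MM N) MM" and b: "b \<in> tuples m (univ MM)"
  shows "\<exists>U. ultra U \<and> tuples m N \<in> U \<and>
    (\<forall>w \<chi>. set w \<subseteq> N \<longrightarrow> is_fm L (m + length w) \<chi> \<longrightarrow> (sat MM (b @ w) \<chi> \<longleftrightarrow> {a. sat MM (a @ w) \<chi>} \<in> U))"
proof -
  have N: "N \<subseteq> univ MM" using el by (simp add: elem_substruct_def)
  have el': "sat (restr MM N) a \<phi> = sat MM a \<phi>" if "is_fm L k \<phi>" "a \<in> tuples k N" for k \<phi> a
    using el that by (simp add: elem_substruct_def)
  have lb: "length b = m" using b by (simp add: tuples_def)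
  have "\<exists>U. ultra U \<and> tuples m N \<in> U \<and> (\<forall>d\<in>tp L MM b N. {a \<in> tuples m N. sat MM (a @ snd d) (fst d)} \<in> U)"
  proof (rule ultra_exists_on)
    fix \<Delta> assume \<Delta>: "finite \<Delta>" "\<Delta> \<subseteq> tp L MM b N"
    from tp_finitely_directed[OF b N \<Delta>] obtain \<chi> w where \<chi>: "(\<chi>, w) \<in> tp L MM b N"
      "\<And>a. a \<in> tuples m (univ MM) \<Longrightarrow> sat MM (a @ w) \<chi> \<Longrightarrow> \<forall>d\<in>\<Delta>. sat MM (a @ snd d) (fst d)"
      by blast
    have f: "is_fm L (m + length w) \<chi>" "set w \<subseteq> N" "sat MM (b @ w) \<chi>"
      using \<chi>(1) by (auto simp: tp_def pfms_def lb)
    have w: "w \<in> tuples (length w) N" using f(2) by (simp add: tuples_def)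
    have "sat MM w ((Ex ^^ m) \<chi>)" unfolding sat_Exs using b f(3) by blast
    then have "sat (restr MM N) w ((Ex ^^ m) \<chi>)" using el'[of "length w", OF _ w] f(1) by (simp add: is_fm_Exs)
    then obtain a where a: "a \<in> tuples m N" "sat (restr MM N) (a @ w) \<chi>" by (auto simp: sat_Exs)
    have "sat MM (a @ w) \<chi>" using el'[OF f(1) tuples_append[OF a(1) w refl]] a(2) by simp
    moreover have "a \<in> tuples m (univ MM)" using a(1) N by (auto simp: tuples_def)
    ultimately show "\<exists>a\<in>tuples m N. \<forall>d\<in>\<Delta>. sat MM (a @ snd d) (fst d)" using \<chi>(2) a(1) by blast
  qed
  then obtain U where U: "ultra U" "tuples m N \<in> U"
    "\<And>d. d \<in> tp L MM b N \<Longrightarrow> {a \<in> tuples m N. sat MM (a @ snd d) (fst d)} \<in> U" by blast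
  have pos: "{a. sat MM (a @ w) \<chi>} \<in> U"
    if "set w \<subseteq> N" "is_fm L (m + length w) \<chi>" "sat MM (b @ w) \<chi>" for w \<chi>
  proof -
    have "(\<chi>, w) \<in> tp L MM b N" using that by (simp add: tp_def pfms_def lb)
    from U(3)[OF this] show ?thesis by (rule ultra_up[OF U(1)]) auto
  qed
  have "sat MM (b @ w) \<chi> \<longleftrightarrow> {a. sat MM (a @ w) \<chi>} \<in> U"
    if "set w \<subseteq> N" "is_fm L (m + length w) \<chi>" for w \<chi>
    using pos[OF that] pos[of w "Neg \<chi>"] that ultra_not[OF U(1), of "\<lambda>a. sat MM (a @ w) \<chi>"] by auto
  then show ?thesis using U(1,2) by blast
qed

text \<open>The two equivalences say that \<open>b\<close> realises over \<open>N\<close> the type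
  given by \<open>U\<close> and that \<open>e\<close> is a Morley sequence in this coheir. They
  mention \<open>U\<close> rather than a global type, so that largeness of sets can be used
  directly. Only one sequence and one inconsistent initial segment are recorded, as Kim's lemma
  supplies no more.\<close>

definition coheir_witness ::
    "nat \<Rightarrow> ('f, 'r) fm \<Rightarrow> 'a set \<Rightarrow> 'a list \<Rightarrow> 'a list set set \<Rightarrow> (nat \<Rightarrow> 'a list) \<Rightarrow> nat \<Rightarrow> bool" where
  "coheir_witness n \<phi> N b U e K \<longleftrightarrow> ultra U \<and> tuples (length b) N \<in> U \<and>
    (\<forall>t. e t \<in> tuples (length b) (univ MM)) \<and>
    (\<forall>w \<chi>. set w \<subseteq> N \<longrightarrow> is_fm L (length b + length w) \<chi> \<longrightarrow>
      (sat MM (b @ w) \<chi> \<longleftrightarrow> {a. sat MM (a @ w) \<chi>} \<in> U)) \<and>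
    (\<forall>t w \<chi>. set w \<subseteq> N \<union> (\<Union>j<t. set (e j)) \<longrightarrow> is_fm L (length b + length w) \<chi> \<longrightarrow>
      (sat MM (e t @ w) \<chi> \<longleftrightarrow> {a. sat MM (a @ w) \<chi>} \<in> U)) \<and>
    \<not> jointly n \<phi> (e ` {..<K})"

text \<open>The given witness \<open>q\<close> and the coheir \<open>?r\<close> have the same
  restriction to \<open>N\<close>, namely the type of \<open>b\<close>, so Kim's lemma transfers
  inconsistency from one to the other.\<close>

theorem Kim_divides_coheir:
  assumes NSOP1: "NSOP1 L MM" and el: "elem_substruct L (restr MM N) MM"
    and N: "(card_of N, \<kappa>) \<in> ordLess" and fm: "is_fm L (n + length b) \<phi>" and b: "set b \<subseteq> univ MM"
    and div: "Kim_divides L MM n N (\<phi>, b)"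
  shows "\<exists>U e K. coheir_witness n \<phi> N b U e K"
proof -
  let ?m = "length b"
  have NM: "N \<subseteq> univ MM" using el by (simp add: elem_substruct_def)
  obtain q k where q: "invariant_type L MM ?m N q" "tp L MM b N \<subseteq> q"
    "\<And>b'. Morley_seq MM ?m N q b' \<Longrightarrow> k_inconsistent MM n k \<phi> b'"
    using div by (auto simp: Kim_divides_def)
  obtain U where U: "ultra U" "tuples ?m N \<in> U"
    "\<And>w \<chi>. set w \<subseteq> N \<Longrightarrow> is_fm L (?m + length w) \<chi> \<Longrightarrow> sat MM (b @ w) \<chi> \<longleftrightarrow> {a. sat MM (a @ w) \<chi>} \<in> U"
    using coheir_exists[OF el, of b ?m] b by (auto simp: tuples_def)
  let ?r = "utype L MM ?m (univ MM) U"
  have r: "invariant_type L MM ?m N ?r" by (rule utype_invariant[OF U(1,2) NM])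
  have qc: "q \<in> complete_types L MM ?m (univ MM)" using q(1) by (simp add: invariant_type_def)
  have qN: "(\<chi>, w) \<in> q \<longleftrightarrow> sat MM (b @ w) \<chi>" if w: "set w \<subseteq> N" "is_fm L (?m + length w) \<chi>" for w \<chi>
  proof
    assume "sat MM (b @ w) \<chi>"
    then show "(\<chi>, w) \<in> q" using q(2) w by (auto simp: tp_def pfms_def)
  next
    assume a: "(\<chi>, w) \<in> q"
    show "sat MM (b @ w) \<chi>"
    proof (rule ccontr)
      assume "\<not> sat MM (b @ w) \<chi>"
      then have "(Neg \<chi>, w) \<in> q" using q(2) w by (auto simp: tp_def pfms_def)
      then have "consistent MM ?m {(\<chi>, w), (Neg \<chi>, w)}"
        using a qc consistent_mono[of MM ?m q] by (simp add: complete_types_def)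
      then show False by (simp add: consistent_finite realizes_def)
    qed
  qed
  have "q \<subseteq> pfms L ?m (univ MM)" using qc by (simp add: complete_types_def)
  then have "type_restr q N = type_restr ?r N"
    using qN U(3) NM unfolding type_restr_def utype_def pfms_def by fast
  from Kim_lemma[OF NSOP1 NM N fm q(1) r this q(3)] obtain e K
    where e: "Morley_seq MM ?m N ?r e" "\<not> jointly n \<phi> (e ` {..<K})" by blast
  have et: "e t \<in> tuples ?m (univ MM)" for t using e(1) by (simp add: Morley_seq_def)
  have "sat MM (e t @ w) \<chi> \<longleftrightarrow> {a. sat MM (a @ w) \<chi>} \<in> U"
    if w: "set w \<subseteq> N \<union> (\<Union>j<t. set (e j))" "is_fm L (?m + length w) \<chi>" for t w \<chi>
  proof -
    have A: "N \<union> (\<Union>j<t. set (e j)) \<subseteq> univ MM" using NM et by (auto simp: tuples_def)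
    have "?r \<in> complete_types L MM ?m (univ MM)" using r by (simp add: invariant_type_def)
    from realizes_type_restr_iff[OF this A _ w] e(1)
    have "sat MM (e t @ w) \<chi> \<longleftrightarrow> (\<chi>, w) \<in> ?r" by (simp add: Morley_seq_def)
    then show ?thesis using w A by (auto simp: utype_def pfms_def)
  qed
  then show ?thesis unfolding coheir_witness_def using U et e(2) by blast
qed

end

section \<open>Clubs\<close>

text \<open>Values are sets of size at most \<open>\<mu>\<close>, so that one function can collect
  all witnesses belonging to a tuple, or absorb \<open>\<mu>\<close> many other functions.\<close>

definition small_fun :: "'a set \<Rightarrow> 'c rel \<Rightarrow> ('a list \<Rightarrow> 'a set) \<Rightarrow> bool" where
  "small_fun X \<mu> F \<longleftrightarrow> (\<forall>d. set d \<subseteq> X \<longrightarrow> F d \<subseteq> X \<and> (card_of (F d), \<mu>) \<in> ordLeq)"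

definition closed_sets :: "'a set \<Rightarrow> 'c rel \<Rightarrow> ('a list \<Rightarrow> 'a set) \<Rightarrow> 'a set set" where
  "closed_sets X \<mu> F = {N \<in> subsets_of_card X \<mu>. \<forall>d. set d \<subseteq> N \<longrightarrow> F d \<subseteq> N}"

text \<open>Stationarity, tested only against families of the form \<open>closed_sets\<close>. A set
  that fails to be positive is missed by such a family; for the bad submodels this leads to the club
  that is sought.\<close>

definition positive :: "'a set \<Rightarrow> 'c rel \<Rightarrow> 'a set set \<Rightarrow> bool" where
  "positive X \<mu> S \<longleftrightarrow> (\<forall>F. small_fun X \<mu> F \<longrightarrow> closed_sets X \<mu> F \<inter> S \<noteq> {})"

locale infinite_cardinal =
  fixes \<mu> :: "'c rel"
  assumes Card: "Card_order \<mu>" and inf: "infinite (Field \<mu>)"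
begin

lemma UNION_le:
  "(card_of I, \<mu>) \<in> ordLeq \<Longrightarrow> (\<And>i. i \<in> I \<Longrightarrow> (card_of (A i), \<mu>) \<in> ordLeq) \<Longrightarrow> (card_of (\<Union>i\<in>I. A i), \<mu>) \<in> ordLeq"
  using card_of_UNION_ordLeq_infinite_Field[OF inf Card] by blast

lemma nat_le: "(card_of (UNIV :: nat set), \<mu>) \<in> ordLeq"
  using inf infinite_iff_card_of_nat card_of_Field_ordIso[OF Card] ordLeq_ordIso_trans by blast

lemma finite_le: "finite A \<Longrightarrow> (card_of A, \<mu>) \<in> ordLeq"
  using finite_ordLess_infinite[OF card_of_Well_order, of \<mu> A] inf Card
  by (simp add: card_order_on_well_order_on Field_card_of ordLess_imp_ordLeq)

lemma Un_le: "(card_of A, \<mu>) \<in> ordLeq \<Longrightarrow> (card_of B, \<mu>) \<in> ordLeq \<Longrightarrow> (card_of (A \<union> B), \<mu>) \<in> ordLeq"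
  by (rule card_of_Un_ordLeq_infinite_Field[OF inf]) (use Card in auto)

lemma tuples_le:
  assumes "(card_of Y, \<mu>) \<in> ordLeq"
  shows "(card_of (tuples n Y), \<mu>) \<in> ordLeq"
proof (induction n)
  case 0
  have "tuples 0 Y = {[]}" by (auto simp: tuples_def)
  then show ?case by (simp add: finite_le)
next
  case (Suc n)
  have "tuples (Suc n) Y = (\<Union>x\<in>Y. (\<lambda>a. x # a) ` tuples n Y)"
    unfolding set_eq_iff by (simp add: tuples_Suc image_iff)
  moreover have "(card_of ((\<lambda>a. x # a) ` tuples n Y), \<mu>) \<in> ordLeq" for x
    by (rule ordLeq_transitive[OF card_of_image Suc.IH])
  ultimately show ?case by (simp add: UNION_le[OF assms])
qed

lemma lists_le:
  assumes "(card_of Y, \<mu>) \<in> ordLeq"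
  shows "(card_of {d. set d \<subseteq> Y}, \<mu>) \<in> ordLeq"
proof -
  have "{d. set d \<subseteq> Y} = (\<Union>n. tuples n Y)" by (auto simp: tuples_def)
  then show ?thesis by (simp only:) (rule UNION_le[OF nat_le tuples_le[OF assms]])
qed

lemma subsets_of_cardI:
  assumes "Y \<subseteq> Z" "Z \<subseteq> X" "(card_of Z, \<mu>) \<in> ordLeq" "Y \<in> subsets_of_card X \<mu>"
  shows "Z \<in> subsets_of_card X \<mu>"
proof -
  have "(\<mu>, card_of Y) \<in> ordLeq"
    using assms(4) by (simp add: subsets_of_card_def ordIso_iff_ordLeq)
  then have "(\<mu>, card_of Z) \<in> ordLeq" using card_of_mono1[OF assms(1)] ordLeq_transitive by blast
  then show ?thesis using assms by (simp add: subsets_of_card_def ordIso_iff_ordLeq)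
qed

text \<open>Arguments of \<open>F\<close> are finite lists: \<omega> rounds of closing off suffice,
  and a list in the union of a chain already lies in one member.\<close>

lemma club_closed_sets:
  assumes F: "small_fun X \<mu> F"
  shows "club X \<mu> (closed_sets X \<mu> F)"
  unfolding club_def
proof (intro conjI ballI allI impI)
  show "closed_sets X \<mu> F \<subseteq> subsets_of_card X \<mu>" by (auto simp: closed_sets_def)
next
  fix Y assume Y: "Y \<in> subsets_of_card X \<mu>"
  define Z where "Z = rec_nat Y (\<lambda>_ A. A \<union> (\<Union>d\<in>{d. set d \<subseteq> A}. F d))"
  have Z: "Z 0 = Y" "Z (Suc n) = Z n \<union> (\<Union>d\<in>{d. set d \<subseteq> Z n}. F d)" for n by (simp_all add: Z_def)
  have Zn: "Z n \<subseteq> X \<and> (card_of (Z n), \<mu>) \<in> ordLeq" for n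
  proof (induction n)
    case 0
    then show ?case using Y by (simp add: Z(1) subsets_of_card_def ordIso_iff_ordLeq)
  next
    case (Suc n)
    have F': "F d \<subseteq> X" "(card_of (F d), \<mu>) \<in> ordLeq" if "set d \<subseteq> Z n" for d
      using F Suc that unfolding small_fun_def by (meson subset_trans)+
    have "(card_of (\<Union>d\<in>{d. set d \<subseteq> Z n}. F d), \<mu>) \<in> ordLeq"
      by (rule UNION_le[OF lists_le]) (use Suc F' in auto)
    then have "(card_of (Z (Suc n)), \<mu>) \<in> ordLeq" unfolding Z(2) using Suc by (intro Un_le) simp_all
    then show ?case using Suc F'(1) unfolding Z(2) by blast
  qed
  have mono: "Z n \<subseteq> Z k" if "n \<le> k" for n k
    using that by (induction rule: dec_induct) (auto simp: Z(2))
  let ?Z = "\<Union>n. Z n"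
  have "F d \<subseteq> ?Z" if d: "set d \<subseteq> ?Z" for d
  proof -
    have "\<exists>n. set d \<subseteq> Z n" using d
    proof (induction d)
      case (Cons x d)
      then obtain n k where "set d \<subseteq> Z n" "x \<in> Z k" by auto
      then have "set (x # d) \<subseteq> Z (max n k)" using mono[of n "max n k"] mono[of k "max n k"] by auto
      then show ?case by blast
    qed simp
    then obtain n where "set d \<subseteq> Z n" by blast
    then have "F d \<subseteq> Z (Suc n)" by (auto simp: Z(2))
    then show ?thesis by blast
  qed
  moreover have "?Z \<in> subsets_of_card X \<mu>"
  proof (rule subsets_of_cardI[OF _ _ _ Y])
    show "Y \<subseteq> ?Z" using Z(1) by blast
    show "?Z \<subseteq> X" using Zn by blast
    show "(card_of ?Z, \<mu>) \<in> ordLeq" by (rule UNION_le[OF nat_le]) (use Zn in blast)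
  qed
  ultimately have "?Z \<in> closed_sets X \<mu> F" by (simp add: closed_sets_def)
  moreover have "Y \<subseteq> ?Z" using Z(1) by blast
  ultimately show "\<exists>Z\<in>closed_sets X \<mu> F. Y \<subseteq> Z" by blast
next
  fix D assume D: "D \<subseteq> closed_sets X \<mu> F" "D \<noteq> {}" "chain\<^sub>\<subseteq> D" "(card_of D, \<mu>) \<in> ordLeq"
  then obtain Y where Y: "Y \<in> D" by blast
  have "\<Union>D \<in> subsets_of_card X \<mu>"
  proof (rule subsets_of_cardI)
    show "Y \<subseteq> \<Union>D" "Y \<in> subsets_of_card X \<mu>" using Y D(1) by (auto simp: closed_sets_def)
    show "\<Union>D \<subseteq> X" using D(1) by (auto simp: closed_sets_def subsets_of_card_def)
    have "(card_of (\<Union>A\<in>D. A), \<mu>) \<in> ordLeq"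
      by (rule UNION_le[OF D(4)]) (use D(1) in \<open>auto simp: closed_sets_def subsets_of_card_def ordIso_iff_ordLeq\<close>)
    then show "(card_of (\<Union>D), \<mu>) \<in> ordLeq" by simp
  qed
  moreover have "F d \<subseteq> \<Union>D" if d: "set d \<subseteq> \<Union>D" for d
  proof -
    have "subset.chain D D" using D(3) by (auto simp: subset_chain_def chain_subset_def)
    then obtain A where A: "A \<in> D" "set d \<subseteq> A"
      by (rule finite_subset_Union_chain[OF finite_set d D(2)])
    then have "F d \<subseteq> A" using D(1) by (auto simp: closed_sets_def)
    then show ?thesis using A by blast
  qed
  ultimately show "\<Union>D \<in> closed_sets X \<mu> F" by (simp add: closed_sets_def)
qed

lemma positive_nonempty:
  assumes "positive X \<mu> S"
  shows "S \<noteq> {}"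
proof -
  have "small_fun X \<mu> (\<lambda>_. {})" by (simp add: small_fun_def finite_le)
  then have "closed_sets X \<mu> (\<lambda>_. {}) \<inter> S \<noteq> {}" using assms by (simp add: positive_def)
  then show ?thesis by blast
qed

lemma positive_Int_closed:
  assumes S: "positive X \<mu> S" and G: "small_fun X \<mu> G"
  shows "positive X \<mu> (S \<inter> closed_sets X \<mu> G)"
  unfolding positive_def
proof (intro allI impI)
  fix F assume F: "small_fun X \<mu> F"
  have "small_fun X \<mu> (\<lambda>d. F d \<union> G d)" using F G by (simp add: small_fun_def Un_le)
  then have "closed_sets X \<mu> (\<lambda>d. F d \<union> G d) \<inter> S \<noteq> {}" using S by (simp add: positive_def)
  moreover have "closed_sets X \<mu> (\<lambda>d. F d \<union> G d) = closed_sets X \<mu> F \<inter> closed_sets X \<mu> G"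
    by (auto simp: closed_sets_def)
  ultimately show "closed_sets X \<mu> F \<inter> (S \<inter> closed_sets X \<mu> G) \<noteq> {}" by (simp add: Int_ac)
qed

text \<open>Closure under the function with constant value \<open>A\<close>, applied to the empty
  list, means containing \<open>A\<close>.\<close>

lemma positive_supersets:
  assumes S: "positive X \<mu> S" and A: "finite A" "A \<subseteq> X"
  shows "positive X \<mu> {N \<in> S. A \<subseteq> N}"
proof -
  have "small_fun X \<mu> (\<lambda>_. A)" using A by (simp add: small_fun_def finite_le)
  from positive_Int_closed[OF S this] show ?thesis
    unfolding positive_def closed_sets_def by (auto 4 4 dest: spec[of _ "[]"])
qed

text \<open>Completeness of the nonstationary ideal: conditions refuting each colour would merge
  into one condition, which some \<open>N\<close> in \<open>S\<close> satisfies although its own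
  colour is refuted.\<close>

lemma positive_colour:
  assumes S: "positive X \<mu> S" and I: "(card_of I, \<mu>) \<in> ordLeq" and c: "\<And>N. N \<in> S \<Longrightarrow> c N \<in> I"
  shows "\<exists>i. positive X \<mu> {N \<in> S. c N = i}"
proof (rule ccontr)
  assume "\<not> ?thesis"
  then have "\<forall>i. \<exists>F. small_fun X \<mu> F \<and> closed_sets X \<mu> F \<inter> {N \<in> S. c N = i} = {}"
    unfolding positive_def by simp
  then obtain F where F: "\<And>i. small_fun X \<mu> (F i)" "\<And>i. closed_sets X \<mu> (F i) \<inter> {N \<in> S. c N = i} = {}"
    by metis
  have "small_fun X \<mu> (\<lambda>d. \<Union>i\<in>I. F i d)"
    unfolding small_fun_def
  proof (intro allI impI conjI)
    fix d assume "set d \<subseteq> X"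
    then have *: "F i d \<subseteq> X" "(card_of (F i d), \<mu>) \<in> ordLeq" for i
      using F(1)[of i] by (simp_all add: small_fun_def)
    then show "(\<Union>i\<in>I. F i d) \<subseteq> X" by blast
    show "(card_of (\<Union>i\<in>I. F i d), \<mu>) \<in> ordLeq" by (rule UNION_le[OF I *(2)])
  qed
  then obtain N where N: "N \<in> closed_sets X \<mu> (\<lambda>d. \<Union>i\<in>I. F i d)" "N \<in> S"
    using S unfolding positive_def by blast
  then have "N \<in> closed_sets X \<mu> (F (c N))" using c[OF N(2)] unfolding closed_sets_def by blast
  then show False using F(2)[of "c N"] N(2) by blast
qed

text \<open>Fodor's lemma: the diagonal intersection of the closure conditions \<open>F a\<close> is the single closure
  condition that reads \<open>a\<close> off the first \<open>m\<close> entries of its argument.\<close>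

lemma positive_press_down:
  assumes S: "positive X \<mu> S" and f: "\<And>N. N \<in> S \<Longrightarrow> f N \<in> tuples m N"
  shows "\<exists>a. positive X \<mu> {N \<in> S. f N = a}"
proof (rule ccontr)
  assume "\<not> ?thesis"
  then have "\<forall>a. \<exists>F. small_fun X \<mu> F \<and> closed_sets X \<mu> F \<inter> {N \<in> S. f N = a} = {}"
    unfolding positive_def by simp
  then obtain F where F: "\<And>a. small_fun X \<mu> (F a)" "\<And>a. closed_sets X \<mu> (F a) \<inter> {N \<in> S. f N = a} = {}"
    by metis
  have "small_fun X \<mu> (\<lambda>d. F (take m d) (drop m d))"
    using F(1) set_drop_subset unfolding small_fun_def by (metis subset_trans)
  then obtain N where N: "N \<in> closed_sets X \<mu> (\<lambda>d. F (take m d) (drop m d))" "N \<in> S"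
    using S unfolding positive_def by blast
  have fN: "length (f N) = m" "set (f N) \<subseteq> N" using f[OF N(2)] by (auto simp: tuples_def)
  have "F (f N) d \<subseteq> N" if "set d \<subseteq> N" for d
  proof -
    have "set (f N @ d) \<subseteq> N" using fN that by simp
    then have "F (take m (f N @ d)) (drop m (f N @ d)) \<subseteq> N" using N(1) unfolding closed_sets_def by blast
    then show ?thesis using fN by simp
  qed
  then have "N \<in> closed_sets X \<mu> (F (f N))" using N(1) unfolding closed_sets_def by blast
  then show False using F(2)[of "f N"] N(2) by blast
qed

end

section \<open>Elementary submodels from closure conditions\<close>

lemma tm_val_restr: "tm_val (restr M N) e t = tm_val M e t"
proof (induction t)
  case (Fn f ts)
  then have "map (tm_val (restr M N) e) ts = map (tm_val M e) ts" by simp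
  then show ?case by (simp only: tm_val.simps) simp
qed simp

lemma Tarski_Vaught:
  assumes M: "is_struct L M" and N: "N \<subseteq> univ M" "N \<noteq> {}"
    and TV: "\<And>k \<phi> d. is_fm L (Suc k) \<phi> \<Longrightarrow> d \<in> tuples k N \<Longrightarrow> \<exists>w\<in>univ M. sat M (w # d) \<phi> \<Longrightarrow>
      \<exists>w\<in>N. sat M (w # d) \<phi>"
  shows "elem_substruct L (restr M N) M"
proof -
  have NM: "a \<in> tuples k (univ M)" if "a \<in> tuples k N" for a k using that N(1) by (auto simp: tuples_def)
  have "fint M f a \<in> N" if f: "f \<in> funs L" "a \<in> tuples (farity L f) N" for f a
  proof -
    let ?k = "farity L f"
    \<comment> \<open>Its only solution is the value of \<open>f\<close> at \<open>a\<close>, so the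
      test itself yields closure under \<open>f\<close>.\<close>
    let ?\<phi> = "Eq (Var 0) (Fn f (map Var [1..<Suc ?k]))"
    have l: "length a = ?k" using f by (simp add: tuples_def)
    have "map (tm_val M (w # a)) (map Var [1..<Suc ?k]) = a" for w
      by (rule nth_equalityI) (auto simp: l simp del: upt_Suc)
    then have s: "sat M (w # a) ?\<phi> \<longleftrightarrow> w = fint M f a" for w
      by (simp only: sat.simps tm_val.simps) simp
    have "is_fm L (Suc ?k) ?\<phi>" using f(1) by auto
    moreover have "fint M f a \<in> univ M" using M f NM[OF f(2)] by (auto simp: is_struct_def)
    ultimately obtain w where "w \<in> N" "sat M (w # a) ?\<phi>" using TV[of ?k ?\<phi> a] f(2) s by blast
    then show ?thesis using s by simp
  qed
  then have st: "is_struct L (restr M N)" using N(2) by (auto simp: is_struct_def)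
  have "sat (restr M N) a \<phi> = sat M a \<phi>" if "is_fm L k \<phi>" "a \<in> tuples k N" for k \<phi> a
    using that
  proof (induction \<phi> arbitrary: k a)
    case (Eq s t)
    then show ?case by (simp add: tm_val_restr)
  next
    case (Rel r ts)
    have "map (tm_val (restr M N) a) ts = map (tm_val M a) ts" by (simp add: tm_val_restr)
    then show ?case by (simp only: sat.simps) simp
  next
    case (Ex \<phi>)
    have IH: "sat (restr M N) (w # a) \<phi> = sat M (w # a) \<phi>" if "w \<in> N" for w
      using Ex.IH[of "Suc k" "w # a"] Ex.prems that by (simp add: tuples_def)
    have "(\<exists>w\<in>univ M. sat M (w # a) \<phi>) \<longleftrightarrow> (\<exists>w\<in>N. sat M (w # a) \<phi>)"
      using TV[of k \<phi> a] Ex.prems N(1) by auto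
    then show ?case using IH by simp
  qed auto
  then show ?thesis using M N(1) st unfolding elem_substruct_def by simp
qed

context monster_model
begin

sublocale infinite_cardinal "theory_card L"
proof
  show "Card_order (theory_card L)" by (simp add: theory_card_def card_of_Card_order)
  show "infinite (Field (theory_card L))" by (simp add: theory_card_def Field_card_of infinite_formulas)
qed

text \<open>A set-valued Skolem function: \<open>d\<close> is sent to witnesses for all formulas
  solvable at \<open>d\<close>, at most |T| many. They are sought in \<open>M\<close>, where they
  exist because \<open>M\<close> is elementary in the monster.\<close>

lemma closed_elementary:
  assumes M: "elem_substruct L (restr MM M) MM"
  shows "\<exists>F. small_fun M (theory_card L) F \<and> (\<forall>N\<in>closed_sets M (theory_card L) F.
    elem_substruct L (restr MM N) MM \<and> elem_substruct L (restr MM N) (restr MM M))"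
proof -
  have MU: "M \<subseteq> univ MM" using M by (simp add: elem_substruct_def)
  have elM: "sat (restr MM M) a \<phi> = sat MM a \<phi>" if "is_fm L k \<phi>" "a \<in> tuples k M" for k \<phi> a
    using M that by (simp add: elem_substruct_def)
  define W where "W d = {\<phi>. is_fm L (Suc (length d)) \<phi> \<and> (\<exists>w\<in>M. sat MM (w # d) \<phi>)}" for d
  define wit where "wit d \<phi> = (SOME w. w \<in> M \<and> sat MM (w # d) \<phi>)" for d \<phi>
  have wit: "wit d \<phi> \<in> M \<and> sat MM (wit d \<phi> # d) \<phi>" if "\<phi> \<in> W d" for d \<phi>
    unfolding wit_def by (rule someI_ex) (use that in \<open>auto simp: W_def\<close>)
  let ?F = "\<lambda>d. wit d ` W d"
  have "small_fun M (theory_card L) ?F"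
    unfolding small_fun_def
  proof (intro allI impI conjI)
    fix d show "?F d \<subseteq> M" using wit by blast
    have "W d \<subseteq> {\<phi>. \<exists>n. is_fm L n \<phi>}" by (auto simp: W_def)
    then have "(card_of (W d), theory_card L) \<in> ordLeq" unfolding theory_card_def by (rule card_of_mono1)
    then show "(card_of (?F d), theory_card L) \<in> ordLeq" by (rule ordLeq_transitive[OF card_of_image])
  qed
  moreover have "elem_substruct L (restr MM N) MM \<and> elem_substruct L (restr MM N) (restr MM M)"
    if N: "N \<in> closed_sets M (theory_card L) ?F" for N
  proof -
    have NM: "N \<subseteq> M" "(card_of N, theory_card L) \<in> ordIso" and cl: "\<And>d. set d \<subseteq> N \<Longrightarrow> ?F d \<subseteq> N"
      using N by (auto simp: closed_sets_def subsets_of_card_def)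
    have "N \<noteq> {}"
    proof
      assume "N = {}"
      then have "finite {\<phi>. \<exists>n. is_fm L n \<phi>}" using NM(2) unfolding theory_card_def
        by (metis card_of_ordIso_finite finite.emptyI)
      then show False using infinite_formulas by blast
    qed
    have el: "elem_substruct L (restr MM N) MM"
    proof (rule Tarski_Vaught[OF struct_MM _ \<open>N \<noteq> {}\<close>])
      show "N \<subseteq> univ MM" using NM MU by blast
      fix k \<phi> d assume \<phi>: "is_fm L (Suc k) \<phi>" and d: "d \<in> tuples k N" and ex: "\<exists>w\<in>univ MM. sat MM (w # d) \<phi>"
      have dM: "d \<in> tuples k M" using d NM by (auto simp: tuples_def)
      have "sat MM d (Ex \<phi>)" using ex by simp
      then have "sat (restr MM M) d (Ex \<phi>)" using elM[OF _ dM, of "Ex \<phi>"] \<phi> by simp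
      then obtain w where w: "w \<in> M" "sat (restr MM M) (w # d) \<phi>" by auto
      have "w # d \<in> tuples (Suc k) M" using w dM by (simp add: tuples_def)
      then have "sat MM (w # d) \<phi>" using elM[OF \<phi>] w(2) by blast
      then have "\<phi> \<in> W d" using \<phi> d w(1) by (auto simp: W_def tuples_def)
      moreover have "wit d \<phi> \<in> N" using cl[of d] d calculation by (auto simp: tuples_def)
      ultimately show "\<exists>w\<in>N. sat MM (w # d) \<phi>" using wit by blast
    qed
    moreover have "elem_substruct L (restr MM N) (restr MM M)"
    proof -
      have "sat (restr MM N) a \<phi> = sat (restr MM M) a \<phi>" if "is_fm L k \<phi>" "a \<in> tuples k N" for k \<phi> a
      proof -
        have "a \<in> tuples k M" using that NM by (auto simp: tuples_def)
        then show ?thesis using elM[OF that(1)] el that by (simp add: elem_substruct_def)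
      qed
      then show ?thesis using el M NM(1) unfolding elem_substruct_def by simp
    qed
    ultimately show ?thesis by blast
  qed
  ultimately show ?thesis by blast
qed

end

section \<open>Positive sets of bad submodels yield arrays\<close>

lemma Rv_cong: "(\<And>i. i < N \<Longrightarrow> u i = v i) \<Longrightarrow> Rv u N = Rv v N"
  by (induction N) auto

context monster_model
begin

text \<open>The clauses of \<open>coheir_witness\<close> speak of single formulas, so inconsistency
  with a finite set \<open>C\<close> has to become one formula with parameters from
  \<open>C\<close>.\<close>

lemma jointly_formula:
  assumes fm: "is_fm L (n + m) \<phi>" and C: "finite C" "C \<subseteq> tuples m (univ MM)"
  shows "\<exists>\<chi> w. set w \<subseteq> (\<Union>c\<in>C. set c) \<and> is_fm L (m + length w) \<chi> \<and>
    (\<forall>a\<in>tuples m (univ MM). sat MM (a @ w) \<chi> \<longleftrightarrow> \<not> jointly n \<phi> (insert a C))"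
proof -
  obtain cs where cs: "set cs = C" using finite_list[OF C(1)] by blast
  define k where "k = length cs"
  \<comment> \<open>\<open>a\<close> comes last after an enumeration of \<open>C\<close>, hence
    stands in front of the parameters \<open>w\<close>.\<close>
  define v where "v a i = (if i < k then cs ! i else a)" for a i
  define w where "w = Rv (\<lambda>i. cs ! i) k"
  have csk: "cs ! i \<in> tuples m (univ MM)" if "i < k" for i
    using that C(2) cs by (auto simp: k_def)
  have vw: "Rv (v a) (Suc k) = a @ w" for a
    using Rv_cong[of k "v a" "\<lambda>i. cs ! i"] by (simp add: w_def v_def)
  have "v a ` {..<k} = (!) cs ` {..<k}" for a by (rule image_cong) (simp_all add: v_def)
  then have "v a ` {..<k} = C" for a
    using nth_image[of k cs] cs by (simp add: k_def lessThan_atLeast0)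
  moreover have "v a k = a" for a by (simp add: v_def)
  ultimately have im: "v a ` {..<Suc k} = insert a C" for a by (simp add: lessThan_Suc)
  have w: "w \<in> tuples (k * m) (univ MM)" unfolding w_def by (rule Rv_tuples) (rule csk)
  obtain P where P: "dfn L MM (Suc k * m) P"
    "\<And>u. (\<forall>i. u i \<in> tuples m (univ MM)) \<Longrightarrow> P (Rv u (Suc k)) \<longleftrightarrow> jointly n \<phi> (u ` {..<Suc k})"
    using dfn_jointly[OF fm, of "{..<Suc k}" "Suc k"] by blast
  obtain \<chi> where \<chi>: "is_fm L (Suc k * m) \<chi>"
    "\<And>a. a \<in> tuples (Suc k * m) (univ MM) \<Longrightarrow> (\<not> P a) \<longleftrightarrow> sat MM a \<chi>"
    using dfn_not[OF P(1)] unfolding dfn_def by blast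
  have "sat MM (a @ w) \<chi> \<longleftrightarrow> \<not> jointly n \<phi> (insert a C)" if a: "a \<in> tuples m (univ MM)" for a
  proof -
    have "a @ w \<in> tuples (Suc k * m) (univ MM)" by (rule tuples_append[OF a w]) simp
    from \<chi>(2)[OF this] have 1: "\<not> P (a @ w) \<longleftrightarrow> sat MM (a @ w) \<chi>" .
    have "\<forall>i. v a i \<in> tuples m (univ MM)" using a csk by (simp add: v_def)
    from P(2)[OF this] have "P (a @ w) \<longleftrightarrow> jointly n \<phi> (insert a C)" unfolding vw im .
    with 1 show ?thesis by blast
  qed
  moreover have "set w \<subseteq> (\<Union>c\<in>C. set c)" using cs by (auto simp: w_def set_Rv k_def)
  moreover have "is_fm L (m + length w) \<chi>" using \<chi>(1) w by (simp add: tuples_def)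
  ultimately show ?thesis by blast
qed

text \<open>An exchange argument. A formula over \<open>N\<close> and the earlier \<open>e j\<close>
  that holds of \<open>e t\<close> holds of almost every \<open>a\<close>, so inconsistency survives
  replacing the last Morley entry \<open>e t\<close> by \<open>a\<close>. Only finitely many pairs
  \<open>(t, J)\<close> and formulas in \<open>X\<close> are involved, so a large set of tuples
  meets all requirements, and it contains a tuple of \<open>N\<close>.\<close>

lemma coheir_step:
  assumes fm: "is_fm L (n + m) \<phi>" and W: "coheir_witness n \<phi> N b U e K" and m: "length b = m"
    and N: "N \<subseteq> univ MM" and R: "R \<in> tuples k N" and c: "\<And>j :: nat. j < h \<Longrightarrow> c j \<in> tuples m N" and X: "finite X"
    and inv: "\<And>t J. J \<subseteq> {..<h} \<Longrightarrow> card J + t = K \<Longrightarrow> \<not> jointly n \<phi> (e ` {..<t} \<union> c ` J)"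
  shows "\<exists>d\<in>tuples m N. (\<forall>\<chi>\<in>X. is_fm L (m + k) \<chi> \<longrightarrow> (sat MM (d @ R) \<chi> \<longleftrightarrow> sat MM (b @ R) \<chi>)) \<and>
    (\<forall>t J. J \<subseteq> {..<h} \<longrightarrow> card J + Suc t = K \<longrightarrow> \<not> jointly n \<phi> (insert d (e ` {..<t} \<union> c ` J)))"
proof -
  have U: "ultra U" "tuples m N \<in> U" and e: "\<And>t. e t \<in> tuples m (univ MM)"
    and bU: "\<And>w \<chi>. set w \<subseteq> N \<Longrightarrow> is_fm L (m + length w) \<chi> \<Longrightarrow> sat MM (b @ w) \<chi> \<longleftrightarrow> {a. sat MM (a @ w) \<chi>} \<in> U"
    and eU: "\<And>t w \<chi>. set w \<subseteq> N \<union> (\<Union>j<t. set (e j)) \<Longrightarrow> is_fm L (m + length w) \<chi> \<Longrightarrow>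
      sat MM (e t @ w) \<chi> \<longleftrightarrow> {a. sat MM (a @ w) \<chi>} \<in> U"
    using W m unfolding coheir_witness_def by auto
  have tN: "tuples m N \<subseteq> tuples m (univ MM)" using N by (auto simp: tuples_def)
  let ?A = "\<lambda>\<chi>. {a. is_fm L (m + k) \<chi> \<longrightarrow> (sat MM (a @ R) \<chi> \<longleftrightarrow> sat MM (b @ R) \<chi>)}"
  have A: "?A \<chi> \<in> U" for \<chi>
  proof (cases "is_fm L (m + k) \<chi>")
    case True
    then have "sat MM (b @ R) \<chi> \<longleftrightarrow> {a. sat MM (a @ R) \<chi>} \<in> U" using bU[of R \<chi>] R by (simp add: tuples_def)
    then show ?thesis using True ultra_not[OF U(1), of "\<lambda>a. sat MM (a @ R) \<chi>"]
      by (cases "sat MM (b @ R) \<chi>") auto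
  next
    case False
    then have "?A \<chi> = UNIV" by simp
    then show ?thesis using ultra_up[OF U, of UNIV] by simp
  qed
  let ?B = "\<lambda>(t, J). {a \<in> tuples m N. \<not> jointly n \<phi> (insert a (e ` {..<t} \<union> c ` J))}"
  define I where "I = {(t, J). J \<subseteq> {..<h} \<and> card J + Suc t = K}"
  have "I \<subseteq> {..<K} \<times> Pow {..<h}" by (auto simp: I_def)
  then have fI: "finite I" by (rule finite_subset) simp
  have B: "?B d \<in> U" if dI: "d \<in> I" for d
  proof -
    obtain t J where d: "d = (t, J)" "J \<subseteq> {..<h}" "card J + Suc t = K" using dI by (auto simp: I_def)
    let ?C = "e ` {..<t} \<union> c ` J"
    have fJ: "finite J" using d(2) finite_subset by blast
    have cN: "set (c j) \<subseteq> N" if "j \<in> J" for j using c[of j] that d(2) by (auto simp: tuples_def)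
    have C: "finite ?C" "?C \<subseteq> tuples m (univ MM)" using fJ e c d(2) tN by auto
    obtain \<chi> w where \<chi>: "set w \<subseteq> (\<Union>c\<in>?C. set c)" "is_fm L (m + length w) \<chi>"
      "\<And>a. a \<in> tuples m (univ MM) \<Longrightarrow> sat MM (a @ w) \<chi> \<longleftrightarrow> \<not> jointly n \<phi> (insert a ?C)"
      using jointly_formula[OF fm C] by blast
    have "insert (e t) ?C = e ` {..<Suc t} \<union> c ` J" by (auto simp: lessThan_Suc)
    then have "sat MM (e t @ w) \<chi>" using inv[OF d(2,3)] \<chi>(3)[OF e] by simp
    moreover have "set w \<subseteq> N \<union> (\<Union>j<t. set (e j))" using \<chi>(1) cN by fastforce
    ultimately have "{a. sat MM (a @ w) \<chi>} \<in> U" using eU[OF _ \<chi>(2)] by blast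
    from ultra_Int[OF U this] show ?thesis
      by (rule ultra_up[OF U(1)]) (use \<chi>(3) tN in \<open>auto simp: d\<close>)
  qed
  have "tuples m N \<inter> ({a. \<forall>\<chi>\<in>X. a \<in> ?A \<chi>} \<inter> {a. \<forall>d\<in>I. a \<in> ?B d}) \<in> U"
    by (intro ultra_Int[OF U(1)] ultra_INT[OF U(1)] U(2) X fI A B)
  from ultra_nonempty[OF U(1) this] obtain a where a: "a \<in> tuples m N" "\<And>\<chi>. \<chi> \<in> X \<Longrightarrow> a \<in> ?A \<chi>"
    "\<And>d. d \<in> I \<Longrightarrow> a \<in> ?B d" by blast
  have "\<not> jointly n \<phi> (insert a (e ` {..<t} \<union> c ` J))" if "J \<subseteq> {..<h}" "card J + Suc t = K" for t J
    using a(3)[of "(t, J)"] that by (simp add: I_def)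
  then show ?thesis using a(1,2) by (intro bexI[of _ a]) auto
qed

text \<open>The odd entry of row \<open>i\<close> is a tuple of \<open>N\<close> approximating the coheir of \<open>b N\<close>, made independent of
  \<open>N\<close> by pressing down; the even entry is \<open>b N\<close> for some remaining \<open>N\<close>.  The last clause says that
  the odd entries chosen so far still look like the start of the Morley sequence \<open>e N\<close>.\<close>

lemma approximate_array:
  assumes S: "positive M (theory_card L) S" and fm: "is_fm L (n + m) \<phi>" and M: "M \<subseteq> univ MM"
    and N: "\<forall>N\<in>S. N \<subseteq> M" and b: "\<forall>N\<in>S. b N \<in> tuples m M"
    and W: "\<forall>N\<in>S. coheir_witness n \<phi> N (b N) (U N) (e N) K"
    and X: "\<And>i. finite (X i)"
  shows "\<exists>u S'. positive M (theory_card L) S' \<and> S' \<subseteq> S \<and> (\<forall>j. u j \<in> tuples m M) \<and>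
    (\<forall>i<h. u (2 * i) \<in> b ` S) \<and>
    (\<forall>i<h. \<forall>\<chi>\<in>X i. is_fm L (Suc (2 * i) * m) \<chi> \<longrightarrow>
      (sat MM (u (2 * i) @ Rv u (2 * i)) \<chi> \<longleftrightarrow> sat MM (u (Suc (2 * i)) @ Rv u (2 * i)) \<chi>)) \<and>
    (\<forall>N\<in>S'. \<forall>t J. J \<subseteq> {..<h} \<longrightarrow> card J + t = K \<longrightarrow>
      \<not> jointly n \<phi> (e N ` {..<t} \<union> (\<lambda>j. u (Suc (2 * j))) ` J))"
proof (induction h)
  case 0
  \<comment> \<open>\<open>b N0\<close> merely fills the sequence, as there are no rows yet; with
    \<open>J\<close> empty the last clause is part of \<open>coheir_witness\<close>.\<close>
  obtain N0 where "N0 \<in> S" using positive_nonempty[OF S] by blast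
  then have "\<forall>j. (\<lambda>_::nat. b N0) j \<in> tuples m M" using b by blast
  moreover have "\<forall>N\<in>S. \<not> jointly n \<phi> (e N ` {..<K})" using W unfolding coheir_witness_def by blast
  ultimately show ?case using S by (intro exI[of _ "\<lambda>_. b N0"] exI[of _ S]) simp
next
  case (Suc h)
  then obtain u S' where S': "positive M (theory_card L) S'" "S' \<subseteq> S" and u': "\<forall>j. u j \<in> tuples m M"
    and ub': "\<forall>i<h. u (2 * i) \<in> b ` S"
    and ueq': "\<forall>i<h. \<forall>\<chi>\<in>X i. is_fm L (Suc (2 * i) * m) \<chi> \<longrightarrow>
      (sat MM (u (2 * i) @ Rv u (2 * i)) \<chi> \<longleftrightarrow> sat MM (u (Suc (2 * i)) @ Rv u (2 * i)) \<chi>)"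
    and inv': "\<forall>N\<in>S'. \<forall>t J. J \<subseteq> {..<h} \<longrightarrow> card J + t = K \<longrightarrow>
      \<not> jointly n \<phi> (e N ` {..<t} \<union> (\<lambda>j. u (Suc (2 * j))) ` J)"
    by (elim exE conjE)
  note u = u'[rule_format] and ub = ub'[rule_format] and ueq = ueq'[rule_format] and inv = inv'[rule_format]
  let ?R = "Rv u (2 * h)"
  define A where "A = (\<Union>j<2 * h. set (u j))"
  have A: "finite A" "A \<subseteq> M" using u by (auto simp: A_def tuples_def)
  \<comment> \<open>The earlier entries must lie in \<open>N\<close> to serve as parameters there;
    this costs only a closure condition.\<close>
  define S1 where "S1 = {N \<in> S'. A \<subseteq> N}"
  have S1: "positive M (theory_card L) S1" unfolding S1_def by (rule positive_supersets[OF S'(1) A])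
  define good where "good N d \<longleftrightarrow>
    (\<forall>\<chi>\<in>X h. is_fm L (m + 2 * h * m) \<chi> \<longrightarrow> (sat MM (d @ ?R) \<chi> \<longleftrightarrow> sat MM (b N @ ?R) \<chi>)) \<and>
    (\<forall>t J. J \<subseteq> {..<h} \<longrightarrow> card J + Suc t = K \<longrightarrow>
      \<not> jointly n \<phi> (insert d (e N ` {..<t} \<union> (\<lambda>j. u (Suc (2 * j))) ` J)))" for N d
  have step: "\<exists>d\<in>tuples m N. good N d" if N1: "N \<in> S1" for N
    unfolding good_def
  proof (rule coheir_step[OF fm W[rule_format]])
    show NS: "N \<in> S" using N1 S'(2) by (auto simp: S1_def)
    show "length (b N) = m" using b[rule_format, OF NS] by (simp add: tuples_def)
    show "N \<subseteq> univ MM" using N[rule_format, OF NS] M by blast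
    have uN: "u j \<in> tuples m N" if "j < 2 * h" for j
      using u[of j] N1 that by (auto simp: S1_def A_def tuples_def)
    show "?R \<in> tuples (2 * h * m) N" by (rule Rv_tuples) (rule uN)
    show "u (Suc (2 * j)) \<in> tuples m N" if "j < h" for j by (rule uN) (use that in simp)
    show "finite (X h)" by (rule X)
    show "\<not> jointly n \<phi> (e N ` {..<t} \<union> (\<lambda>j. u (Suc (2 * j))) ` J)"
      if "J \<subseteq> {..<h}" "card J + t = K" for t J
      by (rule inv[OF _ that]) (use N1 in \<open>simp add: S1_def\<close>)
  qed
  define f where "f N = (SOME d. d \<in> tuples m N \<and> good N d)" for N
  have f: "f N \<in> tuples m N \<and> good N (f N)" if "N \<in> S1" for N
    unfolding f_def by (rule someI_ex) (use step[OF that] in blast)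
  obtain d where S2: "positive M (theory_card L) {N \<in> S1. f N = d}" (is "positive _ _ ?S2")
    using positive_press_down[OF S1, of f m] f by blast
  have d: "d \<in> tuples m N" "good N d" if "N \<in> ?S2" for N using f[of N] that by auto
  have S2S: "?S2 \<subseteq> S" using S'(2) by (auto simp: S1_def)
  \<comment> \<open>One submodel supplies the even entry of the new row, while the common
    \<open>d\<close> preserves the invariant for all remaining \<open>N\<close>.\<close>
  obtain N0 where N0: "N0 \<in> ?S2" using positive_nonempty[OF S2] by blast
  have N0S: "N0 \<in> S" using N0 S2S by blast
  define v where "v = u(2 * h := b N0, Suc (2 * h) := d)"
  have vu: "v j = u j" if "j < 2 * h" for j using that by (simp add: v_def)
  have vh: "v (2 * h) = b N0" "v (Suc (2 * h)) = d" by (simp_all add: v_def)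
  have Rvu: "Rv v (2 * i) = Rv u (2 * i)" if "i \<le> h" for i by (rule Rv_cong) (use that vu in simp)
  have "d \<in> tuples m M" using d(1)[OF N0] N[rule_format, OF N0S] by (auto simp: tuples_def)
  then have "\<forall>j. v j \<in> tuples m M" using u b[rule_format, OF N0S] by (simp add: v_def)
  moreover have "v (2 * i) \<in> b ` S" if "i < Suc h" for i
  proof (cases "i = h")
    case True
    then show ?thesis using N0S vh by simp
  next
    case False
    then show ?thesis using ub[of i] vu[of "2 * i"] that by simp
  qed
  moreover have "sat MM (v (2 * i) @ Rv v (2 * i)) \<chi> \<longleftrightarrow> sat MM (v (Suc (2 * i)) @ Rv v (2 * i)) \<chi>"
    if i: "i < Suc h" and \<chi>: "\<chi> \<in> X i" "is_fm L (Suc (2 * i) * m) \<chi>" for i \<chi>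
  proof (cases "i = h")
    case True
    have "is_fm L (m + 2 * h * m) \<chi>" using \<chi>(2) True by simp
    then have "sat MM (d @ ?R) \<chi> \<longleftrightarrow> sat MM (b N0 @ ?R) \<chi>"
      using d(2)[OF N0] \<chi>(1) True unfolding good_def by blast
    then show ?thesis using True vh Rvu[of h] by simp
  next
    case False
    then have "i < h" using i by simp
    then show ?thesis using ueq[OF _ \<chi>] vu[of "2 * i"] vu[of "Suc (2 * i)"] Rvu[of i] by simp
  qed
  moreover have "\<not> jointly n \<phi> (e N ` {..<t} \<union> (\<lambda>j. v (Suc (2 * j))) ` J)"
    if NS2: "N \<in> ?S2" and J: "J \<subseteq> {..<Suc h}" "card J + t = K" for N t J
  proof (cases "h \<in> J")
    case False
    then have Jh: "J \<subseteq> {..<h}" using J(1) by (auto simp: lessThan_Suc)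
    then have "(\<lambda>j. v (Suc (2 * j))) ` J = (\<lambda>j. u (Suc (2 * j))) ` J" using vu by (intro image_cong) auto
    then show ?thesis using inv[OF _ Jh J(2), of N] NS2 by (simp add: S1_def)
  next
    case True
    have fJ: "finite J" using J(1) finite_subset by blast
    have Jh: "J - {h} \<subseteq> {..<h}" using J(1) by (auto simp: lessThan_Suc)
    \<comment> \<open>Dropping row \<open>h\<close> from \<open>J\<close> makes room for the Morley
      entry that \<open>d\<close> replaced.\<close>
    have "card (J - {h}) + Suc t = K" using card_Suc_Diff1[OF fJ True] J(2) by simp
    then have *: "\<not> jointly n \<phi> (insert d (e N ` {..<t} \<union> (\<lambda>j. u (Suc (2 * j))) ` (J - {h})))"
      using d(2)[OF NS2] Jh unfolding good_def by blast
    have "(\<lambda>j. u (Suc (2 * j))) ` (J - {h}) = (\<lambda>j. v (Suc (2 * j))) ` (J - {h})"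
      using vu Jh by (intro image_cong) auto
    moreover have "d \<in> (\<lambda>j. v (Suc (2 * j))) ` J" using True vh(2) by force
    ultimately have "insert d (e N ` {..<t} \<union> (\<lambda>j. u (Suc (2 * j))) ` (J - {h})) \<subseteq>
        e N ` {..<t} \<union> (\<lambda>j. v (Suc (2 * j))) ` J" by auto
    then show ?thesis using * jointly_mono by blast
  qed
  ultimately show ?case using S2 S2S by (intro exI[of _ v] exI[of _ ?S2]) blast
qed

text \<open>Approximate arrays for every height and every finite set of formulas give an exact
  infinite one by compactness. Its even column is consistent because all instances used in the
  approximations belong to the single type \<open>p\<close>.\<close>

lemma SOP1_of_positive:
  assumes S: "positive M (theory_card L) S" and fm: "is_fm L (n + m) \<phi>" and M: "M \<subseteq> univ MM"
    and N: "\<forall>N\<in>S. N \<subseteq> M" and b: "\<forall>N\<in>S. b N \<in> tuples m M"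
    and W: "\<forall>N\<in>S. coheir_witness n \<phi> N (b N) (U N) (e N) K"
    and p: "consistent MM n p" "\<forall>N\<in>S. (\<phi>, b N) \<in> p"
  shows "\<not> NSOP1 L MM"
proof -
  define FC where "FC = (\<lambda>(h::nat) u. jointly n \<phi> (u ` (\<lambda>i::nat. 2 * i) ` {..<h}))"
  define FI where "FI = (\<lambda>I u. \<not> jointly n \<phi> (u ` (\<lambda>i. Suc (2 * i)) ` I))"
  define D where "D = {I :: nat set. finite I \<and> card I = K}"
  have "\<exists>u. (\<forall>i. u i \<in> tuples m (univ MM)) \<and> (\<forall>Q\<in>range FC \<union> FI ` D. Q u) \<and>
    (\<forall>i. \<exists>\<sigma>. automorphism L MM \<sigma> \<and> (\<forall>j<0 + 2 * i. map \<sigma> (u j) = u j) \<and>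
      map \<sigma> (u (0 + 2 * i)) = u (Suc (0 + 2 * i)))"
  proof (rule compactness_array)
    show "seq_dfn m Q" if "Q \<in> range FC \<union> FI ` D" for Q
    proof -
      have "seq_dfn m (FC h)" for h unfolding FC_def by (intro seq_dfn_jointly[OF fm]) simp
      moreover have "seq_dfn m (FI I)" if "I \<in> D" for I
        unfolding FI_def using that by (intro seq_dfn_not seq_dfn_jointly[OF fm]) (simp add: D_def)
      ultimately show ?thesis using that by blast
    qed
    fix G X assume G: "finite G" "G \<subseteq> range FC \<union> FI ` D" and X: "finite (X :: (nat \<times> ('f, 'r) fm) set)"
    have "finite (G \<inter> range FC)" "G \<inter> range FC \<subseteq> FC ` UNIV" using G by auto
    from finite_subset_image[OF this] obtain H where H: "finite H" "G \<inter> range FC = FC ` H" by (elim exE conjE)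
    have "finite (G - range FC)" "G - range FC \<subseteq> FI ` D" using G by auto
    from finite_subset_image[OF this] obtain Y where Y: "Y \<subseteq> D" "finite Y" "G - range FC = FI ` Y"
      by (elim exE conjE)
    have "finite (H \<union> fst ` X \<union> \<Union>Y)" using H X Y(1,2) by (auto simp: D_def)
    then obtain h where h: "\<And>x. x \<in> H \<union> fst ` X \<union> \<Union>Y \<Longrightarrow> x < h"
      unfolding finite_nat_set_iff_bounded by blast
    have fX: "finite {\<chi>. (i, \<chi>) \<in> X}" for i
      by (rule finite_subset[OF _ finite_imageI[OF X, of snd]]) force
    from approximate_array[where U = U and X = "\<lambda>i. {\<chi>. (i, \<chi>) \<in> X}" and h = h, OF S fm M N b W fX]
    obtain u S' where S': "positive M (theory_card L) S'" and u: "\<forall>j. u j \<in> tuples m M"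
      and ub: "\<forall>i<h. u (2 * i) \<in> b ` S"
      and ueq: "\<forall>i<h. \<forall>\<chi>\<in>{\<chi>. (i, \<chi>) \<in> X}. is_fm L (Suc (2 * i) * m) \<chi> \<longrightarrow>
        (sat MM (u (2 * i) @ Rv u (2 * i)) \<chi> \<longleftrightarrow> sat MM (u (Suc (2 * i)) @ Rv u (2 * i)) \<chi>)"
      and inv: "\<forall>N\<in>S'. \<forall>t J. J \<subseteq> {..<h} \<longrightarrow> card J + t = K \<longrightarrow>
        \<not> jointly n \<phi> (e N ` {..<t} \<union> (\<lambda>j. u (Suc (2 * j))) ` J)"
      by (elim exE conjE)
    have uM: "\<forall>i. u i \<in> tuples m (univ MM)" using u M by (auto simp: tuples_def)
    have "FC x u" if "x \<in> H" for x
    proof -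
      let ?C = "u ` (\<lambda>i. 2 * i) ` {..<x}"
      have "x < h" using h that by blast
      then have "?C \<subseteq> b ` S" using ub by auto
      then have "(\<lambda>c. (\<phi>, c)) ` ?C \<subseteq> (\<lambda>c. (\<phi>, c)) ` b ` S" by (rule image_mono)
      also have "\<dots> \<subseteq> p" using p(2) by auto
      finally have "(\<lambda>c. (\<phi>, c)) ` ?C \<subseteq> p" .
      from consistent_mono[OF p(1) this] show ?thesis by (simp add: consistent_jointly FC_def)
    qed
    moreover have "FI I u" if "I \<in> Y" for I
    proof -
      \<comment> \<open>With \<open>t = 0\<close> the invariant no longer mentions a Morley
        sequence.\<close>
      have "I \<subseteq> {..<h}" "card I + 0 = K" using h that Y(1) by (auto simp: D_def)
      moreover obtain N0 where "N0 \<in> S'" using positive_nonempty[OF S'] by blast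
      ultimately have "\<not> jointly n \<phi> (e N0 ` {..<0} \<union> (\<lambda>j. u (Suc (2 * j))) ` I)" using inv by blast
      then show ?thesis by (simp add: FI_def image_image)
    qed
    ultimately have "\<forall>Q\<in>FC ` H \<union> FI ` Y. Q u" by auto
    then have uG: "\<forall>Q\<in>G. Q u" unfolding H(2)[symmetric] Y(3)[symmetric] by blast
    have uX: "sat MM (u (0 + 2 * i) @ Rv u (0 + 2 * i)) \<chi> \<longleftrightarrow> sat MM (u (Suc (0 + 2 * i)) @ Rv u (0 + 2 * i)) \<chi>"
      if "(i, \<chi>) \<in> X" "is_fm L (Suc (0 + 2 * i) * m) \<chi>" for i \<chi>
    proof -
      have "i < h" using h[of i] that(1) by force
      then show ?thesis using ueq that by simp
    qed
    show "\<exists>u. (\<forall>i. u i \<in> tuples m (univ MM)) \<and> (\<forall>Q\<in>G. Q u) \<and>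
      (\<forall>i \<chi>. (i, \<chi>) \<in> X \<longrightarrow> is_fm L (Suc (0 + 2 * i) * m) \<chi> \<longrightarrow>
        (sat MM (u (0 + 2 * i) @ Rv u (0 + 2 * i)) \<chi> \<longleftrightarrow> sat MM (u (Suc (0 + 2 * i)) @ Rv u (0 + 2 * i)) \<chi>))"
      using uM uG uX by (intro exI[of _ u] conjI allI impI) simp_all
  qed
  then obtain u where u1: "\<forall>i. u i \<in> tuples m (univ MM)" and uQ: "\<forall>Q\<in>range FC \<union> FI ` D. Q u"
    and ex: "\<forall>i. \<exists>\<sigma>. automorphism L MM \<sigma> \<and> (\<forall>j<0 + 2 * i. map \<sigma> (u j) = u j) \<and>
      map \<sigma> (u (0 + 2 * i)) = u (Suc (0 + 2 * i))" by (elim exE conjE)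
  have uF: "FC h u" "I \<in> D \<Longrightarrow> FI I u" for h I using uQ by (simp_all add: ball_Un)
  have "array n \<phi> m 0 K h u" for h
    unfolding array_def
  proof (intro conjI allI impI)
    show "u i \<in> tuples m (univ MM)" for i using u1 by simp
    show "\<exists>\<sigma>. automorphism L MM \<sigma> \<and> (\<forall>j<0 + 2 * i. map \<sigma> (u j) = u j) \<and>
      map \<sigma> (u (0 + 2 * i)) = u (Suc (0 + 2 * i))" for i using ex by blast
    show "jointly n \<phi> (u ` ({..<0} \<union> (\<lambda>i. 0 + 2 * i) ` {..<h}))" using uF(1)[of h] by (simp add: FC_def)
    show "\<not> jointly n \<phi> (u ` ({..<0} \<union> (\<lambda>i. Suc (0 + 2 * i)) ` I))" if "I \<subseteq> {..<h}" "card I = K" for I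
      using uF(2)[of I] that finite_subset[of I "{..<h}"] by (simp add: FI_def D_def)
  qed
  then show ?thesis using SOP1_of_arrays[OF fm] by blast
qed

end

section \<open>The club of good submodels\<close>

theorem theorem3p2:
  fixes L :: "('f, 'r) lang" and T :: "('f, 'r) fm set"
    and \<kappa> :: "'k rel" and MM :: "('f, 'r, 'a) struct"
    and M :: "'a set" and n :: nat and p :: "('f, 'r, 'a) pfm set"
  assumes "complete_theory L T"
    and "monster L T \<kappa> MM"
    and "NSOP1 L MM"
    and "small_model L T \<kappa> MM M"
    and "p \<in> complete_types L MM n M"
  shows "\<exists>C. club M (theory_card L) C \<and>
    C \<subseteq> {N \<in> subsets_of_card M (theory_card L).
           elem_substruct L (restr MM N) (restr MM M) \<and> \<not> type_Kim_divides L MM n N p}"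
proof -
  interpret monster_model L T \<kappa> MM by unfold_locales (rule assms(2))
  let ?\<mu> = "theory_card L"
  have elM: "elem_substruct L (restr MM M) MM" using assms(4) by (simp add: small_model_def)
  then have MU: "M \<subseteq> univ MM" by (simp add: elem_substruct_def)
  obtain F where F: "small_fun M ?\<mu> F" and el: "\<And>N. N \<in> closed_sets M ?\<mu> F \<Longrightarrow>
    elem_substruct L (restr MM N) MM \<and> elem_substruct L (restr MM N) (restr MM M)"
    using closed_elementary[OF elM] by blast
  let ?bad = "{N. type_Kim_divides L MM n N p}"
  have "\<not> positive M ?\<mu> ?bad"
  proof
    assume "positive M ?\<mu> ?bad"
    \<comment> \<open>Coheirs are available over elementary submodels, and positivity survives the
      restriction to these.\<close>
    from positive_Int_closed[OF this F]
    have S0: "positive M ?\<mu> (?bad \<inter> closed_sets M ?\<mu> F)" (is "positive _ _ ?S") .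
    have pf: "is_fm L (n + length b) \<phi>" "set b \<subseteq> M" if "(\<phi>, b) \<in> p" for \<phi> b
      using assms(5) that by (auto simp: complete_types_def pfms_def)
    have "\<exists>\<phi> b U e K. (\<phi>, b) \<in> p \<and> coheir_witness n \<phi> N b U e K" if N: "N \<in> ?S" for N
    proof -
      have "(card_of N, ?\<mu>) \<in> ordIso" using N by (simp add: closed_sets_def subsets_of_card_def)
      then have small: "(card_of N, \<kappa>) \<in> ordLess" using theory_card_less by (rule ordIso_ordLess_trans)
      obtain \<phi> b where d: "(\<phi>, b) \<in> p" "Kim_divides L MM n N (\<phi>, b)"
        using N by (auto simp: type_Kim_divides_def)
      have "set b \<subseteq> univ MM" using pf(2)[OF d(1)] MU by blast
      from Kim_divides_coheir[OF assms(3) _ small pf(1)[OF d(1)] this d(2)] el N d(1) show ?thesis by blast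
    qed
    then obtain \<phi> b U e K where
      w: "\<And>N. N \<in> ?S \<Longrightarrow> (\<phi> N, b N) \<in> p \<and> coheir_witness n (\<phi> N) N (b N) (U N) (e N) (K N)"
      by metis
    \<comment> \<open>The formula, the length of its parameter and the constant \<open>K\<close>
      each take at most |T| values, so they can be fixed; \<open>b N\<close>, \<open>U N\<close> and
      \<open>e N\<close> still vary with \<open>N\<close>.\<close>
    have "(card_of {\<phi>. \<exists>n. is_fm L n \<phi>}, ?\<mu>) \<in> ordLeq"
      unfolding theory_card_def by (rule ordLeq_reflexive[OF card_of_Well_order])
    from positive_colour[OF S0 this, of \<phi>] w pf obtain \<psi>
      where "positive M ?\<mu> {N \<in> ?S. \<phi> N = \<psi>}" by blast
    from positive_colour[OF this nat_le, of "\<lambda>N. length (b N)"] obtain m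
      where "positive M ?\<mu> {N \<in> {N \<in> ?S. \<phi> N = \<psi>}. length (b N) = m}" by blast
    from positive_colour[OF this nat_le, of K] obtain k
      where S1: "positive M ?\<mu> {N \<in> {N \<in> {N \<in> ?S. \<phi> N = \<psi>}. length (b N) = m}. K N = k}"
        (is "positive _ _ ?S1") by blast
    obtain N0 where N0: "N0 \<in> ?S1" using positive_nonempty[OF S1] by blast
    have "\<not> NSOP1 L MM"
    proof (rule SOP1_of_positive[OF S1 _ MU])
      show "is_fm L (n + m) \<psi>" using w[of N0] pf(1) N0 by auto
      show "consistent MM n p" using assms(5) by (simp add: complete_types_def)
      have "N \<subseteq> M \<and> (\<psi>, b N) \<in> p \<and> b N \<in> tuples m M \<and> coheir_witness n \<psi> N (b N) (U N) (e N) k"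
        if N: "N \<in> ?S1" for N
      proof -
        have "N \<in> ?S" using N by blast
        from w[OF this] N pf(2) show ?thesis
          by (auto simp: tuples_def closed_sets_def subsets_of_card_def)
      qed
      then show "\<forall>N\<in>?S1. N \<subseteq> M" "\<forall>N\<in>?S1. b N \<in> tuples m M" "\<forall>N\<in>?S1. (\<psi>, b N) \<in> p"
        "\<forall>N\<in>?S1. coheir_witness n \<psi> N (b N) (U N) (e N) k" by blast+
    qed
    then show False using assms(3) by blast
  qed
  then obtain G where G: "small_fun M ?\<mu> G" "closed_sets M ?\<mu> G \<inter> ?bad = {}"
    unfolding positive_def by blast
  \<comment> \<open>A single condition ensures both elementarity and the absence of
    Kim-dividing.\<close>
  let ?H = "\<lambda>d. F d \<union> G d"
  have "small_fun M ?\<mu> ?H" using F G(1) by (simp add: small_fun_def Un_le)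
  then have "club M ?\<mu> (closed_sets M ?\<mu> ?H)" by (rule club_closed_sets)
  moreover have "closed_sets M ?\<mu> ?H \<subseteq> closed_sets M ?\<mu> F \<inter> closed_sets M ?\<mu> G"
    by (auto simp: closed_sets_def)
  moreover have "closed_sets M ?\<mu> F \<subseteq> subsets_of_card M ?\<mu>" by (auto simp: closed_sets_def)
  ultimately show ?thesis using el G(2) by (intro exI[of _ "closed_sets M ?\<mu> ?H"]) blast
qed

end
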